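(* Let $\mathfrak g$ be a simple complex Lie algebra from one of the series $A_\ell,B_\ell,C_\ell,D_\ell$, let $q>0$, $q\ne1$, and let $\mathcal U=\mathcal U_q(\mathfrak g)$ (with generators the entries of $L^{+},L^{-}$), the algebra $\mathcal C$ (with generators arranged in the matrix $Z^\ast$), the action $\xi$ of $\mathcal U$ on $\mathcal C$ and the matrix $K$ be as described in the context. Let $D$ be a complex diagonal $N\times N$ matrix such that $$\det(D)=1\quad\text{and}\quad K_{12}D_1D_2=K_{12}.$$ Then there exists a linear mapping $\varphi:\mathcal U\to\mathcal C$ with the values on the generators $$\varphi(L^{+})=D^{-1},\qquad \varphi(L^{-})=Z^\ast D^2(Z^\ast)^{-1}D^{-1},$$ and satisfying $\varphi(1)=1$ and $\varphi(xy)=(\xi_{x_{(1)}}\cdot\varphi(y))\,\varphi(x_{(2)})$ for all $x,y\in\mathcal U$. Consequently $x\cdot f:=(\xi_{x_{(1)}}\cdot f)\,\varphi(x_{(2)})$ defines a left action of $\mathcal U$ on $\mathcal C$, and $x\cdot1=\varphi(x)$ for all $x\in\mathcal U$.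
   Context: Matrix conventions: for an $N\times N$ matrix $A$, $A_1=A\otimes\mathbb I$, $A_2=\mathbb I\otimes A$; an $N^2\times N^2$ matrix $M=M_{12}$ has entries $M_{jk,st}$ (row $(j,k)$, column $(s,t)$), $M_{21}=PM_{12}P$ with the flip $P_{jk,st}=\delta_{jt}\delta_{ks}$. Maps such as $\varphi$ and $\xi$ are applied to matrices entrywise. $e_{ij}$ are the matrix units. Sweedler's notation $\Delta x=x_{(1)}\otimes x_{(2)}$ is used. R-matrix. $N$ is the dimension of the vector representation: $N=\ell+1$ for $A_\ell$, $2\ell+1$ for $B_\ell$, $2\ell$ for $C_\ell,D_\ell$. For $A_\ell$, $$R=q\sum_i e_{ii}\otimes e_{ii}+\sum_{i\ne j}e_{ii}\otimes e_{jj}+(q-q^{-1})\sum_{i>j}e_{ij}\otimes e_{ji}.$$ For $B_\ell,C_\ell,D_\ell$, with $i'=N+1-i$, $$R=q\sum_{i\neq i'}e_{ii}\otimes e_{ii}+\sum_{i=i'}e_{ii}\otimes e_{ii}+\sum_{i\ne j,j'}e_{ii}\otimes e_{jj}+q^{-1}\sum_{i\ne i'}e_{i'i'}\otimes e_{ii}+(q-q^{-1})\sum_{i>j}\bigl(e_{ij}\otimes e_{ji}-q^{\rho_i-\rho_j}\epsilon_i\epsilon_j\,e_{ij}\otimes e_{i'j'}\bigr),$$ where $\epsilon_i=1$ for $B_\ell,D_\ell$, while for $C_\ell$ $\epsilon_i=1$ for $i\le\ell$ and $\epsilon_i=-1$ for $i>\ell$; $(\rho_1,\dots,\rho_N)$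 equals $(\ell-\tfrac12,\dots,\tfrac12,0,-\tfrac12,\dots,-\ell+\tfrac12)$ for $B_\ell$, $(\ell,\dots,1,-1,\dots,-\ell)$ for $C_\ell$, $(\ell-1,\dots,1,0,0,-1,\dots,-\ell+1)$ for $D_\ell$. The matrix $K=K_{12}$ is defined by $R_{12}-R_{21}^{-1}=(q-q^{-1})(P-K_{12})$; $K=0$ for $A_\ell$, and $K_{jk,st}=C^t_{jk}C^{-1}_{st}$ with $C_{ij}=\epsilon_i\delta_{ij'}q^{\rho_j}$ for $B_\ell,C_\ell,D_\ell$. Set $Q:=\operatorname{diag}(R)$, the diagonal part of $R$. The bialgebra $\mathcal U=\mathcal U_q(\mathfrak g)$ (Faddeev–Reshetikhin–Takhtajan form): the unital algebra generated by the entries of an upper triangular matrix $L^{+}$ and a lower triangular matrix $L^{-}$ of size $N\times N$ with defining relations $$R_{12}L^{\pm}_2L^{\pm}_1=L^{\pm}_1L^{\pm}_2R_{12},\quad R_{12}L^{+}_2L^{-}_1=L^{-}_1L^{+}_2R_{12},\quad \operatorname{diag}(L^{+})\operatorname{diag}(L^{-})=\operatorname{diag}(L^{-})\operatorname{diag}(L^{+})=\mathbb I,\quad \det(L^{+})=1,$$ where $\det(L^+)$ is the product of the diagonal entries, and, for $B_\ell,C_\ell,D_\ell$, also $K_{12}L^{\pm}_2L^{\pm}_1=K_{12}$. The comultiplication and counit are $\Delta(L^\pm_{ij})=\sum_kL^\pm_{ik}\otimes L^\pm_{kj}$, $\varepsilon(L^\pm)=\mathbb I$. The algebra $\mathcal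 C$ (antiholomorphic quantized big cell of the generic coadjoint orbit): the unital algebra generated by $z^\ast_{jk}$, $1\le j<k\le N$, arranged in the lower triangular matrix $Z^\ast$ with units on the diagonal and $(Z^\ast)_{kj}=z^\ast_{jk}$ for $j<k$, with the defining relation $$R_{12}Z^\ast_2QZ^\ast_1Q^{-1}=Z^\ast_1QZ^\ast_2Q^{-1}R_{12}.$$ The action $\xi$: $\mathcal C$ is a left $\mathcal U$-module with action $x\otimes f\mapsto\xi_x\cdot f=\xi(x)\cdot f$ satisfying $\xi_x\cdot1=\varepsilon(x)1$ and $\xi_x\cdot(fg)=(\xi_{x_{(1)}}\cdot f)(\xi_{x_{(2)}}\cdot g)$, and determined on generators by $$\xi(L^{+}_1)\cdot Z^\ast_2=R_{21}^{-1}Z^\ast_2Q,\qquad \xi(L^{-}_1)\cdot Z^\ast_2=Z^\ast_1QZ^\ast_2Q^{-1}(Z^\ast_1)^{-1},$$ where the $(jk,st)$ entry of $\xi(L^\pm_1)\cdot Z^\ast_2$ is $\xi(L^\pm_{js})\cdot (Z^\ast)_{kt}$. *)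

theory Defs
  imports
    "HOL-Library.Poly_Mapping"
    "HOL-Library.Product_Plus"
    "HOL-Algebra.QuotRing"
    "HOL-Algebra.Module"
    "Jordan_Normal_Form.Determinant"
begin

section \<open>Matrices over a finite index set\<close>

text \<open>
  The size $N$ depends on the rank and on the series, so matrices are functions of two indices,
  read on an explicit index set: $\{1,\dots,N\}$ for $N\times N$ matrices, pairs of such indices
  for $N^2\times N^2$ matrices. The entry $M_{jk,st}$ is \<open>M (j, k) (s, t)\<close>. The entries may lie
  in a noncommutative ring.
\<close>

type_synonym ('i, 'a) mx = "'i \<Rightarrow> 'i \<Rightarrow> 'a"

definition mx_eq :: "'i set \<Rightarrow> ('i, 'a) mx \<Rightarrow> ('i, 'a) mx \<Rightarrow> bool" where
  "mx_eq I A B \<longleftrightarrow> (\<forall>i\<in>I. \<forall>j\<in>I. A i j = B i j)"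

definition mx_one :: "('i, 'a::zero_neq_one) mx" where
  "mx_one = (\<lambda>i j. if i = j then 1 else 0)"

definition mx_mult :: "'i set \<Rightarrow> ('i, 'a::semiring_0) mx \<Rightarrow> ('i, 'a) mx \<Rightarrow> ('i, 'a) mx" where
  "mx_mult I A B = (\<lambda>i j. \<Sum>k\<in>I. A i k * B k j)"

definition mx_prod :: "'i set \<Rightarrow> ('i, 'a::ring_1) mx list \<Rightarrow> ('i, 'a) mx" where
  "mx_prod I As = foldr (mx_mult I) As mx_one"

text \<open>The two-sided inverse; the values outside the index set are fixed to make it unique.\<close>

definition mx_inv :: "'i set \<Rightarrow> ('i, 'a::ring_1) mx \<Rightarrow> ('i, 'a) mx" where
  "mx_inv I A = (THE B. mx_eq I (mx_mult I A B) mx_one \<and> mx_eq I (mx_mult I B A) mx_one \<and>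
     (\<forall>i j. i \<notin> I \<or> j \<notin> I \<longrightarrow> B i j = 0))"

definition mx_diag :: "('i, 'a::zero) mx \<Rightarrow> ('i, 'a) mx" where
  "mx_diag A = (\<lambda>i j. if i = j then A i j else 0)"

definition mx_unit :: "'i \<Rightarrow> 'i \<Rightarrow> ('i, 'a::zero_neq_one) mx" where
  "mx_unit i j = (\<lambda>a b. if a = i \<and> b = j then 1 else 0)"

definition kron :: "('i, 'a::times) mx \<Rightarrow> ('j, 'a) mx \<Rightarrow> ('i \<times> 'j, 'a) mx" where
  "kron A B = (\<lambda>(j, k) (s, t). A j s * B k t)"

definition mx_1 :: "('i, 'a::ring_1) mx \<Rightarrow> ('i \<times> 'i, 'a) mx" where
  "mx_1 A = kron A mx_one"

definition mx_2 :: "('i, 'a::ring_1) mx \<Rightarrow> ('i \<times> 'i, 'a) mx" where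
  "mx_2 A = kron mx_one A"

definition mx_flip :: "('i \<times> 'i, 'a::ring_1) mx" where
  "mx_flip = (\<lambda>(j, k) (s, t). if j = t \<and> k = s then 1 else 0)"

definition mx_21 :: "('i \<times> 'i) set \<Rightarrow> ('i \<times> 'i, 'a::ring_1) mx \<Rightarrow> ('i \<times> 'i, 'a) mx" where
  "mx_21 J M = mx_prod J [mx_flip, M, mx_flip]"

section \<open>The R-matrix\<close>

datatype series = TypeA | TypeB | TypeC | TypeD

text \<open>
  The ranks for which the Lie algebra is simple; the coincidences in low rank
  ($B_1=C_1=A_1$, $C_2=B_2$, $D_3=A_3$) are not excluded.
\<close>

fun simple_type :: "series \<Rightarrow> nat \<Rightarrow> bool" where
  "simple_type TypeA l \<longleftrightarrow> 1 \<le> l"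
| "simple_type TypeB l \<longleftrightarrow> 1 \<le> l"
| "simple_type TypeC l \<longleftrightarrow> 1 \<le> l"
| "simple_type TypeD l \<longleftrightarrow> 3 \<le> l"

fun vdim :: "series \<Rightarrow> nat \<Rightarrow> nat" where
  "vdim TypeA l = l + 1"
| "vdim TypeB l = 2 * l + 1"
| "vdim TypeC l = 2 * l"
| "vdim TypeD l = 2 * l"

definition idx :: "series \<Rightarrow> nat \<Rightarrow> nat set" where
  "idx s l = {1..vdim s l}"

definition idx2 :: "series \<Rightarrow> nat \<Rightarrow> (nat \<times> nat) set" where
  "idx2 s l = idx s l \<times> idx s l"

definition prm :: "series \<Rightarrow> nat \<Rightarrow> nat \<Rightarrow> nat" where
  "prm s l i = vdim s l + 1 - i"

fun eps :: "series \<Rightarrow> nat \<Rightarrow> nat \<Rightarrow> real" where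
  "eps TypeC l i = (if i \<le> l then 1 else - 1)"
| "eps _ l i = 1"

text \<open>No $\rho$ is attached to the series A; the value given there is never used.\<close>

fun rho :: "series \<Rightarrow> nat \<Rightarrow> nat \<Rightarrow> real" where
  "rho TypeA l i = 0"
| "rho TypeB l i = (if i \<le> l then real l + 1/2 - real i
                else if i = l + 1 then 0 else real l + 3/2 - real i)"
| "rho TypeC l i = (if i \<le> l then real l + 1 - real i else real l - real i)"
| "rho TypeD l i = (if i \<le> l then real l - real i else real l + 1 - real i)"

definition R_typeA :: "nat \<Rightarrow> real \<Rightarrow> (nat \<times> nat, real) mx" where
  "R_typeA l q = (let I = idx TypeA l; e = mx_unit in (\<lambda>r c.
      q * (\<Sum>i\<in>I. kron (e i i) (e i i) r c)
    + (\<Sum>i\<in>I. \<Sum>j | j \<in> I \<and> i \<noteq> j. kron (e i i) (e j j) r c)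
    + (q - 1 / q) * (\<Sum>i\<in>I. \<Sum>j | j \<in> I \<and> i > j. kron (e i j) (e j i) r c)))"

definition R_typeBCD :: "series \<Rightarrow> nat \<Rightarrow> real \<Rightarrow> (nat \<times> nat, real) mx" where
  "R_typeBCD s l q = (let I = idx s l; p = prm s l; e = mx_unit in (\<lambda>r c.
      q * (\<Sum>i | i \<in> I \<and> i \<noteq> p i. kron (e i i) (e i i) r c)
    + (\<Sum>i | i \<in> I \<and> i = p i. kron (e i i) (e i i) r c)
    + (\<Sum>i\<in>I. \<Sum>j | j \<in> I \<and> i \<noteq> j \<and> i \<noteq> p j. kron (e i i) (e j j) r c)
    + 1 / q * (\<Sum>i | i \<in> I \<and> i \<noteq> p i. kron (e (p i) (p i)) (e i i) r c)
    + (q - 1 / q) * (\<Sum>i\<in>I. \<Sum>j | j \<in> I \<and> i > j.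
          kron (e i j) (e j i) r c
        - q powr (rho s l i - rho s l j) * eps s l i * eps s l j
            * kron (e i j) (e (p i) (p j)) r c)))"

definition R_mx :: "series \<Rightarrow> nat \<Rightarrow> real \<Rightarrow> (nat \<times> nat, complex) mx" where
  "R_mx s l q = (\<lambda>r c. complex_of_real
     (if s = TypeA then R_typeA l q r c else R_typeBCD s l q r c))"

definition Q_mx :: "series \<Rightarrow> nat \<Rightarrow> real \<Rightarrow> (nat \<times> nat, complex) mx" where
  "Q_mx s l q = mx_diag (R_mx s l q)"

definition Qinv_mx :: "series \<Rightarrow> nat \<Rightarrow> real \<Rightarrow> (nat \<times> nat, complex) mx" where
  "Qinv_mx s l q = mx_inv (idx2 s l) (Q_mx s l q)"

definition R21inv_mx :: "series \<Rightarrow> nat \<Rightarrow> real \<Rightarrow> (nat \<times> nat, complex) mx" where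
  "R21inv_mx s l q = mx_inv (idx2 s l) (mx_21 (idx2 s l) (R_mx s l q))"

text \<open>$K$ is defined by $R_{12} - R_{21}^{-1} = (q - q^{-1})(P - K)$, where $q\ne q^{-1}$.\<close>

definition K_mx :: "series \<Rightarrow> nat \<Rightarrow> real \<Rightarrow> (nat \<times> nat, complex) mx" where
  "K_mx s l q = (\<lambda>r c. mx_flip r c
     - (R_mx s l q r c - R21inv_mx s l q r c) / complex_of_real (q - 1 / q))"

section \<open>Free algebras and algebras given by generators and relations\<close>

text \<open>
  Words form the free monoid, written additively as \<^theory>\<open>HOL-Library.Poly_Mapping\<close> requires.
  Thus \<open>'g word \<Rightarrow>\<^sub>0 complex\<close> with its convolution product is the free associative unital
  complex algebra on \<open>'g\<close>, and \<open>('g word \<times> 'g word) \<Rightarrow>\<^sub>0 complex\<close> is its tensor square,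
  the pair \<open>(u, v)\<close> standing for $u\otimes v$.
\<close>

datatype 'g word = Word (letters: "'g list")

instantiation word :: (type) monoid_add
begin

definition zero_word :: "'a word" where "zero_word = Word []"

definition plus_word :: "'a word \<Rightarrow> 'a word \<Rightarrow> 'a word" where
  "plus_word u v = Word (letters u @ letters v)"

instance
  by standard (simp_all add: zero_word_def plus_word_def)

end

type_synonym 'g falg = "'g word \<Rightarrow>\<^sub>0 complex"
type_synonym 'g falg2 = "('g word \<times> 'g word) \<Rightarrow>\<^sub>0 complex"

definition gen :: "'g \<Rightarrow> 'g falg" where
  "gen g = Poly_Mapping.single (Word [g]) 1"

definition const :: "complex \<Rightarrow> ('w::monoid_add \<Rightarrow>\<^sub>0 complex)" where
  "const c = Poly_Mapping.single 0 c"

definition const_mx :: "('i, complex) mx \<Rightarrow> ('i, 'w::monoid_add \<Rightarrow>\<^sub>0 complex) mx" where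
  "const_mx M = (\<lambda>i j. const (M i j))"

definition tens :: "'g falg \<Rightarrow> 'g falg \<Rightarrow> 'g falg2" where
  "tens a b = (\<Sum>u\<in>Poly_Mapping.keys a. \<Sum>v\<in>Poly_Mapping.keys b.
     Poly_Mapping.single (u, v) (Poly_Mapping.lookup a u * Poly_Mapping.lookup b v))"

text \<open>The homomorphism of unital algebras with prescribed values \<open>f\<close> on the generators, where
  \<open>\<iota>\<close> embeds the scalars into the target algebra.\<close>

definition free_hom :: "(complex \<Rightarrow> 'b::ring_1) \<Rightarrow> ('g \<Rightarrow> 'b) \<Rightarrow> 'g falg \<Rightarrow> 'b" where
  "free_hom \<iota> f p = (\<Sum>w\<in>Poly_Mapping.keys p.
     \<iota> (Poly_Mapping.lookup p w) * prod_list (map f (letters w)))"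

definition free_algebra :: "'g set \<Rightarrow> (complex, 'g falg) module" where
  "free_algebra G = \<lparr>carrier = {p. \<forall>w\<in>Poly_Mapping.keys p. set (letters w) \<subseteq> G},
     monoid.mult = (*), one = 1, zero = 0, add = (+), module.smult = (\<lambda>c p. const c * p)\<rparr>"

definition presented_algebra :: "'g set \<Rightarrow> 'g falg set \<Rightarrow> (complex, 'g falg set) module" where
  "presented_algebra G S =
    (let F = free_algebra G; I = genideal F S; FI = F Quot I in
     \<lparr>carrier = carrier FI, monoid.mult = monoid.mult FI, one = one FI, zero = zero FI, add = add FI,
      module.smult = (\<lambda>c X. \<Union>x\<in>X. I +>\<^bsub>F\<^esub> (c \<odot>\<^bsub>F\<^esub> x))\<rparr>)"

definition cls :: "'g set \<Rightarrow> 'g falg set \<Rightarrow> 'g falg \<Rightarrow> 'g falg set" where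
  "cls G S x = genideal (free_algebra G) S +>\<^bsub>free_algebra G\<^esub> x"

text \<open>The relators expressing an equality of two matrices.\<close>

definition mx_rel :: "'i set \<Rightarrow> ('i, 'a::minus) mx \<Rightarrow> ('i, 'a) mx \<Rightarrow> 'a set" where
  "mx_rel I A B = {A i j - B i j | i j. i \<in> I \<and> j \<in> I}"

definition is_linear :: "(complex, 'a) module \<Rightarrow> (complex, 'b) module \<Rightarrow> ('a \<Rightarrow> 'b) \<Rightarrow> bool" where
  "is_linear V W f \<longleftrightarrow> f \<in> carrier V \<rightarrow> carrier W \<and>
     (\<forall>x\<in>carrier V. \<forall>y\<in>carrier V. f (x \<oplus>\<^bsub>V\<^esub> y) = f x \<oplus>\<^bsub>W\<^esub> f y) \<and>
     (\<forall>c. \<forall>x\<in>carrier V. f (c \<odot>\<^bsub>V\<^esub> x) = c \<odot>\<^bsub>W\<^esub> f x)"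

definition is_left_action ::
  "(complex, 'a) module \<Rightarrow> (complex, 'b) module \<Rightarrow> ('a \<Rightarrow> 'b \<Rightarrow> 'b) \<Rightarrow> bool" where
  "is_left_action U V act \<longleftrightarrow>
     (\<forall>x\<in>carrier U. is_linear V V (act x)) \<and>
     (\<forall>f\<in>carrier V. is_linear U V (\<lambda>x. act x f)) \<and>
     (\<forall>f\<in>carrier V. act \<one>\<^bsub>U\<^esub> f = f) \<and>
     (\<forall>x\<in>carrier U. \<forall>y\<in>carrier U. \<forall>f\<in>carrier V.
        act (x \<otimes>\<^bsub>U\<^esub> y) f = act x (act y f))"

section \<open>The bialgebra $\mathcal U$\<close>

datatype ugen = LP nat nat | LM nat nat

definition Lplus :: "(nat, ugen falg) mx" where
  "Lplus = (\<lambda>i j. if i \<le> j then gen (LP i j) else 0)"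

definition Lminus :: "(nat, ugen falg) mx" where
  "Lminus = (\<lambda>i j. if j \<le> i then gen (LM i j) else 0)"

definition U_gens :: "series \<Rightarrow> nat \<Rightarrow> ugen set" where
  "U_gens s l = {LP i j | i j. i \<in> idx s l \<and> j \<in> idx s l \<and> i \<le> j}
              \<union> {LM i j | i j. i \<in> idx s l \<and> j \<in> idx s l \<and> j \<le> i}"

definition U_rels :: "series \<Rightarrow> nat \<Rightarrow> real \<Rightarrow> ugen falg set" where
  "U_rels s l q =
    (let I = idx s l; J = idx2 s l; R = const_mx (R_mx s l q); K = const_mx (K_mx s l q);
         Lp1 = mx_1 Lplus; Lp2 = mx_2 Lplus; Lm1 = mx_1 Lminus; Lm2 = mx_2 Lminus in
       mx_rel J (mx_prod J [R, Lp2, Lp1]) (mx_prod J [Lp1, Lp2, R])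
     \<union> mx_rel J (mx_prod J [R, Lm2, Lm1]) (mx_prod J [Lm1, Lm2, R])
     \<union> mx_rel J (mx_prod J [R, Lp2, Lm1]) (mx_prod J [Lm1, Lp2, R])
     \<union> mx_rel I (mx_prod I [mx_diag Lplus, mx_diag Lminus]) mx_one
     \<union> mx_rel I (mx_prod I [mx_diag Lminus, mx_diag Lplus]) mx_one
     \<union> {prod_list (map (\<lambda>i. Lplus i i) [1..<vdim s l + 1]) - 1}
     \<union> (if s = TypeA then {}
        else mx_rel J (mx_prod J [K, Lp2, Lp1]) K \<union> mx_rel J (mx_prod J [K, Lm2, Lm1]) K))"

definition U_free :: "series \<Rightarrow> nat \<Rightarrow> (complex, ugen falg) module" where
  "U_free s l = free_algebra (U_gens s l)"

definition U_alg :: "series \<Rightarrow> nat \<Rightarrow> real \<Rightarrow> (complex, ugen falg set) module" where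
  "U_alg s l q = presented_algebra (U_gens s l) (U_rels s l q)"

definition U_cls :: "series \<Rightarrow> nat \<Rightarrow> real \<Rightarrow> ugen falg \<Rightarrow> ugen falg set" where
  "U_cls s l q = cls (U_gens s l) (U_rels s l q)"

text \<open>Comultiplication and counit of $\mathcal U$ on representatives in the free algebra.\<close>

definition comult :: "series \<Rightarrow> nat \<Rightarrow> ugen falg \<Rightarrow> ugen falg2" where
  "comult s l = free_hom const (\<lambda>g. case g of
       LP i j \<Rightarrow> \<Sum>k\<in>idx s l. tens (Lplus i k) (Lplus k j)
     | LM i j \<Rightarrow> \<Sum>k\<in>idx s l. tens (Lminus i k) (Lminus k j))"

definition counit :: "ugen falg \<Rightarrow> complex" where
  "counit = free_hom id (\<lambda>g. case g of
       LP i j \<Rightarrow> if i = j then 1 else 0 | LM i j \<Rightarrow> if i = j then 1 else 0)"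

text \<open>
  The Sweedler sum $\beta(x_{(1)},x_{(2)})$, with values in \<open>W\<close>, for a bilinear map \<open>\<beta>\<close> on
  $\mathcal U\times\mathcal U$ and the element $x$ of $\mathcal U$ represented by \<open>a\<close>:
  if \<open>comult s l a\<close> is $\sum c_{uv}\,u\otimes v$, then $\Delta x=\sum c_{uv}[u]\otimes[v]$.
\<close>

definition sweedler :: "series \<Rightarrow> nat \<Rightarrow> real \<Rightarrow> (complex, 'w) module \<Rightarrow>
    (ugen falg set \<Rightarrow> ugen falg set \<Rightarrow> 'w) \<Rightarrow> ugen falg \<Rightarrow> 'w" where
  "sweedler s l q W \<beta> a = (\<Oplus>\<^bsub>W\<^esub> p \<in> Poly_Mapping.keys (comult s l a).
     Poly_Mapping.lookup (comult s l a) p \<odot>\<^bsub>W\<^esub>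
       \<beta> (U_cls s l q (Poly_Mapping.single (fst p) 1))
         (U_cls s l q (Poly_Mapping.single (snd p) 1)))"

section \<open>The algebra $\mathcal C$ and the action $\xi$\<close>

text \<open>The generator \<open>(j, k)\<close> is $z^\ast_{jk}$.\<close>

definition C_gens :: "series \<Rightarrow> nat \<Rightarrow> (nat \<times> nat) set" where
  "C_gens s l = {(j, k). j \<in> idx s l \<and> k \<in> idx s l \<and> j < k}"

definition Zstar :: "(nat, (nat \<times> nat) falg) mx" where
  "Zstar = (\<lambda>k j. if j < k then gen (j, k) else if j = k then 1 else 0)"

definition C_rels :: "series \<Rightarrow> nat \<Rightarrow> real \<Rightarrow> (nat \<times> nat) falg set" where
  "C_rels s l q =
    (let J = idx2 s l; R = const_mx (R_mx s l q);
         Q = const_mx (Q_mx s l q); Qi = const_mx (Qinv_mx s l q);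
         Z1 = mx_1 Zstar; Z2 = mx_2 Zstar in
     mx_rel J (mx_prod J [R, Z2, Q, Z1, Qi]) (mx_prod J [Z1, Q, Z2, Qi, R]))"

definition C_alg :: "series \<Rightarrow> nat \<Rightarrow> real \<Rightarrow> (complex, (nat \<times> nat) falg set) module" where
  "C_alg s l q = presented_algebra (C_gens s l) (C_rels s l q)"

definition C_cls :: "series \<Rightarrow> nat \<Rightarrow> real \<Rightarrow> (nat \<times> nat) falg \<Rightarrow> (nat \<times> nat) falg set" where
  "C_cls s l q = cls (C_gens s l) (C_rels s l q)"

definition is_xi :: "series \<Rightarrow> nat \<Rightarrow> real \<Rightarrow>
    (ugen falg set \<Rightarrow> (nat \<times> nat) falg set \<Rightarrow> (nat \<times> nat) falg set) \<Rightarrow> bool" where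
  "is_xi s l q \<xi> \<longleftrightarrow>
    (let U = U_alg s l q; CA = C_alg s l q; J = idx2 s l;
         Q = const_mx (Q_mx s l q); Qi = const_mx (Qinv_mx s l q);
         R21i = const_mx (R21inv_mx s l q); Z1 = mx_1 Zstar; Z2 = mx_2 Zstar in
     is_left_action U CA \<xi> \<and>
     (\<forall>a\<in>carrier (U_free s l). \<xi> (U_cls s l q a) \<one>\<^bsub>CA\<^esub> = counit a \<odot>\<^bsub>CA\<^esub> \<one>\<^bsub>CA\<^esub>) \<and>
     (\<forall>a\<in>carrier (U_free s l). \<forall>f\<in>carrier CA. \<forall>g\<in>carrier CA.
        \<xi> (U_cls s l q a) (f \<otimes>\<^bsub>CA\<^esub> g)
          = sweedler s l q CA (\<lambda>x1 x2. \<xi> x1 f \<otimes>\<^bsub>CA\<^esub> \<xi> x2 g) a) \<and>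
     (\<forall>(j, k)\<in>J. \<forall>(u, v)\<in>J.
        \<xi> (U_cls s l q (Lplus j u)) (C_cls s l q (Zstar k v))
          = C_cls s l q (mx_prod J [R21i, Z2, Q] (j, k) (u, v)) \<and>
        \<xi> (U_cls s l q (Lminus j u)) (C_cls s l q (Zstar k v))
          = C_cls s l q (mx_prod J [Z1, Q, Z2, Qi, mx_inv J Z1] (j, k) (u, v))))"

end

theory Submission
  imports Defs
begin

text \<open>
  The map $\varphi$ is recovered from the action as $\varphi(x)=x\cdot 1$, so the action is built
  first. The formula $x\cdot f=(\xi_{x_{(1)}}f)\,\varphi(x_{(2)})$ forces the generators to act by
  $T(L^\pm_{ij})f=\sum_k(\xi(L^\pm_{ik})f)\,\Phi^\pm_{kj}$, where $\Phi^+=D^{-1}$ and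
  $\Phi^-=Z^*D^2(Z^*)^{-1}D^{-1}$. These operators extend to the free algebra on the generators,
  and the point is that they satisfy the relations of $\mathcal U$.

  For $L,L'$ among $L^+,L^-$ with corresponding $\Phi,\Phi'$, multiplicativity of $\xi$ gives
  $T(L_1)T(L'_2)f=(\xi(L_1)\xi(L'_2)f)\,M_{12}$ with the cocycle
  $M_{12}=(\xi(L_1)\Phi'_2)\,\Phi_1$, which does not involve $f$ (lemma \<open>tw_tw\<close>). Since the
  operators $\xi(L)$ satisfy $RL'_2L_1=L_1L'_2R$ and $KL_2L_1=K$, the operators $T(L)$ do as soon as
  the cocycles satisfy $R\tilde M_{21}=M_{12}R$ and $KM_{21}=K$, where $\tilde M$ is the
  cocycle of $L',L$ (lemmas \<open>exchange_transfer\<close>, \<open>absorb_transfer\<close>).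

  The cocycles are computed from the action on $Z^*$. The one with two factors $L^-$ is
  $M_{12}=Y_{12}\,(D_1D_2)^2\,Y_{12}^{-1}\,(D_1D_2)^{-1}$ with $Y_{12}=Z^*_1QZ^*_2Q^{-1}$
  (\<open>cocycle_minus_minus\<close>). The relation of $\mathcal C$ says $RY_{21}=Y_{12}R$; the same holds
  for $R_{21}^{-1}$ and for the flip, hence for $K$, which is a linear combination of the three
  (\<open>K_intertwines\<close>). Together with $[R,D_1D_2]=0$ and $KD_1D_2=K$ this yields both identities.
  The commutation $[R,D_1D_2]=0$ follows from $KD_1D_2=K$: by triangularity of $R$ and
  $R_{21}^{-1}$ the row $(N,1)$ of $K$ has a nonzero entry in every column $(j,j')$ with $j<N$,
  so $D_jD_{j'}=1$ (\<open>K_row_nonzero\<close>, \<open>d_pair\<close>). The relations for the diagonals and the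
  determinant hold because $\Phi^\pm$ are triangular with diagonals $D^{\mp1}$ and $\det D=1$.

  Finally $x\cdot f=(\xi_{x_{(1)}}f)\,\varphi(x_{(2)})$ holds for all words in the generators by
  induction (\<open>sweedler_word\<close>), and the equation for $\varphi(xy)$ is $(xy)\cdot1=x\cdot(y\cdot1)$.

  All computations take place in the free algebras, modulo the congruence of having the same class
  in the presented algebra, so that matrix identities can be manipulated in a ring that is a type.
\<close>

section \<open>Matrices over a finite index set, up to a congruence\<close>

lemma mx_mult_assoc:
  "mx_mult J (mx_mult J A B) C = mx_mult J A (mx_mult J B C)"
proof (intro ext)
  fix i j
  have "mx_mult J (mx_mult J A B) C i j = (\<Sum>k\<in>J. \<Sum>m\<in>J. A i m * B m k * C k j)"
    by (simp add: mx_mult_def sum_distrib_right)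
  also have "\<dots> = (\<Sum>m\<in>J. \<Sum>k\<in>J. A i m * B m k * C k j)"
    by (rule sum.swap)
  also have "\<dots> = mx_mult J A (mx_mult J B C) i j"
    by (simp add: mx_mult_def sum_distrib_left mult.assoc)
  finally show "mx_mult J (mx_mult J A B) C i j = mx_mult J A (mx_mult J B C) i j" .
qed

text \<open>
  For a matrix $M_{12}$ this is $M_{21}=PM_{12}P$, without the products with the flip.
\<close>

definition mx_swap :: "('i \<times> 'i, 'a) mx \<Rightarrow> ('i \<times> 'i, 'a) mx" where
  "mx_swap A = (\<lambda>r c. A (prod.swap r) (prod.swap c))"

lemma mx_swap_swap [simp]: "mx_swap (mx_swap A) = A"
  by (simp add: mx_swap_def)

lemma mx_swap_1 [simp]: "mx_swap (mx_1 A) = mx_2 A"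
  by (auto simp: mx_swap_def mx_1_def mx_2_def kron_def mx_one_def fun_eq_iff)

lemma mx_swap_2 [simp]: "mx_swap (mx_2 A) = mx_1 A"
  by (auto simp: mx_swap_def mx_1_def mx_2_def kron_def mx_one_def fun_eq_iff)

lemma mx_swap_one [simp]: "mx_swap mx_one = mx_one"
  by (auto simp: mx_swap_def mx_one_def fun_eq_iff)

lemma mx_swap_mult: "mx_swap (mx_mult (I \<times> I) A B) = mx_mult (I \<times> I) (mx_swap A) (mx_swap B)"
proof (intro ext)
  fix r c
  show "mx_swap (mx_mult (I \<times> I) A B) r c = mx_mult (I \<times> I) (mx_swap A) (mx_swap B) r c"
    unfolding mx_swap_def mx_mult_def
    by (rule sum.reindex_bij_witness[of _ prod.swap prod.swap]) auto
qed

lemma mx_swap_prod: "mx_swap (mx_prod (I \<times> I) As) = mx_prod (I \<times> I) (map mx_swap As)"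
  by (induction As) (simp_all add: mx_prod_def mx_swap_mult)

lemma mx_prod_simps [simp]:
  "mx_prod J [] = mx_one" "mx_prod J (A # As) = mx_mult J A (mx_prod J As)"
  by (simp_all add: mx_prod_def)

lemma mx_mult_one_right:
  fixes A :: "('i, 'a::ring_1) mx"
  shows "finite J \<Longrightarrow> mx_mult J A mx_one i j = (if j \<in> J then A i j else 0)"
  by (simp add: mx_mult_def mx_one_def if_distrib cong: if_cong)

lemma mx_mult_one_left:
  fixes A :: "('i, 'a::ring_1) mx"
  shows "finite J \<Longrightarrow> mx_mult J mx_one A i j = (if i \<in> J then A i j else 0)"
  by (simp add: mx_mult_def mx_one_def if_distrib[of "\<lambda>x. x * _"] cong: if_cong)

lemma mx_flip_mult:
  assumes "finite I" "a \<in> I" "b \<in> I"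
  shows "mx_mult (I \<times> I) mx_flip A (a, b) c = A (b, a) c"
proof -
  have "mx_mult (I \<times> I) mx_flip A (a, b) c = (\<Sum>k\<in>I \<times> I. if k = (b, a) then A k c else 0)"
    unfolding mx_mult_def by (rule sum.cong) (auto simp: mx_flip_def split: if_splits)
  with assms show ?thesis by simp
qed

lemma mx_mult_flip:
  assumes "finite I" "a \<in> I" "b \<in> I"
  shows "mx_mult (I \<times> I) A mx_flip r (a, b) = A r (b, a)"
proof -
  have "mx_mult (I \<times> I) A mx_flip r (a, b) = (\<Sum>k\<in>I \<times> I. if k = (b, a) then A r k else 0)"
    unfolding mx_mult_def by (rule sum.cong) (auto simp: mx_flip_def split: if_splits)
  with assms show ?thesis by simp
qed

text \<open>
  The congruences of interest are equality itself and equality of classes modulo the ideal of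
  relations. Matrices are compared entrywise on their index set (\<open>mxc\<close>), and products of
  matrices are compared as lists of factors (\<open>pc\<close>). The latter is a congruence on the free
  monoid of matrices, so identities can be applied inside a longer product (\<open>pc_ctx\<close>)
  without reassociating.
\<close>

locale ring_cong =
  fixes eq :: "'a::ring_1 \<Rightarrow> 'a \<Rightarrow> bool"  (infix "\<approx>" 50)
  assumes refl [simp, intro]: "a \<approx> a"
    and sym: "a \<approx> b \<Longrightarrow> b \<approx> a"
    and trans [trans]: "a \<approx> b \<Longrightarrow> b \<approx> c \<Longrightarrow> a \<approx> c"
    and add: "a \<approx> b \<Longrightarrow> c \<approx> d \<Longrightarrow> a + c \<approx> b + d"
    and mult: "a \<approx> b \<Longrightarrow> c \<approx> d \<Longrightarrow> a * c \<approx> b * d"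
begin

lemma eqI: "a = b \<Longrightarrow> a \<approx> b" by simp

lemma minus: "a \<approx> b \<Longrightarrow> - a \<approx> - b"
  using mult[OF refl[of "- 1"], of a b] by simp

lemma diff: "a \<approx> b \<Longrightarrow> c \<approx> d \<Longrightarrow> a - c \<approx> b - d"
  using add[OF _ minus[of c d], of a b] by simp

lemma diff_zero: "a - b \<approx> 0 \<longleftrightarrow> a \<approx> b"
  using diff[of a b b b] add[of "a - b" 0 b b] by auto

lemma sum: "(\<And>x. x \<in> A \<Longrightarrow> f x \<approx> g x) \<Longrightarrow> sum f A \<approx> sum g A"
  by (induction A rule: infinite_finite_induct) (auto intro: add)

definition mxc :: "'j set \<Rightarrow> ('j, 'a) mx \<Rightarrow> ('j, 'a) mx \<Rightarrow> bool" where
  "mxc J A B \<longleftrightarrow> (\<forall>i\<in>J. \<forall>j\<in>J. A i j \<approx> B i j)"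

definition pc :: "'j set \<Rightarrow> ('j, 'a) mx list \<Rightarrow> ('j, 'a) mx list \<Rightarrow> bool" where
  "pc J As Bs \<longleftrightarrow> mxc J (mx_prod J As) (mx_prod J Bs)"

lemma mxc_refl [simp, intro]: "mxc J A A" by (simp add: mxc_def)
lemma mxc_sym: "mxc J A B \<Longrightarrow> mxc J B A" by (simp add: mxc_def sym)
lemma mxc_trans [trans]: "mxc J A B \<Longrightarrow> mxc J B C \<Longrightarrow> mxc J A C"
  unfolding mxc_def by (meson trans)

lemma mx_eq_mxc: "mx_eq J A B \<Longrightarrow> mxc J A B"
  by (simp add: mx_eq_def mxc_def)

lemma mxc_mult: "mxc J A A' \<Longrightarrow> mxc J B B' \<Longrightarrow> mxc J (mx_mult J A B) (mx_mult J A' B')"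
  unfolding mxc_def mx_mult_def by (intro ballI sum mult) auto

lemma mxc_one_left: "finite J \<Longrightarrow> mxc J (mx_mult J mx_one A) A"
  by (simp add: mxc_def mx_mult_one_left)

lemma mxc_one_right: "finite J \<Longrightarrow> mxc J (mx_mult J A mx_one) A"
  by (simp add: mxc_def mx_mult_one_right)

lemma mxc_swap: "mxc (I \<times> I) A B \<Longrightarrow> mxc (I \<times> I) (mx_swap A) (mx_swap B)"
  by (auto simp: mxc_def mx_swap_def)

lemma pc_refl [simp, intro]: "pc J As As" by (simp add: pc_def)
lemma pc_sym: "pc J As Bs \<Longrightarrow> pc J Bs As" by (simp add: pc_def mxc_sym)
lemma pc_trans [trans]: "pc J As Bs \<Longrightarrow> pc J Bs Cs \<Longrightarrow> pc J As Cs"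
  unfolding pc_def by (rule mxc_trans)

lemma mx_prod_append:
  assumes "finite J"
  shows "mxc J (mx_prod J (As @ Bs)) (mx_mult J (mx_prod J As) (mx_prod J Bs))"
proof (induction As)
  case Nil
  show ?case using mxc_one_left[OF assms] by (simp add: mxc_sym)
next
  case (Cons A As)
  then show ?case by (simp add: mx_mult_assoc mxc_mult)
qed

lemma pc_append: 
  assumes J: "finite J" and "pc J As As'" "pc J Bs Bs'"
  shows "pc J (As @ Bs) (As' @ Bs')"
proof -
  have "mxc J (mx_prod J (As @ Bs)) (mx_mult J (mx_prod J As) (mx_prod J Bs))"
    by (rule mx_prod_append[OF J])
  also have "mxc J \<dots> (mx_mult J (mx_prod J As') (mx_prod J Bs'))"
    using assms(2,3) unfolding pc_def by (rule mxc_mult)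
  also have "mxc J \<dots> (mx_prod J (As' @ Bs'))"
    by (rule mxc_sym[OF mx_prod_append[OF J]])
  finally show ?thesis by (simp add: pc_def)
qed

lemma pc_ctx:
  assumes "finite J" "pc J As Bs"
  shows "pc J (us @ As @ vs) (us @ Bs @ vs)"
  using assms by (intro pc_append) auto

lemma pc_swap: "pc (I \<times> I) As Bs \<Longrightarrow> pc (I \<times> I) (map mx_swap As) (map mx_swap Bs)"
  unfolding pc_def by (drule mxc_swap) (simp add: mx_swap_prod)

lemma pc_single: "finite J \<Longrightarrow> pc J [mx_prod J As] As"
  by (simp add: pc_def mxc_one_right)

lemma mxc_prod: "list_all2 (mxc J) As Bs \<Longrightarrow> pc J As Bs"
  unfolding pc_def by (induction rule: list_all2_induct) (auto intro: mxc_mult)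

lemma pc_inverse_unique:
  assumes "finite J" "pc J (As @ Bs) []" "pc J (Bs @ Cs) []"
  shows "pc J As Cs"
proof -
  have "pc J As (As @ (Bs @ Cs))"
    using pc_ctx[OF assms(1) pc_sym[OF assms(3)], of As "[]"] by simp
  also have "pc J \<dots> Cs"
    using pc_ctx[OF assms(1,2), of "[]" Cs] by simp
  finally show ?thesis .
qed

end

section \<open>Inverse matrices\<close>

interpretation req: ring_cong "(=) :: 'a::ring_1 \<Rightarrow> 'a \<Rightarrow> bool"
  by standard auto

lemma req_mxc: "req.mxc J A B \<longleftrightarrow> mx_eq J A B"
  by (simp add: req.mxc_def mx_eq_def)

text \<open>
  Any two-sided inverse on the index set, normalised to be zero outside, satisfies the
  defining description of \<open>mx_inv\<close> uniquely.
\<close>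

lemma mx_inv_props:
  fixes A :: "('i, 'a::ring_1) mx"
  assumes J: "finite J" and AB: "mx_eq J (mx_mult J A B) mx_one" and BA: "mx_eq J (mx_mult J B A) mx_one"
  shows "mx_eq J (mx_mult J A (mx_inv J A)) mx_one" "mx_eq J (mx_mult J (mx_inv J A) A) mx_one"
    "mx_eq J (mx_inv J A) B" "\<And>i j. i \<notin> J \<or> j \<notin> J \<Longrightarrow> mx_inv J A i j = 0"
proof -
  define B' where "B' = (\<lambda>i j. if i \<in> J \<and> j \<in> J then B i j else 0)"
  define P where "P = (\<lambda>X. mx_eq J (mx_mult J A X) mx_one \<and> mx_eq J (mx_mult J X A) mx_one \<and>
     (\<forall>i j. i \<notin> J \<or> j \<notin> J \<longrightarrow> X i j = 0))"
  have uniq: "mx_eq J X B" if "P X" for X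
  proof -
    have "req.pc J [X] [B]"
      by (rule req.pc_inverse_unique[OF J, where Bs = "[A]"])
         (use that AB J in \<open>auto simp: req.pc_def req_mxc P_def mx_eq_def mx_mult_one_right
            mx_mult_assoc[symmetric]\<close>)
    then show ?thesis using J by (auto simp: req.pc_def req_mxc mx_mult_one_right mx_eq_def)
  qed
  have PB: "P B'"
    using AB BA by (auto simp: P_def B'_def mx_eq_def mx_mult_def cong: sum.cong)
  have "\<exists>!X. P X"
  proof (rule ex1I[of P B'])
    show "P B'" by (rule PB)
    fix X assume X: "P X"
    show "X = B'"
    proof (intro ext)
      fix i j show "X i j = B' i j"
        using X uniq[OF X] by (auto simp: P_def B'_def mx_eq_def)
    qed
  qed
  then have "P (mx_inv J A)"
    unfolding mx_inv_def P_def by (rule theI')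
  then show "mx_eq J (mx_mult J A (mx_inv J A)) mx_one" "mx_eq J (mx_mult J (mx_inv J A) A) mx_one"
    "mx_eq J (mx_inv J A) B" "\<And>i j. i \<notin> J \<or> j \<notin> J \<Longrightarrow> mx_inv J A i j = 0"
    using uniq by (auto simp: P_def)
qed

text \<open>
  The rank function makes one notion cover lower triangular matrices and the matrices
  $R$, $R_{21}^{-1}$, which are triangular for the first and the second index of a pair.
\<close>

definition tri_on :: "'i set \<Rightarrow> ('i \<Rightarrow> nat) \<Rightarrow> ('i, 'a::zero) mx \<Rightarrow> bool" where
  "tri_on J r A \<longleftrightarrow> (\<forall>i\<in>J. \<forall>j\<in>J. A i j \<noteq> 0 \<longrightarrow> i = j \<or> r j < r i)"

text \<open>
  Write $A=\Delta+N$ with $\Delta$ diagonal. A right inverse is a fixed point of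
  $B\mapsto\Delta^{-1}(1-NB)$. Iterating from $0$, the row $i$ is stationary once the number of
  steps exceeds the rank of $i$, as $N$ only refers to rows of smaller rank.
\<close>

lemma tri_right_inverse:
  fixes A :: "('i, 'a::ring_1) mx"
  assumes J: "finite J" and A: "tri_on J r A" and u: "\<And>i. i \<in> J \<Longrightarrow> A i i * u i = 1"
  shows "\<exists>B. mx_eq J (mx_mult J A B) mx_one \<and> tri_on J r B \<and> (\<forall>i\<in>J. B i i = u i)"
proof -
  define F where "F = (\<lambda>B i j. u i * ((if i = j then 1 else 0) - (\<Sum>k\<in>J - {i}. A i k * B k j)) :: 'a)"
  define B where "B = (\<lambda>n. (F ^^ n) (\<lambda>i j. 0))"
  have B_Suc: "B (Suc n) i j = u i * ((if i = j then 1 else 0) - (\<Sum>k\<in>J - {i}. A i k * B n k j))"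
    for n i j by (simp add: B_def F_def)
  have stab: "B (Suc n) i j = B n i j" if "i \<in> J" "r i < n" for n i j
    using that
  proof (induction n arbitrary: i)
    case 0 then show ?case by simp
  next
    case (Suc n)
    have "A i k * B (Suc n) k j = A i k * B n k j" if k: "k \<in> J - {i}" for k
    proof (cases "A i k = 0")
      case False
      with A k Suc.prems have "r k < r i" by (auto simp: tri_on_def)
      with Suc k show ?thesis by simp
    qed simp
    then have "(\<Sum>k\<in>J - {i}. A i k * B (Suc n) k j) = (\<Sum>k\<in>J - {i}. A i k * B n k j)"
      by (rule sum.cong[OF refl])
    then show ?case unfolding B_Suc[of "Suc n" i j] B_Suc[of n i j] by simp
  qed
  have tri: "tri_on J r (B n) \<and> (n > 0 \<longrightarrow> (\<forall>i\<in>J. B n i i = u i))" for n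
  proof (induction n)
    case 0 then show ?case by (simp add: B_def tri_on_def)
  next
    case (Suc n)
    have z: "A i k * B n k j = 0" if "i \<in> J" "j \<in> J" "k \<in> J - {i}" "\<not> r j < r i" for i j k
    proof (rule ccontr)
      assume "A i k * B n k j \<noteq> 0"
      then have "A i k \<noteq> 0" "B n k j \<noteq> 0" by auto
      with that A Suc have "r k < r i" "k = j \<or> r j < r k" by (auto simp: tri_on_def)
      with that show False by auto
    qed
    have "B (Suc n) i j = (if i = j then u i else 0)" if "i \<in> J" "j \<in> J" "\<not> r j < r i" for i j
      using z[of i j] that by (simp add: B_Suc)
    then show ?case by (auto simp: tri_on_def split: if_splits)
  qed
  \<comment> \<open>After this many steps all rows are stationary; the successor also ensures that a step was made.\<close>
  define m where "m = Suc (Max (insert 0 (r ` J)))"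
  have m: "r i < m" if "i \<in> J" for i
    using J that by (auto simp: m_def less_Suc_eq_le intro!: Max_ge)
  have "mx_mult J A (B m) i j = mx_one i j" if ij: "i \<in> J" "j \<in> J" for i j
  proof -
    have "mx_mult J A (B m) i j = A i i * B m i j + (\<Sum>k\<in>J - {i}. A i k * B m k j)"
      using J ij by (simp add: mx_mult_def sum.remove)
    also have "B m i j = B (Suc m) i j" using stab[OF ij(1) m[OF ij(1)]] by simp
    also have "A i i * B (Suc m) i j = (if i = j then 1 else 0) - (\<Sum>k\<in>J - {i}. A i k * B m k j)"
      unfolding B_Suc using u[OF ij(1)] by (simp add: mult.assoc[symmetric])
    finally show ?thesis by (simp add: mx_one_def)
  qed
  then show ?thesis using tri[of m] by (intro exI[of _ "B m"]) (auto simp: mx_eq_def m_def)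
qed

text \<open>
  The right inverse is triangular with invertible diagonal, so it has a right inverse
  itself; in a monoid this makes it a two-sided inverse.
\<close>

lemma tri_inverse:
  fixes A :: "('i, 'a::ring_1) mx"
  assumes J: "finite J" and A: "tri_on J r A"
    and u: "\<And>i. i \<in> J \<Longrightarrow> A i i * u i = 1" "\<And>i. i \<in> J \<Longrightarrow> u i * A i i = 1"
  shows "mx_eq J (mx_mult J A (mx_inv J A)) mx_one" "mx_eq J (mx_mult J (mx_inv J A) A) mx_one"
    "tri_on J r (mx_inv J A)" "\<And>i. i \<in> J \<Longrightarrow> mx_inv J A i i = u i"
    "\<And>i j. i \<notin> J \<or> j \<notin> J \<Longrightarrow> mx_inv J A i j = 0"
proof -
  obtain B where B: "mx_eq J (mx_mult J A B) mx_one" "tri_on J r B" "\<forall>i\<in>J. B i i = u i"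
    using tri_right_inverse[OF J A u(1)] by blast
  obtain C where C: "mx_eq J (mx_mult J B C) mx_one"
    using tri_right_inverse[OF J B(2), of "\<lambda>i. A i i"] u(2) B(3) by auto
  have "req.pc J [A] [C]"
    by (rule req.pc_inverse_unique[OF J, where Bs = "[B]"])
       (use B C J in \<open>auto simp: req.pc_def req_mxc mx_eq_def mx_mult_one_right
          mx_mult_assoc[symmetric]\<close>)
  then have "mx_eq J A C" using J by (auto simp: req.pc_def req_mxc mx_mult_one_right mx_eq_def)
  with C have BA: "mx_eq J (mx_mult J B A) mx_one" by (auto simp: mx_eq_def mx_mult_def cong: sum.cong)
  note inv = mx_inv_props[OF J B(1) BA]
  show "mx_eq J (mx_mult J A (mx_inv J A)) mx_one" "mx_eq J (mx_mult J (mx_inv J A) A) mx_one"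
    "\<And>i j. i \<notin> J \<or> j \<notin> J \<Longrightarrow> mx_inv J A i j = 0" by fact+
  show "tri_on J r (mx_inv J A)" "\<And>i. i \<in> J \<Longrightarrow> mx_inv J A i i = u i"
    using inv(3) B(2,3) by (auto simp: tri_on_def mx_eq_def)
qed

section \<open>Tensor legs and the flip\<close>

context ring_cong
begin

lemma mx_1_mult: "finite I \<Longrightarrow> mxc (I \<times> I) (mx_1 (mx_mult I A B)) (mx_mult (I \<times> I) (mx_1 A) (mx_1 B))"
  unfolding mxc_def
proof (clarsimp, rule eqI)
  fix a b c d assume I: "finite I" "a \<in> I" "b \<in> I" "c \<in> I" "d \<in> I"
  have "mx_mult (I \<times> I) (mx_1 A) (mx_1 B) (a, b) (c, d)
      = (\<Sum>k\<in>I. \<Sum>m\<in>I. if b = m then (if m = d then A a k * B k c else 0) else 0)"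
    unfolding mx_mult_def sum.cartesian_product
    by (rule sum.cong) (auto simp: mx_1_def kron_def mx_one_def)
  also have "\<dots> = mx_1 (mx_mult I A B) (a, b) (c, d)"
    using I by (auto simp: mx_1_def kron_def mx_one_def mx_mult_def)
  finally show "mx_1 (mx_mult I A B) (a, b) (c, d) = mx_mult (I \<times> I) (mx_1 A) (mx_1 B) (a, b) (c, d)" ..
qed

lemma mx_1_one: "mx_1 mx_one = mx_one"
  by (auto simp: mx_1_def kron_def mx_one_def fun_eq_iff)

lemma mx_1_cong: "mxc I A B \<Longrightarrow> mxc (I \<times> I) (mx_1 A) (mx_1 B)"
  by (auto simp: mxc_def mx_1_def kron_def intro!: mult)

lemma mx_1_prod:
  assumes "finite I"
  shows "mxc (I \<times> I) (mx_1 (mx_prod I As)) (mx_prod (I \<times> I) (map mx_1 As))"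
proof (induction As)
  case Nil then show ?case by (simp add: mx_1_one)
next
  case (Cons A As)
  have "mxc (I \<times> I) (mx_1 (mx_prod I (A # As))) (mx_mult (I \<times> I) (mx_1 A) (mx_1 (mx_prod I As)))"
    using mx_1_mult[OF assms] by simp
  also have "mxc (I \<times> I) \<dots> (mx_prod (I \<times> I) (map mx_1 (A # As)))"
    using Cons by (simp add: mxc_mult)
  finally show ?case .
qed

lemma pc_mx_1:
  assumes I: "finite I" and "pc I As Bs"
  shows "pc (I \<times> I) (map mx_1 As) (map mx_1 Bs)"
proof -
  have "mxc (I \<times> I) (mx_prod (I \<times> I) (map mx_1 As)) (mx_1 (mx_prod I As))"
    by (rule mxc_sym[OF mx_1_prod[OF I]])
  also have "mxc (I \<times> I) \<dots> (mx_1 (mx_prod I Bs))"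
    using assms(2) unfolding pc_def by (rule mx_1_cong)
  also have "mxc (I \<times> I) \<dots> (mx_prod (I \<times> I) (map mx_1 Bs))"
    by (rule mx_1_prod[OF I])
  finally show ?thesis by (simp add: pc_def)
qed

end

section \<open>Linear extension and free algebras\<close>

lemma const_0 [simp]: "const 0 = 0" by (simp add: const_def)
lemma const_1 [simp]: "const 1 = 1" by (simp add: const_def)
lemma const_add: "const (a + b) = const a + const b" by (simp add: const_def single_add)
lemma const_uminus: "const (- a) = - const a" by (simp add: const_def single_uminus)
lemma const_diff: "const (a - b) = const a - const b" by (simp add: const_def single_diff)
lemma const_mult: "const (a * b) = const a * const b" by (simp add: const_def mult_single)
lemma const_sum: "const (sum f A) = (\<Sum>x\<in>A. const (f x))"
  by (induction A rule: infinite_finite_induct) (simp_all add: const_add)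

lemma const_times_single: "const c * Poly_Mapping.single w d = Poly_Mapping.single w (c * d)"
  by (simp add: const_def mult_single)

lemma single_times_const: "Poly_Mapping.single w d * const c = Poly_Mapping.single w (c * d)"
  by (simp add: const_def mult_single mult.commute)

lemma poly_mapping_induct [case_names zero add]:
  fixes x :: "'k \<Rightarrow>\<^sub>0 'b::comm_monoid_add"
  assumes "P 0" and "\<And>x k c. P x \<Longrightarrow> P (x + Poly_Mapping.single k c)"
  shows "P x"
proof (induction x rule: update_induct)
  case (update f a b)
  have "Poly_Mapping.update a b f = f + Poly_Mapping.single a b"
    using update(1) by (intro poly_mapping_eqI)
      (auto simp: lookup_update lookup_add lookup_single in_keys_iff when_def)
  then show ?case using assms(2)[OF update(3)] by simp
qed fact

lemma const_commute: "const c * a = a * const c"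
  by (induction a rule: poly_mapping_induct)
     (simp_all add: distrib_left distrib_right const_times_single single_times_const)

text \<open>
  The linear extension of \<open>h\<close> from basis elements. The comultiplication, the twisted
  operators and the Sweedler sums are all of this form.
\<close>

definition lin :: "('k \<Rightarrow> ('w::monoid_add \<Rightarrow>\<^sub>0 complex)) \<Rightarrow> ('k \<Rightarrow>\<^sub>0 complex) \<Rightarrow> ('w \<Rightarrow>\<^sub>0 complex)" where
  "lin h x = (\<Sum>p\<in>Poly_Mapping.keys x. const (Poly_Mapping.lookup x p) * h p)"

lemma lin_superset:
  "finite A \<Longrightarrow> Poly_Mapping.keys x \<subseteq> A \<Longrightarrow> lin h x = (\<Sum>p\<in>A. const (Poly_Mapping.lookup x p) * h p)"
  unfolding lin_def by (rule sum.mono_neutral_left) (auto simp: in_keys_iff)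

lemma lin_0 [simp]: "lin h 0 = 0" by (simp add: lin_def)

lemma lin_single: "lin h (Poly_Mapping.single p c) = const c * h p"
  by (cases "c = 0") (simp_all add: lin_def)

lemma lin_add: "lin h (x + y) = lin h x + lin h y"
proof -
  let ?A = "Poly_Mapping.keys x \<union> Poly_Mapping.keys y"
  have "lin h (x + y) = (\<Sum>p\<in>?A. const (Poly_Mapping.lookup (x + y) p) * h p)"
    by (rule lin_superset) (auto dest: subsetD[OF keys_add])
  also have "\<dots> = lin h x + lin h y"
    by (simp add: lin_superset[of ?A] lookup_add const_add distrib_right sum.distrib)
  finally show ?thesis .
qed

lemma lin_const: "lin h (const c * x) = const c * lin h x"
  by (induction x rule: poly_mapping_induct)
     (simp_all add: lin_add lin_single distrib_left const_times_single const_mult mult.assoc)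

lemma lin_uminus: "lin h (- x) = - lin h x"
  using lin_add[of h x "- x"] by (simp add: eq_neg_iff_add_eq_0 add.commute)

lemma lin_diff: "lin h (x - y) = lin h x - lin h y"
  using lin_add[of h x "- y"] by (simp add: lin_uminus)

lemma lin_sum: "lin h (sum f A) = (\<Sum>x\<in>A. lin h (f x))"
  by (induction A rule: infinite_finite_induct) (simp_all add: lin_add)

lemma lin_fun_sum: "lin (\<lambda>p. \<Sum>m\<in>M. h m p) x = (\<Sum>m\<in>M. lin (h m) x)"
  unfolding lin_def sum_distrib_left by (rule sum.swap)

lemma lin_single_mult:
  "lin h (Poly_Mapping.single p c * y) = const c * lin (\<lambda>k. h (p + k)) y"
  by (induction y rule: poly_mapping_induct)
     (simp_all add: lin_add distrib_left mult_single lin_single const_mult mult.assoc)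

lemma free_hom_const: "free_hom const f = lin (\<lambda>w. prod_list (map f (letters w)))"
  by (simp add: free_hom_def lin_def fun_eq_iff)

lemma letters_plus [simp]: "letters (u + v) = letters u @ letters v"
  by (simp add: plus_word_def)

lemma letters_zero [simp]: "letters 0 = []"
  by (simp add: zero_word_def)

lemma tens_single:
  "tens (Poly_Mapping.single u 1) (Poly_Mapping.single v 1) = Poly_Mapping.single (u, v) 1"
  by (simp add: tens_def)

lemma tens_0 [simp]: "tens 0 b = 0" "tens a 0 = 0"
  by (simp_all add: tens_def)

text \<open>
  The retraction of the free algebra on the whole type onto the free algebra on \<open>G\<close> that
  kills the other generators. Its fixed points are the carrier of \<open>free_algebra G\<close>, and composing
  with it removes carrier conditions from all identities below.
\<close>

definition retr :: "'g set \<Rightarrow> 'g falg \<Rightarrow> 'g falg" where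
  "retr G = lin (\<lambda>w. if set (letters w) \<subseteq> G then Poly_Mapping.single w 1 else 0)"

lemma retr_single:
  "retr G (Poly_Mapping.single w c) = (if set (letters w) \<subseteq> G then Poly_Mapping.single w c else 0)"
  by (simp add: retr_def lin_single const_times_single)

lemma retr_0 [simp]: "retr G 0 = 0" by (simp add: retr_def)
lemma retr_const [simp]: "retr G (const c) = const c" by (simp add: const_def retr_single)
lemma retr_1 [simp]: "retr G 1 = 1" using retr_const[of G 1] by simp
lemma retr_add: "retr G (a + b) = retr G a + retr G b" by (simp add: retr_def lin_add)
lemma retr_diff: "retr G (a - b) = retr G a - retr G b" by (simp add: retr_def lin_diff)
lemma retr_uminus: "retr G (- a) = - retr G a" by (simp add: retr_def lin_uminus)
lemma retr_sum: "retr G (sum f A) = (\<Sum>x\<in>A. retr G (f x))" by (simp add: retr_def lin_sum)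

lemma retr_mult: "retr G (a * b) = retr G a * retr G b"
proof (induction a rule: poly_mapping_induct)
  case (add a u c)
  have "retr G (Poly_Mapping.single u c * b) = retr G (Poly_Mapping.single u c) * retr G b"
    by (induction b rule: poly_mapping_induct)
       (auto simp: distrib_left retr_add mult_single retr_single)
  with add show ?case by (simp add: distrib_right retr_add)
qed simp

lemma lookup_retr:
  "Poly_Mapping.lookup (retr G a) w = (if set (letters w) \<subseteq> G then Poly_Mapping.lookup a w else 0)"
  by (induction a rule: poly_mapping_induct)
     (auto simp: retr_add retr_single lookup_add lookup_single when_def)

lemma in_free_algebra_iff: "a \<in> carrier (free_algebra G) \<longleftrightarrow> retr G a = a"
proof
  assume "a \<in> carrier (free_algebra G)"
  then show "retr G a = a"
    by (intro poly_mapping_eqI) (auto simp: lookup_retr free_algebra_def in_keys_iff)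
next
  assume *: "retr G a = a"
  show "a \<in> carrier (free_algebra G)"
  proof (clarsimp simp: free_algebra_def)
    fix w x assume "w \<in> Poly_Mapping.keys a" "x \<in> set (letters w)"
    then show "x \<in> G" using lookup_retr[of G a w] * by (auto simp: in_keys_iff split: if_splits)
  qed
qed

lemma retr_retr [simp]: "retr G (retr G a) = retr G a"
  by (intro poly_mapping_eqI) (simp add: lookup_retr)

lemma free_algebra_simps [simp]:
  "a \<otimes>\<^bsub>free_algebra G\<^esub> b = a * b" "a \<oplus>\<^bsub>free_algebra G\<^esub> b = a + b"
  "\<one>\<^bsub>free_algebra G\<^esub> = 1" "\<zero>\<^bsub>free_algebra G\<^esub> = 0" "c \<odot>\<^bsub>free_algebra G\<^esub> a = const c * a"
  by (simp_all add: free_algebra_def)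

lemma ring_free_algebra: "ring (free_algebra G)"
proof (rule ringI)
  show "abelian_group (free_algebra G)"
  proof (rule abelian_groupI)
    fix x assume "x \<in> carrier (free_algebra G)"
    then show "\<exists>y\<in>carrier (free_algebra G). y \<oplus>\<^bsub>free_algebra G\<^esub> x = \<zero>\<^bsub>free_algebra G\<^esub>"
      by (intro bexI[of _ "- x"]) (simp_all add: in_free_algebra_iff retr_uminus)
  qed (simp_all add: in_free_algebra_iff retr_add algebra_simps)
  show "monoid (free_algebra G)"
    by (rule monoidI) (simp_all add: in_free_algebra_iff retr_mult mult.assoc)
qed (simp_all add: algebra_simps)

lemma free_algebra_a_inv: "a \<in> carrier (free_algebra G) \<Longrightarrow> \<ominus>\<^bsub>free_algebra G\<^esub> a = - a"
proof -
  interpret ring "free_algebra G" by (rule ring_free_algebra)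
  assume "a \<in> carrier (free_algebra G)"
  then show ?thesis using minus_equality[of "- a" a] by (simp add: in_free_algebra_iff retr_uminus)
qed

section \<open>Presented algebras\<close>

text \<open>
  As a function on the whole type, not only on the carrier, this is a surjective ring homomorphism onto the presented algebra.
\<close>

definition pres :: "'g set \<Rightarrow> 'g falg set \<Rightarrow> 'g falg \<Rightarrow> 'g falg set" where
  "pres G S a = cls G S (retr G a)"

locale presentation =
  fixes G :: "'g set" and S :: "'g falg set"
  assumes rels: "\<And>r. r \<in> S \<Longrightarrow> retr G r = r"
begin

abbreviation "F \<equiv> free_algebra G"
abbreviation "K \<equiv> genideal F S"
abbreviation "A \<equiv> presented_algebra G S"
abbreviation "p \<equiv> pres G S"

sublocale F: ring F by (rule ring_free_algebra)

lemma S_carrier: "S \<subseteq> carrier F"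
  using rels by (auto simp: in_free_algebra_iff)

sublocale K: ideal K F by (rule F.genideal_ideal[OF S_carrier])

lemma retr_carrier [simp]: "retr G a \<in> carrier F"
  by (simp add: in_free_algebra_iff)

lemma pres_eq_iff: "p a = p b \<longleftrightarrow> retr G (a - b) \<in> K"
proof -
  have "p a = p b \<longleftrightarrow> retr G a \<ominus>\<^bsub>F\<^esub> retr G b \<in> K"
    unfolding pres_def cls_def
    by (rule F.quotient_eq_iff_same_a_r_cos[symmetric, OF K.ideal_axioms]) simp_all
  also have "retr G a \<ominus>\<^bsub>F\<^esub> retr G b = retr G (a - b)"
    by (simp add: a_minus_def free_algebra_a_inv retr_diff)
  finally show ?thesis .
qed

lemma A_simps:
  "carrier A = carrier (F Quot K)" "x \<otimes>\<^bsub>A\<^esub> y = x \<otimes>\<^bsub>F Quot K\<^esub> y"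
  "x \<oplus>\<^bsub>A\<^esub> y = x \<oplus>\<^bsub>F Quot K\<^esub> y" "\<one>\<^bsub>A\<^esub> = \<one>\<^bsub>F Quot K\<^esub>" "\<zero>\<^bsub>A\<^esub> = \<zero>\<^bsub>F Quot K\<^esub>"
  "c \<odot>\<^bsub>A\<^esub> X = (\<Union>x\<in>X. K +>\<^bsub>F\<^esub> (const c * x))"
  by (simp_all add: presented_algebra_def Let_def)

lemma carrier_A: "carrier A = range p"
proof -
  have "carrier A = (\<lambda>a. K +>\<^bsub>F\<^esub> a) ` carrier F"
    by (auto simp: A_simps FactRing_simps a_r_coset_def)
  also have "carrier F = range (retr G)"
    by (auto simp: in_free_algebra_iff intro: range_eqI[OF HOL.sym])
  also have "(\<lambda>a. K +>\<^bsub>F\<^esub> a) ` range (retr G) = range p"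
    by (simp add: pres_def cls_def image_image)
  finally show ?thesis .
qed

lemma pres_in [simp]: "p a \<in> carrier A"
  by (simp add: carrier_A)

lemma pres_cls: "a \<in> carrier F \<Longrightarrow> cls G S a = p a"
  by (simp add: pres_def in_free_algebra_iff)

lemma pres_mult: "p a \<otimes>\<^bsub>A\<^esub> p b = p (a * b)"
  by (simp add: A_simps FactRing_def pres_def cls_def K.rcoset_mult_add retr_mult)

lemma pres_add: "p a \<oplus>\<^bsub>A\<^esub> p b = p (a + b)"
  by (simp add: A_simps FactRing_def pres_def cls_def K.a_rcos_sum retr_add)

lemma pres_one: "\<one>\<^bsub>A\<^esub> = p 1"
  by (simp add: A_simps FactRing_def pres_def cls_def)

lemma pres_zero: "\<zero>\<^bsub>A\<^esub> = p 0"
proof -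
  have "K +>\<^bsub>F\<^esub> 0 = K" using F.a_coset_add_zero[OF K.a_subset] by simp
  then show ?thesis by (simp add: A_simps FactRing_def pres_def cls_def)
qed

text \<open>
  The scalar multiplication of the presented algebra is a union over representatives; all of
  them give the same coset because the ideal is stable under scalars.
\<close>

lemma pres_smult: "c \<odot>\<^bsub>A\<^esub> p a = p (const c * a)"
proof -
  have "K +>\<^bsub>F\<^esub> (const c * x) = p (const c * a)" if x: "x \<in> p a" for x
  proof -
    have "x \<in> K +>\<^bsub>F\<^esub> retr G a" using x by (simp add: pres_def cls_def)
    then obtain i where i: "i \<in> K" "x = i + retr G a" by (auto simp: a_r_coset_def r_coset_def)
    have xF: "x \<in> carrier F" using i K.a_subset by (auto simp: in_free_algebra_iff retr_add)
    have "const c * i \<in> K"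
      using K.I_l_closed[OF i(1), of "const c"] by (simp add: in_free_algebra_iff)
    then have "retr G (const c * x - const c * a) \<in> K"
      using i xF K.a_subset by (auto simp: retr_diff retr_mult retr_add in_free_algebra_iff algebra_simps)
    then have "p (const c * x) = p (const c * a)" by (simp add: pres_eq_iff)
    moreover have "const c * x \<in> carrier F" using xF by (simp add: in_free_algebra_iff retr_mult)
    ultimately show ?thesis by (simp add: pres_cls[unfolded cls_def])
  qed
  moreover have "retr G a \<in> p a"
    using K.zero_closed by (force simp: pres_def cls_def a_r_coset_def r_coset_def)
  ultimately show ?thesis unfolding A_simps by blast
qed

lemma pres_rel: "r \<in> S \<Longrightarrow> p r = p 0"
  using F.genideal_self[OF S_carrier] by (auto simp: pres_eq_iff rels)

text \<open>
  A two-sided ideal of the full free algebra that contains the relators contains the kernel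
  of the projection. This is how operators that kill the relators descend to the quotient.
\<close>

lemma pres_kernel:
  assumes eq: "p a = p b" and S: "S \<subseteq> V" and "0 \<in> V"
    and "\<And>x y. x \<in> V \<Longrightarrow> y \<in> V \<Longrightarrow> x + y \<in> V"
    and "\<And>x y. x \<in> V \<Longrightarrow> y * x \<in> V" "\<And>x y. x \<in> V \<Longrightarrow> x * y \<in> V"
  shows "retr G (a - b) \<in> V"
proof -
  have "ideal (V \<inter> carrier F) F"
  proof (rule idealI[OF ring_free_algebra])
    show "subgroup (V \<inter> carrier F) (add_monoid F)"
    proof
      fix x assume x: "x \<in> V \<inter> carrier F"
      have "\<ominus>\<^bsub>F\<^esub> x = const (- 1) * x" using x by (simp add: free_algebra_a_inv const_uminus)
      with x assms(5) show "inv\<^bsub>add_monoid F\<^esub> x \<in> V \<inter> carrier F"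
        unfolding a_inv_def[symmetric] by (simp add: in_free_algebra_iff retr_mult)
    qed (use assms in \<open>auto simp: in_free_algebra_iff retr_add\<close>)
  qed (use assms in \<open>auto simp: in_free_algebra_iff retr_mult\<close>)
  then have "K \<subseteq> V \<inter> carrier F"
    by (rule F.genideal_minimal) (use S S_carrier in auto)
  with eq show ?thesis by (auto simp: pres_eq_iff)
qed

lemma A_cases:
  assumes "X \<in> carrier A"
  obtains a where "retr G a = a" "X = p a"
proof -
  from assms obtain a where "X = p a" unfolding carrier_A by blast
  then have "X = p (retr G a)" by (simp add: pres_def)
  then show ?thesis using that[of "retr G a"] by simp
qed

lemma abelian_monoid_A: "abelian_monoid A"
proof (rule abelian_monoidI)
  fix x y z assume x: "x \<in> carrier A" and y: "y \<in> carrier A" and z: "z \<in> carrier A"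
  obtain a where "x = p a" using A_cases[OF x] by blast
  moreover obtain b where "y = p b" using A_cases[OF y] by blast
  moreover obtain c where "z = p c" using A_cases[OF z] by blast
  ultimately show "x \<oplus>\<^bsub>A\<^esub> y \<oplus>\<^bsub>A\<^esub> z = x \<oplus>\<^bsub>A\<^esub> (y \<oplus>\<^bsub>A\<^esub> z)"
    by (simp only: pres_add add.assoc)
next
  fix x y assume x: "x \<in> carrier A" and y: "y \<in> carrier A"
  obtain a where "x = p a" using A_cases[OF x] by blast
  moreover obtain b where "y = p b" using A_cases[OF y] by blast
  ultimately show "x \<oplus>\<^bsub>A\<^esub> y = y \<oplus>\<^bsub>A\<^esub> x" "x \<oplus>\<^bsub>A\<^esub> y \<in> carrier A" "\<zero>\<^bsub>A\<^esub> \<oplus>\<^bsub>A\<^esub> x = x"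
    by (simp_all only: pres_add pres_zero add.commute add_0 pres_in)
qed (simp only: pres_zero pres_in)

lemma finsum_pres:
  assumes "finite X"
  shows "finsum A (\<lambda>x. p (f x)) X = p (\<Sum>x\<in>X. f x)"
  using assms
proof (induction rule: finite_induct)
  case empty
  show ?case by (simp only: abelian_monoid.finsum_empty[OF abelian_monoid_A] pres_zero sum.empty)
next
  case (insert x X)
  have "finsum A (\<lambda>x. p (f x)) (insert x X) = p (f x) \<oplus>\<^bsub>A\<^esub> finsum A (\<lambda>x. p (f x)) X"
    by (rule abelian_monoid.finsum_insert[OF abelian_monoid_A insert(1,2)]) (auto simp only: pres_in)
  with insert(3) show ?case by (simp only: pres_add sum.insert[OF insert(1,2)])
qed

end

section \<open>The entries of the R-matrix\<close>

lemma finite_idx [simp]: "finite (idx s l)" "finite (idx2 s l)"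
  by (simp_all add: idx_def idx2_def)

lemma prm_in: "i \<in> idx s l \<Longrightarrow> prm s l i \<in> idx s l"
  by (auto simp: idx_def prm_def)

lemma prm_prm: "i \<in> idx s l \<Longrightarrow> prm s l (prm s l i) = i"
  by (auto simp: idx_def prm_def)

lemma kron_unit:
  "kron (mx_unit i j) (mx_unit k m) (a, b) (c, d)
    = (if a = i \<and> c = j \<and> b = k \<and> d = m then 1 else (0::real))"
  by (simp add: kron_def mx_unit_def)

lemma sum_point:
  fixes f :: "'i \<Rightarrow> real"
  assumes "finite A" "\<And>i. i \<in> A \<Longrightarrow> i \<noteq> a \<Longrightarrow> f i = 0"
  shows "sum f A = (if a \<in> A then f a else 0)"
proof -
  have "sum f A = (\<Sum>i\<in>A. if i = a then f a else 0)"
    by (rule sum.cong) (use assms in auto)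
  with assms(1) show ?thesis by simp
qed

lemma double_sum_point:
  fixes f :: "'i \<Rightarrow> 'i \<Rightarrow> real"
  assumes I: "finite I" and a: "a \<in> I" and b: "b \<in> I"
    and z: "\<And>i j. i \<noteq> a \<or> j \<noteq> b \<Longrightarrow> f i j = 0"
  shows "(\<Sum>i\<in>I. \<Sum>j | j \<in> I \<and> Q i j. f i j) = (if Q a b then f a b else 0)"
proof -
  have "(\<Sum>i\<in>I. \<Sum>j | j \<in> I \<and> Q i j. f i j) = (\<Sum>j | j \<in> I \<and> Q a j. f a j)"
    using I a z by (subst sum_point[of I a]) auto
  also have "\<dots> = (if Q a b then f a b else 0)"
    using I b z by (subst sum_point[of _ b]) auto
  finally show ?thesis .
qed

lemma R_typeA_entry:
  assumes "a \<in> idx TypeA l" "b \<in> idx TypeA l" "c \<in> idx TypeA l" "d \<in> idx TypeA l"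
  shows "R_typeA l q (a, b) (c, d) =
      q * (if a = c \<and> b = d \<and> a = b then 1 else 0) + (if a = c \<and> b = d \<and> a \<noteq> b then 1 else 0)
    + (q - 1 / q) * (if c < a \<and> a = d \<and> b = c then 1 else 0)"
proof -
  have "(\<Sum>i\<in>idx TypeA l. kron (mx_unit i i) (mx_unit i i) (a, b) (c, d))
      = (if a = c \<and> b = d \<and> a = b then 1 else (0::real))"
    using assms by (subst sum_point[of _ a]) (auto simp: kron_unit)
  moreover have "(\<Sum>i\<in>idx TypeA l. \<Sum>j | j \<in> idx TypeA l \<and> i \<noteq> j.
        kron (mx_unit i i) (mx_unit j j) (a, b) (c, d))
      = (if a = c \<and> b = d \<and> a \<noteq> b then 1 else (0::real))"
    using assms by (subst double_sum_point[of _ a b]) (auto simp: kron_unit)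
  moreover have "(\<Sum>i\<in>idx TypeA l. \<Sum>j | j \<in> idx TypeA l \<and> j < i.
        kron (mx_unit i j) (mx_unit j i) (a, b) (c, d))
      = (if c < a \<and> a = d \<and> b = c then 1 else (0::real))"
    using assms by (subst double_sum_point[of _ a c]) (auto simp: kron_unit)
  ultimately show ?thesis by (simp add: R_typeA_def Let_def)
qed

lemma R_typeBCD_entry:
  fixes s l
  defines "I \<equiv> idx s l" and "p \<equiv> prm s l"
  assumes "a \<in> I" "b \<in> I" "c \<in> I" "d \<in> I"
  shows "R_typeBCD s l q (a, b) (c, d) =
      q * (if a = c \<and> b = d \<and> a = b \<and> a \<noteq> p a then 1 else 0)
    + (if a = c \<and> b = d \<and> a = b \<and> a = p a then 1 else 0)
    + (if a = c \<and> b = d \<and> a \<noteq> b \<and> a \<noteq> p b then 1 else 0)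
    + 1 / q * (if a = c \<and> b = d \<and> a = p b \<and> b \<noteq> p b then 1 else 0)
    + (q - 1 / q) * (if c < a then (if a = d \<and> b = c then 1 else 0)
        - q powr (rho s l a - rho s l c) * eps s l a * eps s l c * (if b = p a \<and> d = p c then 1 else 0)
       else 0)"
proof -
  have fin: "finite I" by (simp add: I_def)
  have 1: "(\<Sum>i | i \<in> I \<and> i \<noteq> p i. kron (mx_unit i i) (mx_unit i i) (a, b) (c, d))
      = (if a = c \<and> b = d \<and> a = b \<and> a \<noteq> p a then 1 else (0::real))"
    using assms(3-) fin by (subst sum_point[of _ a]) (auto simp: kron_unit)
  have 2: "(\<Sum>i | i \<in> I \<and> i = p i. kron (mx_unit i i) (mx_unit i i) (a, b) (c, d))
      = (if a = c \<and> b = d \<and> a = b \<and> a = p a then 1 else (0::real))"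
    using assms(3-) fin by (subst sum_point[of _ a]) (auto simp: kron_unit)
  have 3: "(\<Sum>i\<in>I. \<Sum>j | j \<in> I \<and> i \<noteq> j \<and> i \<noteq> p j. kron (mx_unit i i) (mx_unit j j) (a, b) (c, d))
      = (if a = c \<and> b = d \<and> a \<noteq> b \<and> a \<noteq> p b then 1 else (0::real))"
    using assms(3-) fin by (subst double_sum_point[of _ a b]) (auto simp: kron_unit)
  have 4: "(\<Sum>i | i \<in> I \<and> i \<noteq> p i. kron (mx_unit (p i) (p i)) (mx_unit i i) (a, b) (c, d))
      = (if a = c \<and> b = d \<and> a = p b \<and> b \<noteq> p b then 1 else (0::real))"
    using assms(3-) fin by (subst sum_point[of _ b]) (auto simp: kron_unit)
  have 5: "(\<Sum>i\<in>I. \<Sum>j | j \<in> I \<and> j < i. kron (mx_unit i j) (mx_unit j i) (a, b) (c, d)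
        - w i j * kron (mx_unit i j) (mx_unit (p i) (p j)) (a, b) (c, d))
      = (if c < a then (if a = d \<and> b = c then 1 else 0)
        - w a c * (if b = p a \<and> d = p c then 1 else 0) else 0)" for w :: "nat \<Rightarrow> nat \<Rightarrow> real"
  proof -
    have z: "kron (mx_unit i j) (mx_unit k m) (a, b) (c, d) = (0::real)" if "i \<noteq> a \<or> j \<noteq> c" for i j k m
      using that unfolding kron_unit by (intro if_not_P) blast
    have kr: "kron (mx_unit a c) (mx_unit k m) (a, b) (c, d) = (if b = k \<and> d = m then 1 else (0::real))" for k m
      unfolding kron_unit by (rule if_cong) auto
    have "(a = d \<and> b = c) = (b = c \<and> d = a)" by auto
    then show ?thesis
      by (subst double_sum_point[OF fin assms(3) assms(5)])
         (simp_all only: z mult_zero_right diff_0_right kr)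
  qed
  show ?thesis
    unfolding R_typeBCD_def Let_def I_def[symmetric] p_def[symmetric] 1 2 3 4 5 ..
qed

lemma R_diag_entry:
  assumes "(a, b) \<in> idx2 s l"
  shows "R_mx s l q (a, b) (a, b) = complex_of_real
    (if a = b then (if s \<noteq> TypeA \<and> a = prm s l a then 1 else q)
     else if s \<noteq> TypeA \<and> a = prm s l b then 1 / q else 1)"
proof (cases "s = TypeA")
  case True
  with assms show ?thesis by (simp add: R_mx_def idx2_def R_typeA_entry)
next
  case False
  have ab: "a \<in> idx s l" "b \<in> idx s l" using assms by (auto simp: idx2_def)
  consider "a = b" "a = prm s l a" | "a = b" "a \<noteq> prm s l a" | "a \<noteq> b" "a = prm s l b" "b \<noteq> prm s l b"
    | "a \<noteq> b" "a \<noteq> prm s l b" by metis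
  then show ?thesis
  proof cases
    case 1
    with False ab(1) R_typeBCD_entry[of a s l a a a q] show ?thesis by (simp add: R_mx_def)
  next
    case 2
    with False ab(1) R_typeBCD_entry[of a s l a a a q] show ?thesis by (simp add: R_mx_def)
  next
    case 3
    with False ab R_typeBCD_entry[of a s l b a b q] show ?thesis by (simp add: R_mx_def)
  next
    case 4
    with False ab R_typeBCD_entry[of a s l b a b q] show ?thesis by (simp add: R_mx_def)
  qed
qed

lemma R_off_diag_entry:
  assumes "(a, b) \<in> idx2 s l" "(c, d) \<in> idx2 s l" "(a, b) \<noteq> (c, d)"
  shows "R_mx s l q (a, b) (c, d) = complex_of_real ((q - 1 / q) * (if c < a then
      (if a = d \<and> b = c then 1 else 0)
      - (if s \<noteq> TypeA \<and> b = prm s l a \<and> d = prm s l c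
         then q powr (rho s l a - rho s l c) * eps s l a * eps s l c else 0) else 0))"
proof (cases "s = TypeA")
  case True
  with assms show ?thesis by (cases "a = c") (simp_all add: R_mx_def idx2_def R_typeA_entry)
next
  case False
  have *: "a \<in> idx s l" "b \<in> idx s l" "c \<in> idx s l" "d \<in> idx s l"
    using assms by (auto simp: idx2_def)
  show ?thesis
  proof (cases "a = c")
    case True
    with assms False R_typeBCD_entry[OF *, of q] show ?thesis by (simp add: R_mx_def)
  next
    case ac: False
    with False R_typeBCD_entry[OF *, of q] show ?thesis by (simp add: R_mx_def)
  qed
qed

text \<open>
  Two consequences of the formula for $R$: it is triangular for the first index, and it
  couples only pairs with the same product $D_iD_k$, once $D_iD_{i'}=1$ is known.
\<close>

lemma R_support:
  assumes "(a, b) \<in> idx2 s l" "(c, d) \<in> idx2 s l" "R_mx s l q (a, b) (c, d) \<noteq> 0"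
  shows "a = c \<and> b = d \<or> c < a \<and> (a = d \<and> b = c \<or> s \<noteq> TypeA \<and> b = prm s l a \<and> d = prm s l c)"
proof (cases "(a, b) = (c, d)")
  case False
  note entry = R_off_diag_entry[OF assms(1,2) False, of q]
  show ?thesis
  proof (rule ccontr)
    assume n: "\<not> ?thesis"
    show False
    proof (cases "c < a")
      case True
      with n have "\<not> (a = d \<and> b = c)" "\<not> (s \<noteq> TypeA \<and> b = prm s l a \<and> d = prm s l c)" by blast+
      then show False using assms(3) entry by (simp only: if_not_P True if_True) simp
    next
      case False
      then show False using assms(3) entry by (simp only: if_False) simp
    qed
  qed
qed simp

lemma R_tri: "tri_on (idx2 s l) fst (R_mx s l q)"
  unfolding tri_on_def using R_support by fastforce

lemma R_diag_nonzero: "q > 0 \<Longrightarrow> r \<in> idx2 s l \<Longrightarrow> R_mx s l q r r \<noteq> 0"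
  by (cases r) (simp add: R_diag_entry)

lemma R_diag_swap:
  assumes "r \<in> idx2 s l"
  shows "R_mx s l q (prod.swap r) (prod.swap r) = R_mx s l q r r"
proof -
  obtain a b where r: "r = (a, b)" by (cases r)
  have "(b, a) \<in> idx2 s l" "a = prm s l b \<longleftrightarrow> b = prm s l a"
    using assms r prm_prm[of a s l] prm_prm[of b s l] by (auto simp: idx2_def)
  with assms show ?thesis by (auto simp: R_diag_entry r)
qed

lemma mx_21_eq_swap: "finite I \<Longrightarrow> mx_eq (I \<times> I) (mx_21 (I \<times> I) M) (mx_swap M)"
  by (auto simp: mx_eq_def mx_21_def mx_flip_mult mx_mult_flip mx_mult_one_right mx_mult_assoc[symmetric] mx_swap_def)

text \<open>
  $R_{21}$ is triangular for the second index since $R$ is triangular for the first; the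
  inverse inherits this.
\<close>

lemma R21_inv:
  fixes s l
  assumes q: "q > 0"
  defines "R21 \<equiv> mx_swap (R_mx s l q)"
  shows "mx_eq (idx2 s l) (mx_mult (idx2 s l) R21 (R21inv_mx s l q)) mx_one"
    "mx_eq (idx2 s l) (mx_mult (idx2 s l) (R21inv_mx s l q) R21) mx_one"
    "tri_on (idx2 s l) snd (R21inv_mx s l q)"
proof -
  let ?J = "idx2 s l"
  define M where "M = mx_21 ?J (R_mx s l q)"
  have M: "M r c = R21 r c" if "r \<in> ?J" "c \<in> ?J" for r c
    using mx_21_eq_swap[of "idx s l" "R_mx s l q"] that by (auto simp: M_def R21_def mx_eq_def idx2_def)
  have tri: "tri_on ?J snd M"
    unfolding tri_on_def
  proof (intro ballI impI)
    fix r c assume rc: "r \<in> ?J" "c \<in> ?J" "M r c \<noteq> 0"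
    then have "prod.swap r \<in> ?J" "prod.swap c \<in> ?J" "R_mx s l q (prod.swap r) (prod.swap c) \<noteq> 0"
      by (auto simp: M R21_def mx_swap_def idx2_def)
    then have "prod.swap r = prod.swap c \<or> fst (prod.swap c) < fst (prod.swap r)"
      using R_tri[of s l q] unfolding tri_on_def by blast
    then show "r = c \<or> snd c < snd r" by (simp add: inj_eq[OF inj_swap])
  qed
  have nz: "M r r \<noteq> 0" if "r \<in> ?J" for r
    using R_diag_nonzero[OF q that] R_diag_swap[OF that] that by (simp add: M R21_def mx_swap_def)
  have Mi: "mx_inv ?J M = R21inv_mx s l q" by (simp add: M_def R21inv_mx_def)
  have eq: "mx_eq ?J (mx_mult ?J M X) (mx_mult ?J R21 X)" "mx_eq ?J (mx_mult ?J X M) (mx_mult ?J X R21)"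
    for X :: "(nat \<times> nat, complex) mx"
    by (auto simp: mx_eq_def mx_mult_def M cong: sum.cong)
  have u: "M r r * (1 / M r r) = 1" "(1 / M r r) * M r r = 1" if "r \<in> ?J" for r
    using nz[OF that] by simp_all
  note inv = tri_inverse[OF finite_idx(2) tri u, unfolded Mi]
  show "mx_eq ?J (mx_mult ?J R21 (R21inv_mx s l q)) mx_one"
    "mx_eq ?J (mx_mult ?J (R21inv_mx s l q) R21) mx_one"
    using inv(1,2) eq by (simp_all add: mx_eq_def)
  show "tri_on ?J snd (R21inv_mx s l q)" by (rule inv(3))
qed

text \<open>
  At the row $(N,1)$ and the columns $(j,j')$ with $j<N$ the matrix $R_{21}^{-1}$ vanishes
  by triangularity, and the flip cancels the term $e_{ij}\otimes e_{ji}$ of $R$, which meets this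
  row only for $j=1$. What remains is $q^{\rho_N-\rho_j}\epsilon_N\epsilon_j$.
\<close>

lemma K_row_nonzero:
  assumes q: "q > 0" "q \<noteq> 1" and s: "s \<noteq> TypeA" and j: "1 \<le> j" "j < vdim s l"
  shows "K_mx s l q (vdim s l, 1) (j, prm s l j) \<noteq> 0"
proof -
  let ?N = "vdim s l"
  have N: "?N \<in> idx s l" "1 \<in> idx s l" "j \<in> idx s l" "prm s l j \<in> idx s l"
    using j prm_in[of j s l] by (auto simp: idx_def)
  have pN: "prm s l ?N = 1" and pj: "prm s l j = ?N \<longleftrightarrow> j = 1" using j by (auto simp: prm_def)
  have 0: "R21inv_mx s l q (?N, 1) (j, prm s l j) = 0"
  proof (rule ccontr)
    assume "R21inv_mx s l q (?N, 1) (j, prm s l j) \<noteq> 0"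
    then have "(?N, 1) = (j, prm s l j) \<or> prm s l j < 1"
      using R21_inv(3)[OF q(1), of s l] N by (force simp: tri_on_def idx2_def)
    then show False using j N by (auto simp: idx_def)
  qed
  have qq: "q - 1 / q \<noteq> 0"
    using q by (auto simp: field_simps power2_eq_1_iff simp flip: power2_eq_square)
  define t where "t = q powr (rho s l ?N - rho s l j) * eps s l ?N * eps s l j"
  have eps: "eps s l i \<noteq> 0" for i by (cases s) auto
  have t: "t \<noteq> 0" using q eps by (simp add: t_def)
  have "R_mx s l q (?N, 1) (j, prm s l j) = complex_of_real ((q - 1 / q) * ((if j = 1 then 1 else 0) - t))"
    using s N j pN pj R_off_diag_entry[of ?N 1 s l j "prm s l j" q] by (auto simp: idx2_def t_def)
  then have "R_mx s l q (?N, 1) (j, prm s l j) / complex_of_real (q - 1 / q)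
      = complex_of_real ((if j = 1 then 1 else 0) - t)"
    using qq by (simp only: of_real_mult) (simp del: of_real_diff of_real_divide)
  then have "K_mx s l q (?N, 1) (j, prm s l j)
      = (if j = 1 then 1 else 0) - complex_of_real ((if j = 1 then 1 else 0) - t)"
    using pj unfolding K_mx_def 0 by (simp add: mx_flip_def eq_commute[of ?N] del: of_real_diff of_real_divide)
  then have "K_mx s l q (?N, 1) (j, prm s l j) = complex_of_real t"
    by (cases "j = 1") simp_all
  with t show ?thesis by simp
qed

section \<open>Diagonal and scalar matrices\<close>

definition dgm :: "('i \<Rightarrow> 'a::zero) \<Rightarrow> ('i, 'a) mx" where
  "dgm g = (\<lambda>i j. if i = j then g i else 0)"

lemma mx_mult_dgm:
  fixes A :: "('i, 'a::ring_1) mx"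
  assumes "finite J" "c \<in> J"
  shows "mx_mult J A (dgm g) r c = A r c * g c"
proof -
  have "mx_mult J A (dgm g) r c = (\<Sum>k\<in>J. if k = c then A r k * g k else 0)"
    unfolding mx_mult_def dgm_def by (rule sum.cong) simp_all
  with assms show ?thesis by simp
qed

lemma dgm_mx_mult:
  fixes A :: "('i, 'a::ring_1) mx"
  assumes "finite J" "r \<in> J"
  shows "mx_mult J (dgm g) A r c = g r * A r c"
proof -
  have "mx_mult J (dgm g) A r c = (\<Sum>k\<in>J. if r = k then g k * A k c else 0)"
    unfolding mx_mult_def dgm_def by (rule sum.cong) simp_all
  with assms show ?thesis by simp
qed

lemma mx_swap_dgm: "mx_swap (dgm g) = dgm (\<lambda>r. g (prod.swap r))"
  by (intro ext) (simp add: mx_swap_def dgm_def inj_eq[OF inj_swap])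

lemma mx_mult_cong_right:
  assumes "c \<in> J" "mx_eq J B B'"
  shows "mx_mult J A B r c = mx_mult J A B' r c"
  unfolding mx_mult_def by (rule sum.cong) (use assms in \<open>simp_all add: mx_eq_def\<close>)

lemma mx_relI: "r \<in> J \<Longrightarrow> c \<in> J \<Longrightarrow> A r c - B r c \<in> mx_rel J A B"
  by (auto simp: mx_rel_def)

lemma mx_rel_subset:
  "(\<And>r c. r \<in> J \<Longrightarrow> c \<in> J \<Longrightarrow> A r c - B r c \<in> V) \<Longrightarrow> mx_rel J A B \<subseteq> V"
  by (auto simp: mx_rel_def)

lemma mx_inv_dgm:
  fixes g :: "'i \<Rightarrow> complex"
  assumes J: "finite J" and A: "mx_eq J A (dgm g)" and g: "\<And>i. i \<in> J \<Longrightarrow> g i \<noteq> 0"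
  shows "mx_eq J (mx_inv J A) (dgm (\<lambda>i. 1 / g i))"
proof (rule mx_inv_props(3)[OF J])
  have "mx_mult J A X i j = mx_mult J (dgm g) X i j" "mx_mult J X A j i = mx_mult J X (dgm g) j i"
    if "i \<in> J" for i j X
    using A that by (simp_all add: mx_eq_def mx_mult_def)
  then have mult: "mx_mult J A X i j = g i * X i j" "mx_mult J X A j i = X j i * g i"
    if "i \<in> J" for i j X
    using that J by (simp_all add: dgm_mx_mult mx_mult_dgm)
  show "mx_eq J (mx_mult J A (dgm (\<lambda>i. 1 / g i))) mx_one"
    unfolding mx_eq_def by (intro ballI) (simp add: mult g dgm_def mx_one_def)
  show "mx_eq J (mx_mult J (dgm (\<lambda>i. 1 / g i)) A) mx_one"
    unfolding mx_eq_def by (intro ballI) (simp add: mult g dgm_def mx_one_def)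
qed

lemma const_mx_one: "const_mx mx_one = mx_one"
  by (intro ext) (simp add: const_mx_def mx_one_def)

lemma const_mx_mult: "const_mx (mx_mult J A B) = mx_mult J (const_mx A) (const_mx B)"
  by (intro ext) (simp add: const_mx_def mx_mult_def const_sum const_mult)

lemma const_mx_dgm: "const_mx (dgm g) = dgm (\<lambda>r. const (g r))"
  by (intro ext) (simp add: const_mx_def dgm_def)

lemma mx_swap_const_mx: "mx_swap (const_mx A) = const_mx (mx_swap A)"
  by (simp add: mx_swap_def const_mx_def)

lemma mx_1_mx_2_entry:
  assumes "finite I" "j \<in> I" "k \<in> I" "u \<in> I" "v \<in> I"
  shows "mx_mult (I \<times> I) (mx_1 A) (mx_2 B) (j, k) (u, v) = A j u * B k v"
    and "mx_mult (I \<times> I) (mx_2 B) (mx_1 A) (j, k) (u, v) = B k v * A j u"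
proof -
  have "mx_mult (I \<times> I) (mx_1 A) (mx_2 B) (j, k) (u, v)
      = (\<Sum>p\<in>I \<times> I. if p = (u, k) then A j u * B k v else 0)"
    unfolding mx_mult_def by (rule sum.cong) (auto simp: mx_1_def mx_2_def kron_def mx_one_def split: if_splits)
  with assms show "mx_mult (I \<times> I) (mx_1 A) (mx_2 B) (j, k) (u, v) = A j u * B k v" by simp
  have "mx_mult (I \<times> I) (mx_2 B) (mx_1 A) (j, k) (u, v)
      = (\<Sum>p\<in>I \<times> I. if p = (j, v) then B k v * A j u else 0)"
    unfolding mx_mult_def by (rule sum.cong) (auto simp: mx_1_def mx_2_def kron_def mx_one_def split: if_splits)
  with assms show "mx_mult (I \<times> I) (mx_2 B) (mx_1 A) (j, k) (u, v) = B k v * A j u" by simp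
qed

lemma pc_const:
  assumes cong: "ring_cong cg" and "mx_eq J (mx_prod J As) (mx_prod J Bs)"
  shows "ring_cong.pc cg J (map const_mx As) (map const_mx Bs)"
proof -
  have prod: "mx_prod J (map const_mx Xs) = const_mx (mx_prod J Xs)" for Xs
    by (induction Xs) (simp_all add: const_mx_one const_mx_mult)
  show ?thesis
    using assms(2) unfolding ring_cong.pc_def[OF cong] ring_cong.mxc_def[OF cong] mx_eq_def prod
    by (simp add: const_mx_def ring_cong.refl[OF cong])
qed

context ring_cong
begin

lemma pc_two:
  assumes "finite J" "\<And>r c. r \<in> J \<Longrightarrow> c \<in> J \<Longrightarrow> mx_mult J A B r c \<approx> mx_mult J C D r c"
  shows "pc J [A, B] [C, D]"
  using assms by (simp add: pc_def mxc_def mx_mult_one_right flip: mx_mult_assoc)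

lemma pc_mx_1_mx_2:
  assumes "finite I"
    and "\<And>j k u v. j \<in> I \<Longrightarrow> k \<in> I \<Longrightarrow> u \<in> I \<Longrightarrow> v \<in> I \<Longrightarrow> A j u * B k v = B k v * A j u"
  shows "pc (I \<times> I) [mx_2 B, mx_1 A] [mx_1 A, mx_2 B]"
  using assms by (intro pc_two) (auto simp: mx_1_mx_2_entry)

lemma mxc_mx_1_diag:
  assumes "\<And>i j. i \<in> I \<Longrightarrow> j \<in> I \<Longrightarrow> A i j = dgm g i j"
  shows "mxc (I \<times> I) (mx_1 A) (dgm (\<lambda>r. g (fst r)))" "mxc (I \<times> I) (mx_2 A) (dgm (\<lambda>r. g (snd r)))"
  using assms by (auto simp: mxc_def mx_1_def mx_2_def kron_def mx_one_def dgm_def)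

lemma pc_two_iff:
  "finite J \<Longrightarrow> pc J [A, B] [C, D] \<longleftrightarrow> mxc J (mx_mult J A B) (mx_mult J C D)"
  by (simp add: pc_def mxc_def mx_mult_one_right flip: mx_mult_assoc)

lemma pc_single_iff: "finite J \<Longrightarrow> pc J [A] [B] \<longleftrightarrow> mxc J A B"
  by (simp add: pc_def mxc_def mx_mult_one_right)

end

lemma pc_diag_mult:
  assumes cong: "ring_cong cg" and J: "finite J"
    and A: "ring_cong.mxc cg J A (const_mx (dgm g))" and B: "ring_cong.mxc cg J B (const_mx (dgm h))"
  shows "ring_cong.pc cg J [A, B] [const_mx (dgm (\<lambda>r. g r * h r))]"
proof -
  interpret ring_cong cg by (rule cong)
  have "pc J [A, B] [const_mx (dgm g), const_mx (dgm h)]"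
    using A B by (intro mxc_prod) simp
  also have "mx_eq J (mx_prod J [dgm g, dgm h]) (mx_prod J [dgm (\<lambda>r. g r * h r)])"
    using J by (simp add: mx_eq_def mx_mult_one_right mx_mult_dgm flip: mx_mult_assoc) (simp add: dgm_def)
  from pc_const[OF cong this]
  have "pc J [const_mx (dgm g), const_mx (dgm h)] [const_mx (dgm (\<lambda>r. g r * h r))]" by simp
  finally show ?thesis .
qed

lemma pc_diag_commute:
  assumes cong: "ring_cong cg" and J: "finite J"
    and A: "ring_cong.mxc cg J A (const_mx (dgm g))" and B: "ring_cong.mxc cg J B (const_mx (dgm h))"
  shows "ring_cong.pc cg J [A, B] [B, A]"
proof -
  interpret ring_cong cg by (rule cong)
  have "pc J [A, B] [const_mx (dgm (\<lambda>r. g r * h r))]" by (rule pc_diag_mult[OF assms])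
  moreover have "pc J [B, A] [const_mx (dgm (\<lambda>r. g r * h r))]"
    using pc_diag_mult[OF cong J B A] by (simp add: mult.commute)
  ultimately show ?thesis by (meson pc_sym pc_trans)
qed

lemma pc_diag_inverse:
  assumes cong: "ring_cong cg" and J: "finite J"
    and A: "ring_cong.mxc cg J A (const_mx (dgm g))" and B: "ring_cong.mxc cg J B (const_mx (dgm h))"
    and gh: "\<And>r. r \<in> J \<Longrightarrow> g r * h r = 1"
  shows "ring_cong.pc cg J [A, B] []"
proof -
  interpret ring_cong cg by (rule cong)
  have "pc J [A, B] [const_mx (dgm (\<lambda>r. g r * h r))]" by (rule pc_diag_mult[OF cong J A B])
  also have "mx_eq J (mx_prod J [dgm (\<lambda>r. g r * h r)]) (mx_prod J [])"
    using J gh by (simp add: mx_eq_def mx_mult_one_right) (simp add: dgm_def mx_one_def)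
  from pc_const[OF cong this]
  have "pc J [const_mx (dgm (\<lambda>r. g r * h r))] []" by simp
  finally show ?thesis .
qed

section \<open>Identities between words in matrices\<close>

context ring_cong
begin

text \<open>
  Abstract form of the evaluation of the cocycle of $L^-,L^-$: the inner $W=Z^{-1}$ cancel
  against $Z$ and the diagonal factors are collected in the middle and at the end.
\<close>

lemma word_conjugate_form:
  assumes J: "finite J"
    and wz: "pc J [w1, z1] []"
    and wd: "pc J [w1, d2] [d2, w1]" and we: "pc J [w1, e2] [e2, w1]" and w2d: "pc J [w2, d1] [d1, w2]"
    and ed: "pc J [e2, d1] [d1, e2]" and qd: "pc J [q, d1] [d1, q]" "pc J [q', d1] [d1, q']"
  shows "pc J [z1, q, z2, q', w1, d2, d2, z1, q, w2, q', w1, e2, z1, d1, d1, w1, e1]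
              [z1, q, z2, q', d2, d2, d1, d1, q, w2, q', w1, e2, e1]"
proof -
  note ctx = pc_ctx[OF J]
  have "pc J [w1, d2, d2, z1] [d2, w1, d2, z1]" using ctx[OF wd, of "[]" "[d2, z1]"] by simp
  also have "pc J \<dots> [d2, d2, w1, z1]" using ctx[OF wd, of "[d2]" "[z1]"] by simp
  also have "pc J \<dots> [d2, d2]" using ctx[OF wz, of "[d2, d2]" "[]"] by simp
  finally have 1: "pc J [w1, d2, d2, z1] [d2, d2]" .
  have "pc J [w1, e2, z1] [e2, w1, z1]" using ctx[OF we, of "[]" "[z1]"] by simp
  also have "pc J \<dots> [e2]" using ctx[OF wz, of "[e2]" "[]"] by simp
  finally have 2: "pc J [w1, e2, z1] [e2]" .
  have "pc J [q, w2, q', e2, d1] [q, w2, q', d1, e2]" using ctx[OF ed, of "[q, w2, q']" "[]"] by simp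
  also have "pc J \<dots> [q, w2, d1, q', e2]" using ctx[OF qd(2), of "[q, w2]" "[e2]"] by simp
  also have "pc J \<dots> [q, d1, w2, q', e2]" using ctx[OF w2d, of "[q]" "[q', e2]"] by simp
  also have "pc J \<dots> [d1, q, w2, q', e2]" using ctx[OF qd(1), of "[]" "[w2, q', e2]"] by simp
  finally have 3: "pc J [q, w2, q', e2, d1] [d1, q, w2, q', e2]" .
  have "pc J [z1, q, z2, q', w1, d2, d2, z1, q, w2, q', w1, e2, z1, d1, d1, w1, e1]
             [z1, q, z2, q', d2, d2, q, w2, q', w1, e2, z1, d1, d1, w1, e1]"
    using ctx[OF 1, of "[z1, q, z2, q']" "[q, w2, q', w1, e2, z1, d1, d1, w1, e1]"] by simp
  also have "pc J \<dots> [z1, q, z2, q', d2, d2, q, w2, q', e2, d1, d1, w1, e1]"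
    using ctx[OF 2, of "[z1, q, z2, q', d2, d2, q, w2, q']" "[d1, d1, w1, e1]"] by simp
  also have "pc J \<dots> [z1, q, z2, q', d2, d2, d1, q, w2, q', e2, d1, w1, e1]"
    using ctx[OF 3, of "[z1, q, z2, q', d2, d2]" "[d1, w1, e1]"] by simp
  also have "pc J \<dots> [z1, q, z2, q', d2, d2, d1, d1, q, w2, q', e2, w1, e1]"
    using ctx[OF 3, of "[z1, q, z2, q', d2, d2, d1]" "[w1, e1]"] by simp
  also have "pc J \<dots> [z1, q, z2, q', d2, d2, d1, d1, q, w2, q', w1, e2, e1]"
    using ctx[OF pc_sym[OF we], of "[z1, q, z2, q', d2, d2, d1, d1, q, w2, q']" "[e1]"] by simp
  finally show ?thesis .
qed

lemma word_inverse_intertwines: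
  assumes J: "finite J" and ra: "pc J [r, a] [b, r]" and "pc J [a, a'] []" and "pc J [b', b] []"
  shows "pc J [r, a'] [b', r]"
proof -
  note ctx = pc_ctx[OF J]
  have "pc J [r, a'] [b', b, r, a']" using ctx[OF pc_sym[OF assms(4)], of "[]" "[r, a']"] by simp
  also have "pc J \<dots> [b', r, a, a']" using ctx[OF pc_sym[OF ra], of "[b']" "[a']"] by simp
  also have "pc J \<dots> [b', r]" using ctx[OF assms(3), of "[b', r]" "[]"] by simp
  finally show ?thesis .
qed

lemma word_intertwines_conjugate:
  assumes J: "finite J" and ra: "pc J [r, a] [b, r]" and inv: "pc J [a, a'] []" "pc J [b', b] []"
    and rt: "pc J [r, t] [t, r]" and re: "pc J [r, e] [e, r]"
  shows "pc J [r, a, t, a', e] [b, t, b', e, r]"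
proof -
  note ctx = pc_ctx[OF J]
  have ra': "pc J [r, a'] [b', r]" by (rule word_inverse_intertwines[OF J ra inv])
  have "pc J [r, a, t, a', e] [b, r, t, a', e]" using ctx[OF ra, of "[]" "[t, a', e]"] by simp
  also have "pc J \<dots> [b, t, r, a', e]" using ctx[OF rt, of "[b]" "[a', e]"] by simp
  also have "pc J \<dots> [b, t, b', r, e]" using ctx[OF ra', of "[b, t]" "[e]"] by simp
  also have "pc J \<dots> [b, t, b', e, r]" using ctx[OF re, of "[b, t, b']" "[]"] by simp
  finally show ?thesis .
qed

lemma word_absorbs_conjugate:
  assumes J: "finite J" and ka: "pc J [k, a] [b, k]" and inv: "pc J [a, a'] []" "pc J [b', b] []" "pc J [b, b'] []"
    and kt: "pc J [k, t] [k]" and ke: "pc J [k, e] [k]"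
  shows "pc J [k, a, t, a', e] [k]"
proof -
  note ctx = pc_ctx[OF J]
  have ka': "pc J [k, a'] [b', k]" by (rule word_inverse_intertwines[OF J ka inv(1,2)])
  have "pc J [k, a, t, a', e] [b, k, t, a', e]" using ctx[OF ka, of "[]" "[t, a', e]"] by simp
  also have "pc J \<dots> [b, k, a', e]" using ctx[OF kt, of "[b]" "[a', e]"] by simp
  also have "pc J \<dots> [b, b', k, e]" using ctx[OF ka', of "[b]" "[e]"] by simp
  also have "pc J \<dots> [k, e]" using ctx[OF inv(3), of "[]" "[k, e]"] by simp
  also have "pc J \<dots> [k]" by (rule ke)
  finally show ?thesis .
qed

text \<open>
  Abstract form of the exchange relation between $L^+$ and $L^-$; the factors $Q$ and
  the outer factors $R$ of the mixed cocycle cancel.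
\<close>

lemma word_mixed:
  assumes J: "finite J" and rr: "pc J [r, r'] []" and zq: "pc J [q, d1] [d1, q]" "pc J [q, q'] []"
    and w: "pc J [w1, e2] [e2, w1]" and z: "pc J [z1, e2] [e2, z1]"
    and de: "pc J [d1, e2] [e2, d1]" and ee: "pc J [e1, e2] [e2, e1]" and re: "pc J [r, e1, e2] [e1, e2, r]"
  shows "pc J [r, r', z1, q, d1, d1, q', w1, r, e1, e2] [e2, z1, d1, d1, w1, e1, r]"
proof -
  note ctx = pc_ctx[OF J]
  have "pc J [r, r', z1, q, d1, d1, q', w1, r, e1, e2] [z1, q, d1, d1, q', w1, r, e1, e2]"
    using ctx[OF rr, of "[]" "[z1, q, d1, d1, q', w1, r, e1, e2]"] by simp
  also have "pc J \<dots> [z1, d1, q, d1, q', w1, r, e1, e2]"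
    using ctx[OF zq(1), of "[z1]" "[d1, q', w1, r, e1, e2]"] by simp
  also have "pc J \<dots> [z1, d1, d1, q, q', w1, r, e1, e2]"
    using ctx[OF zq(1), of "[z1, d1]" "[q', w1, r, e1, e2]"] by simp
  also have "pc J \<dots> [z1, d1, d1, w1, r, e1, e2]"
    using ctx[OF zq(2), of "[z1, d1, d1]" "[w1, r, e1, e2]"] by simp
  also have "pc J \<dots> [z1, d1, d1, w1, e1, e2, r]"
    using ctx[OF re, of "[z1, d1, d1, w1]" "[]"] by simp
  also have "pc J \<dots> [z1, d1, d1, w1, e2, e1, r]"
    using ctx[OF ee, of "[z1, d1, d1, w1]" "[r]"] by simp
  also have "pc J \<dots> [z1, d1, d1, e2, w1, e1, r]"
    using ctx[OF w, of "[z1, d1, d1]" "[e1, r]"] by simp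
  also have "pc J \<dots> [z1, d1, e2, d1, w1, e1, r]"
    using ctx[OF de, of "[z1, d1]" "[w1, e1, r]"] by simp
  also have "pc J \<dots> [z1, e2, d1, d1, w1, e1, r]"
    using ctx[OF de, of "[z1]" "[d1, w1, e1, r]"] by simp
  also have "pc J \<dots> [e2, z1, d1, d1, w1, e1, r]"
    using ctx[OF z, of "[]" "[d1, d1, w1, e1, r]"] by simp
  finally show ?thesis .
qed

end

section \<open>Operators modulo a congruence\<close>

lemma (in ring_cong) scale: "a \<approx> b \<Longrightarrow> c * a \<approx> c * b"
  by (rule mult[OF refl])

text \<open>
  A representation of the free algebra by operators on another free algebra, where all the
  laws hold only up to the congruence on the target. Both $\xi$ and its twist have this form.
\<close>

locale operators = ring_cong eq
  for eq :: "('v::monoid_add \<Rightarrow>\<^sub>0 complex) \<Rightarrow> ('v \<Rightarrow>\<^sub>0 complex) \<Rightarrow> bool"  (infix "\<approx>" 50) +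
  fixes act :: "'g falg \<Rightarrow> ('v \<Rightarrow>\<^sub>0 complex) \<Rightarrow> ('v \<Rightarrow>\<^sub>0 complex)"
  assumes act_cong: "f \<approx> g \<Longrightarrow> act a f \<approx> act a g"
    and act_add_left: "act (a + b) f \<approx> act a f + act b f"
    and act_const_left: "act (const c * a) f \<approx> const c * act a f"
    and act_add: "act a (f + g) \<approx> act a f + act a g"
    and act_const: "act a (const c * f) \<approx> const c * act a f"
    and act_mult: "act (a * b) f \<approx> act a (act b f)"
    and act_one: "act 1 f \<approx> f"
begin

lemma act_zero_left: "act 0 f \<approx> 0"
  using act_const_left[of 0 0 f] by simp

lemma act_zero: "act a 0 \<approx> 0"
  using act_const[of a 0 0] by simp

lemma act_diff_left: "act (a - b) f \<approx> act a f - act b f"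
proof -
  have "act (a - b) f = act (a + const (- 1) * b) f" by (simp add: const_uminus)
  also have "\<dots> \<approx> act a f + act (const (- 1) * b) f" by (rule act_add_left)
  also have "\<dots> \<approx> act a f + const (- 1) * act b f" by (intro add refl act_const_left)
  also have "\<dots> = act a f - act b f" by (simp add: const_uminus)
  finally show ?thesis .
qed

lemma act_sum_left: "act (\<Sum>x\<in>X. a x) f \<approx> (\<Sum>x\<in>X. act (a x) f)"
proof (induction X rule: infinite_finite_induct)
  case (insert x X)
  have "act (\<Sum>x\<in>insert x X. a x) f \<approx> act (a x) f + act (\<Sum>x\<in>X. a x) f"
    using insert act_add_left by simp
  also have "\<dots> \<approx> act (a x) f + (\<Sum>x\<in>X. act (a x) f)"
    by (intro add refl insert)
  finally show ?case using insert by simp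
qed (simp_all add: act_zero_left)

lemma act_sum: "act a (\<Sum>x\<in>X. f x) \<approx> (\<Sum>x\<in>X. act a (f x))"
proof (induction X rule: infinite_finite_induct)
  case (insert x X)
  have "act a (\<Sum>x\<in>insert x X. f x) \<approx> act a (f x) + act a (\<Sum>x\<in>X. f x)"
    using insert act_add by simp
  also have "\<dots> \<approx> act a (f x) + (\<Sum>x\<in>X. act a (f x))"
    by (intro add refl insert)
  finally show ?case using insert by simp
qed (simp_all add: act_zero)

lemma act_lin: "act a (lin h x) \<approx> lin (\<lambda>k. act a (h k)) x"
proof -
  have "act a (lin h x) \<approx> (\<Sum>k\<in>Poly_Mapping.keys x. act a (const (Poly_Mapping.lookup x k) * h k))"
    unfolding lin_def by (rule act_sum)
  also have "\<dots> \<approx> lin (\<lambda>k. act a (h k)) x"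
    unfolding lin_def by (intro sum act_const)
  finally show ?thesis .
qed

lemma act_scalar: "act (const c) f \<approx> const c * f"
proof -
  have "act (const c * 1) f \<approx> const c * act 1 f" by (rule act_const_left)
  also have "\<dots> \<approx> const c * f" by (intro scale act_one)
  finally show ?thesis by simp
qed

definition act_mx :: "('v \<Rightarrow>\<^sub>0 complex) \<Rightarrow> ('j, 'g falg) mx \<Rightarrow> ('j, 'v \<Rightarrow>\<^sub>0 complex) mx" where
  "act_mx f A = (\<lambda>r c. act (A r c) f)"

lemma act_mx_const_left:
  "mxc J (act_mx f (mx_mult J (const_mx R) A)) (mx_mult J (const_mx R) (act_mx f A))"
  unfolding mxc_def
proof (intro ballI)
  fix r c
  have "act (\<Sum>k\<in>J. const (R r k) * A k c) f \<approx> (\<Sum>k\<in>J. act (const (R r k) * A k c) f)"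
    by (rule act_sum_left)
  also have "\<dots> \<approx> (\<Sum>k\<in>J. const (R r k) * act (A k c) f)"
    by (intro sum act_const_left)
  finally show "act_mx f (mx_mult J (const_mx R) A) r c \<approx> mx_mult J (const_mx R) (act_mx f A) r c"
    by (simp add: act_mx_def mx_mult_def const_mx_def)
qed

lemma act_mx_const_right:
  "mxc J (act_mx f (mx_mult J A (const_mx R))) (mx_mult J (act_mx f A) (const_mx R))"
  unfolding mxc_def
proof (intro ballI)
  fix r c
  have "act (\<Sum>k\<in>J. A r k * const (R k c)) f \<approx> (\<Sum>k\<in>J. act (A r k * const (R k c)) f)"
    by (rule act_sum_left)
  also have "\<dots> = (\<Sum>k\<in>J. act (const (R k c) * A r k) f)"
    by (simp only: const_commute)
  also have "\<dots> \<approx> (\<Sum>k\<in>J. const (R k c) * act (A r k) f)"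
    by (intro sum act_const_left)
  also have "\<dots> = (\<Sum>k\<in>J. act (A r k) f * const (R k c))"
    by (simp only: const_commute)
  finally show "act_mx f (mx_mult J A (const_mx R)) r c \<approx> mx_mult J (act_mx f A) (const_mx R) r c"
    by (simp add: act_mx_def mx_mult_def const_mx_def)
qed

text \<open>
  The relators $RXY-X'Y'R$ act by zero on \<open>f\<close> if and only if the matrices of values
  on \<open>f\<close> satisfy the relation; the entries of $R$ are scalars and pass through the operators.
\<close>

lemma act_exchange_iff:
  assumes J: "finite J"
  shows "(\<forall>r\<in>J. \<forall>c\<in>J. act (mx_prod J [const_mx R, X, Y] r c - mx_prod J [X', Y', const_mx R] r c) f \<approx> 0)
    \<longleftrightarrow> mxc J (mx_mult J (const_mx R) (act_mx f (mx_mult J X Y)))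
              (mx_mult J (act_mx f (mx_mult J X' Y')) (const_mx R))"
    (is "?L \<longleftrightarrow> mxc J ?A ?B")
proof -
  let ?P = "mx_mult J (const_mx R) (mx_mult J X Y)" and ?Q = "mx_mult J (mx_mult J X' Y') (const_mx R)"
  have PQ: "mx_prod J [const_mx R, X, Y] r c = ?P r c" "mx_prod J [X', Y', const_mx R] r c = ?Q r c"
    if "c \<in> J" for r c
    using J that by (simp_all add: mx_mult_one_right flip: mx_mult_assoc)
  have "?L \<longleftrightarrow> (\<forall>r\<in>J. \<forall>c\<in>J. act (?P r c - ?Q r c) f \<approx> 0)"
    by (simp only: PQ cong: ball_cong)
  also have "\<dots> \<longleftrightarrow> (\<forall>r\<in>J. \<forall>c\<in>J. act (?P r c) f \<approx> act (?Q r c) f)"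
    by (meson act_diff_left diff_zero sym trans)
  also have "\<dots> \<longleftrightarrow> mxc J (act_mx f ?P) (act_mx f ?Q)"
    by (simp add: mxc_def act_mx_def)
  also have "\<dots> \<longleftrightarrow> mxc J ?A ?B"
    by (meson act_mx_const_left act_mx_const_right mxc_sym mxc_trans)
  finally show ?thesis .
qed

lemma act_absorb_iff:
  assumes J: "finite J"
  shows "(\<forall>r\<in>J. \<forall>c\<in>J. act (mx_prod J [const_mx R, X, Y] r c - const_mx R r c) f \<approx> 0)
    \<longleftrightarrow> mxc J (mx_mult J (const_mx R) (act_mx f (mx_mult J X Y))) (\<lambda>r c. const (R r c) * f)"
    (is "?L \<longleftrightarrow> mxc J ?A ?B")
proof -
  let ?P = "mx_mult J (const_mx R) (mx_mult J X Y)"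
  have P: "mx_prod J [const_mx R, X, Y] r c = ?P r c" if "c \<in> J" for r c
    using J that by (simp add: mx_mult_one_right flip: mx_mult_assoc)
  have "?L \<longleftrightarrow> (\<forall>r\<in>J. \<forall>c\<in>J. act (?P r c - const_mx R r c) f \<approx> 0)"
    by (simp only: P cong: ball_cong)
  also have "\<dots> \<longleftrightarrow> (\<forall>r\<in>J. \<forall>c\<in>J. act (?P r c) f \<approx> act (const (R r c)) f)"
    unfolding const_mx_def by (meson act_diff_left diff_zero sym trans)
  also have "\<dots> \<longleftrightarrow> (\<forall>r\<in>J. \<forall>c\<in>J. act (?P r c) f \<approx> const (R r c) * f)"
    by (meson act_scalar sym trans)
  also have "\<dots> \<longleftrightarrow> mxc J (act_mx f ?P) ?B"
    by (simp add: mxc_def act_mx_def)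
  also have "\<dots> \<longleftrightarrow> mxc J ?A ?B"
    by (meson act_mx_const_left mxc_sym mxc_trans)
  finally show ?thesis .
qed

end

locale generator_operators = ring_cong eq
  for eq :: "('v::monoid_add \<Rightarrow>\<^sub>0 complex) \<Rightarrow> ('v \<Rightarrow>\<^sub>0 complex) \<Rightarrow> bool"  (infix "\<approx>" 50) +
  fixes tg :: "'g \<Rightarrow> ('v \<Rightarrow>\<^sub>0 complex) \<Rightarrow> ('v \<Rightarrow>\<^sub>0 complex)"
  assumes tg_cong: "f \<approx> h \<Longrightarrow> tg g f \<approx> tg g h"
    and tg_add: "tg g (f + h) \<approx> tg g f + tg g h"
    and tg_const: "tg g (const c * f) \<approx> const c * tg g f"
begin

definition ext :: "'g falg \<Rightarrow> ('v \<Rightarrow>\<^sub>0 complex) \<Rightarrow> ('v \<Rightarrow>\<^sub>0 complex)" where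
  "ext a f = lin (\<lambda>w. foldr tg (letters w) f) a"

lemma foldr_cong: "f \<approx> h \<Longrightarrow> foldr tg w f \<approx> foldr tg w h"
  by (induction w) (auto intro: tg_cong)

lemma foldr_add: "foldr tg w (f + h) \<approx> foldr tg w f + foldr tg w h"
proof (induction w)
  case (Cons g w)
  have "tg g (foldr tg w (f + h)) \<approx> tg g (foldr tg w f + foldr tg w h)" by (rule tg_cong[OF Cons])
  also have "\<dots> \<approx> tg g (foldr tg w f) + tg g (foldr tg w h)" by (rule tg_add)
  finally show ?case by simp
qed simp

lemma foldr_const: "foldr tg w (const c * f) \<approx> const c * foldr tg w f"
proof (induction w)
  case (Cons g w)
  have "tg g (foldr tg w (const c * f)) \<approx> tg g (const c * foldr tg w f)" by (rule tg_cong[OF Cons])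
  also have "\<dots> \<approx> const c * tg g (foldr tg w f)" by (rule tg_const)
  finally show ?case by simp
qed simp

lemma lin_cong: "(\<And>k. h k \<approx> h' k) \<Longrightarrow> lin h x \<approx> lin h' x"
  unfolding lin_def by (intro sum scale) auto

lemma lin_fun_add: "lin (\<lambda>k. h k + h' k) x = lin h x + lin h' x"
  by (simp add: lin_def distrib_left sum.distrib)

lemma lin_fun_const: "lin (\<lambda>k. const c * h k) x = const c * lin h x"
  unfolding lin_def sum_distrib_left
  by (rule sum.cong) (simp_all only: mult.assoc[symmetric] const_mult[symmetric] mult.commute[of c])

lemma foldr_lin: "foldr tg w (lin h x) \<approx> lin (\<lambda>k. foldr tg w (h k)) x"
proof (induction x rule: poly_mapping_induct)
  case zero
  show ?case using foldr_const[of w 0 0] by simp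
next
  case (add x k c)
  have "foldr tg w (lin h (x + Poly_Mapping.single k c)) \<approx> foldr tg w (lin h x) + foldr tg w (const c * h k)"
    unfolding lin_add lin_single by (rule foldr_add)
  also have "\<dots> \<approx> lin (\<lambda>k. foldr tg w (h k)) x + const c * foldr tg w (h k)"
    by (rule ring_cong.add[OF ring_cong_axioms add foldr_const])
  finally show ?case by (simp add: lin_add lin_single)
qed

lemma operators_ext: "operators eq ext"
proof
  fix a b f g c
  show "ext a f \<approx> ext a g" if "f \<approx> g"
    unfolding ext_def by (intro lin_cong foldr_cong that)
  show "ext (a + b) f \<approx> ext a f + ext b f" by (simp add: ext_def lin_add)
  show "ext (const c * a) f \<approx> const c * ext a f" by (simp add: ext_def lin_const)
  show "ext a (f + g) \<approx> ext a f + ext a g"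
    unfolding ext_def lin_fun_add[symmetric] by (intro lin_cong foldr_add)
  show "ext a (const c * f) \<approx> const c * ext a f"
    unfolding ext_def lin_fun_const[symmetric] by (intro lin_cong foldr_const)
  show "ext 1 f \<approx> f"
    using lin_single[of "\<lambda>w. foldr tg (letters w) f" 0 1] by (simp add: ext_def)
  show "ext (a * b) f \<approx> ext a (ext b f)"
  proof (induction a rule: poly_mapping_induct)
    case zero
    show ?case by (simp add: ext_def)
  next
    case (add a u d)
    have "ext (Poly_Mapping.single u d * b) f
        = const d * lin (\<lambda>v. foldr tg (letters u) (foldr tg (letters v) f)) b"
      by (simp add: ext_def lin_single_mult)
    also have "\<dots> \<approx> const d * foldr tg (letters u) (ext b f)"
      unfolding ext_def by (intro scale sym[OF foldr_lin])
    also have "\<dots> = ext (Poly_Mapping.single u d) (ext b f)" by (simp add: ext_def lin_single)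
    finally have "ext (Poly_Mapping.single u d * b) f \<approx> ext (Poly_Mapping.single u d) (ext b f)" .
    from ring_cong.add[OF ring_cong_axioms add this] show ?case
      by (simp add: ext_def distrib_right lin_add)
  qed
qed

lemma ext_gen: "ext (gen g) f = tg g f"
  by (simp add: ext_def gen_def lin_single)

end

section \<open>Twisting operators by a matrix\<close>

text \<open>
  The twist of $\xi$ by the matrices \<open>Phi b\<close>. The assumptions express that the
  comultiplication and the counit have matrix form on the generators \<open>L b\<close>.
\<close>

locale twisted_operators = X: operators eq xi + T: operators eq tw
  for eq :: "('v::monoid_add \<Rightarrow>\<^sub>0 complex) \<Rightarrow> ('v \<Rightarrow>\<^sub>0 complex) \<Rightarrow> bool"  (infix "\<approx>" 50)
    and xi tw :: "'g falg \<Rightarrow> ('v \<Rightarrow>\<^sub>0 complex) \<Rightarrow> ('v \<Rightarrow>\<^sub>0 complex)" +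
  fixes I :: "'i set" and L :: "'l \<Rightarrow> ('i, 'g falg) mx" and Phi :: "'l \<Rightarrow> ('i, 'v \<Rightarrow>\<^sub>0 complex) mx"
  assumes I: "finite I"
    and xi_product: "\<And>b i j f g. i \<in> I \<Longrightarrow> j \<in> I \<Longrightarrow>
      xi (L b i j) (f * g) \<approx> (\<Sum>k\<in>I. xi (L b i k) f * xi (L b k j) g)"
    and xi_unit: "\<And>b i j. i \<in> I \<Longrightarrow> j \<in> I \<Longrightarrow> xi (L b i j) 1 \<approx> (if i = j then 1 else 0)"
    and tw_L: "\<And>b i j f. i \<in> I \<Longrightarrow> j \<in> I \<Longrightarrow> tw (L b i j) f \<approx> (\<Sum>k\<in>I. xi (L b i k) f * Phi b k j)"
begin

text \<open>
  The matrix $\xi(L_1)\cdot A_2$.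
\<close>

definition ximx :: "'l \<Rightarrow> ('i, 'v \<Rightarrow>\<^sub>0 complex) mx \<Rightarrow> ('i \<times> 'i, 'v \<Rightarrow>\<^sub>0 complex) mx" where
  "ximx b A = (\<lambda>(j, k) (u, v). xi (L b j u) (A k v))"

lemma ximx_mult: "X.mxc (I \<times> I) (ximx b (mx_mult I A B)) (mx_mult (I \<times> I) (ximx b A) (ximx b B))"
  unfolding X.mxc_def
proof clarify
  fix j k u v assume jk: "j \<in> I" "k \<in> I" "u \<in> I" "v \<in> I"
  have "ximx b (mx_mult I A B) (j, k) (u, v) = xi (L b j u) (\<Sum>m\<in>I. A k m * B m v)"
    by (simp add: ximx_def mx_mult_def)
  also have "\<dots> \<approx> (\<Sum>m\<in>I. xi (L b j u) (A k m * B m v))" by (rule X.act_sum)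
  also have "\<dots> \<approx> (\<Sum>m\<in>I. \<Sum>n\<in>I. xi (L b j n) (A k m) * xi (L b n u) (B m v))"
    by (intro X.sum xi_product jk)
  also have "\<dots> = (\<Sum>n\<in>I. \<Sum>m\<in>I. xi (L b j n) (A k m) * xi (L b n u) (B m v))"
    by (rule sum.swap)
  also have "\<dots> = mx_mult (I \<times> I) (ximx b A) (ximx b B) (j, k) (u, v)"
    unfolding mx_mult_def sum.cartesian_product by (rule sum.cong) (auto simp: ximx_def)
  finally show "ximx b (mx_mult I A B) (j, k) (u, v) \<approx> mx_mult (I \<times> I) (ximx b A) (ximx b B) (j, k) (u, v)" .
qed

lemma ximx_const: "X.mxc (I \<times> I) (ximx b (const_mx A)) (mx_2 (const_mx A))"
  unfolding X.mxc_def
proof clarify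
  fix j k u v assume jk: "j \<in> I" "k \<in> I" "u \<in> I" "v \<in> I"
  have "xi (L b j u) (const (A k v) * 1) \<approx> const (A k v) * xi (L b j u) 1" by (rule X.act_const)
  also have "\<dots> \<approx> const (A k v) * (if j = u then 1 else 0)" by (intro X.scale xi_unit jk)
  finally show "ximx b (const_mx A) (j, k) (u, v) \<approx> mx_2 (const_mx A) (j, k) (u, v)"
    by (cases "j = u") (simp_all add: ximx_def const_mx_def mx_2_def kron_def mx_one_def)
qed

lemma ximx_cong: "X.mxc I A B \<Longrightarrow> X.mxc (I \<times> I) (ximx b A) (ximx b B)"
  unfolding X.mxc_def by (clarsimp simp: ximx_def intro!: X.act_cong)

lemma ximx_prod: "X.mxc (I \<times> I) (ximx b (mx_prod I As)) (mx_prod (I \<times> I) (map (ximx b) As))"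
proof (induction As)
  case Nil
  have "mx_2 mx_one = (mx_one :: ('i \<times> 'i, 'v \<Rightarrow>\<^sub>0 complex) mx)"
    by (intro ext) (auto simp: mx_2_def kron_def mx_one_def split: if_splits)
  then show ?case using ximx_const[of b mx_one] by (simp add: const_mx_one)
next
  case (Cons A As)
  have "X.mxc (I \<times> I) (ximx b (mx_prod I (A # As))) (mx_mult (I \<times> I) (ximx b A) (ximx b (mx_prod I As)))"
    using ximx_mult by simp
  also have "X.mxc (I \<times> I) \<dots> (mx_prod (I \<times> I) (map (ximx b) (A # As)))"
    using Cons by (simp add: X.mxc_mult)
  finally show ?case .
qed

text \<open>
  $\xi(L_1)\cdot$ is multiplicative on matrices and maps the unit to the unit, so it maps
  inverses to inverses.
\<close>

lemma ximx_inverse: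
  assumes AB: "mx_eq I (mx_mult I A B) mx_one"
    and A: "X.pc (I \<times> I) [ximx b A] As" and inv: "X.pc (I \<times> I) (Bs @ As) []"
  shows "X.pc (I \<times> I) [ximx b B] Bs"
proof -
  have J: "finite (I \<times> I)" using I by simp
  have "X.mxc (I \<times> I) (mx_mult (I \<times> I) (ximx b A) (ximx b B)) (ximx b (mx_mult I A B))"
    by (rule X.mxc_sym[OF ximx_mult])
  also have "X.mxc (I \<times> I) \<dots> (ximx b mx_one)"
    by (intro ximx_cong X.mx_eq_mxc AB)
  also have "X.mxc (I \<times> I) \<dots> mx_one" using ximx_prod[of b "[]"] by simp
  finally have "X.pc (I \<times> I) [ximx b A, ximx b B] []"
    using J by (simp add: X.pc_def X.mxc_def mx_mult_one_right flip: mx_mult_assoc)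
  moreover have "X.pc (I \<times> I) [ximx b A, ximx b B] (As @ [ximx b B])"
    using X.pc_ctx[OF J A, of "[]" "[ximx b B]"] by simp
  ultimately have "X.pc (I \<times> I) (As @ [ximx b B]) []" by (meson X.pc_sym X.pc_trans)
  from X.pc_inverse_unique[OF J inv this] show ?thesis by (rule X.pc_sym)
qed

text \<open>
  The matrix $M_{12}=(\xi(L_1)\cdot\Phi'_2)\,\Phi_1$ for $L=$ \<open>L b\<close> and $L'=$ \<open>L b'\<close>.
\<close>

definition cocycle :: "'l \<Rightarrow> 'l \<Rightarrow> ('i \<times> 'i, 'v \<Rightarrow>\<^sub>0 complex) mx" where
  "cocycle b b' = mx_mult (I \<times> I) (ximx b (Phi b')) (mx_1 (Phi b))"

lemma cocycle_entry:
  assumes "u \<in> I" "v \<in> I"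
  shows "cocycle b b' (n, m) (u, v) = (\<Sum>a\<in>I. xi (L b n a) (Phi b' m v) * Phi b a u)"
proof -
  have "cocycle b b' (n, m) (u, v) = (\<Sum>a\<in>I. \<Sum>c\<in>I. if c = v then xi (L b n a) (Phi b' m v) * Phi b a u else 0)"
    unfolding cocycle_def mx_mult_def sum.cartesian_product
    by (rule sum.cong) (auto simp: ximx_def mx_1_def kron_def mx_one_def)
  also have "\<dots> = (\<Sum>a\<in>I. xi (L b n a) (Phi b' m v) * Phi b a u)"
    using I assms by simp
  finally show ?thesis .
qed

text \<open>
  Expanding the outer twisted operator on the product $(\xi(L'_2)f)\,\Phi'_2$ by the
  comultiplication separates the part that acts on \<open>f\<close> from the cocycle.
\<close>

lemma tw_tw:
  assumes jk: "j \<in> I" "k \<in> I" "u \<in> I" "v \<in> I"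
  shows "tw (L b j u) (tw (L b' k v) f)
    \<approx> (\<Sum>n\<in>I. \<Sum>m\<in>I. xi (L b j n) (xi (L b' k m) f) * cocycle b b' (n, m) (u, v))"
proof -
  have "tw (L b j u) (tw (L b' k v) f) \<approx> tw (L b j u) (\<Sum>m\<in>I. xi (L b' k m) f * Phi b' m v)"
    by (intro T.act_cong tw_L jk)
  also have "\<dots> \<approx> (\<Sum>a\<in>I. xi (L b j a) (\<Sum>m\<in>I. xi (L b' k m) f * Phi b' m v) * Phi b a u)"
    by (intro tw_L jk)
  also have "\<dots> \<approx> (\<Sum>a\<in>I. (\<Sum>m\<in>I. xi (L b j a) (xi (L b' k m) f * Phi b' m v)) * Phi b a u)"
    by (intro X.sum X.mult X.act_sum X.refl)
  also have "\<dots> \<approx> (\<Sum>a\<in>I. (\<Sum>m\<in>I. \<Sum>n\<in>I. xi (L b j n) (xi (L b' k m) f) * xi (L b n a) (Phi b' m v)) * Phi b a u)"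
    by (intro X.sum X.mult X.refl xi_product jk)
  also have "\<dots> = (\<Sum>a\<in>I. \<Sum>m\<in>I. \<Sum>n\<in>I. xi (L b j n) (xi (L b' k m) f) * (xi (L b n a) (Phi b' m v) * Phi b a u))"
    by (simp only: sum_distrib_right mult.assoc)
  also have "\<dots> = (\<Sum>m\<in>I. \<Sum>a\<in>I. \<Sum>n\<in>I. xi (L b j n) (xi (L b' k m) f) * (xi (L b n a) (Phi b' m v) * Phi b a u))"
    by (rule sum.swap)
  also have "\<dots> = (\<Sum>m\<in>I. \<Sum>n\<in>I. \<Sum>a\<in>I. xi (L b j n) (xi (L b' k m) f) * (xi (L b n a) (Phi b' m v) * Phi b a u))"
    by (intro sum.cong HOL.refl sum.swap)
  also have "\<dots> = (\<Sum>m\<in>I. \<Sum>n\<in>I. xi (L b j n) (xi (L b' k m) f) * cocycle b b' (n, m) (u, v))"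
    using jk by (simp only: cocycle_entry sum_distrib_left)
  also have "\<dots> = (\<Sum>n\<in>I. \<Sum>m\<in>I. xi (L b j n) (xi (L b' k m) f) * cocycle b b' (n, m) (u, v))"
    by (rule sum.swap)
  finally show ?thesis .
qed

lemma tw_12:
  "X.mxc (I \<times> I) (T.act_mx f (mx_mult (I \<times> I) (mx_1 (L b)) (mx_2 (L b'))))
     (mx_mult (I \<times> I) (X.act_mx f (mx_mult (I \<times> I) (mx_1 (L b)) (mx_2 (L b')))) (cocycle b b'))"
  unfolding X.mxc_def
proof clarify
  fix j k u v assume jk: "j \<in> I" "k \<in> I" "u \<in> I" "v \<in> I"
  have "T.act_mx f (mx_mult (I \<times> I) (mx_1 (L b)) (mx_2 (L b'))) (j, k) (u, v) = tw (L b j u * L b' k v) f"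
    using jk I by (simp add: T.act_mx_def mx_1_mx_2_entry)
  also have "\<dots> \<approx> tw (L b j u) (tw (L b' k v) f)" by (rule T.act_mult)
  also have "\<dots> \<approx> (\<Sum>n\<in>I. \<Sum>m\<in>I. xi (L b j n) (xi (L b' k m) f) * cocycle b b' (n, m) (u, v))"
    by (rule tw_tw[OF jk])
  also have "\<dots> \<approx> (\<Sum>n\<in>I. \<Sum>m\<in>I. xi (L b j n * L b' k m) f * cocycle b b' (n, m) (u, v))"
    by (intro X.sum X.mult X.refl X.sym[OF X.act_mult])
  also have "\<dots> = mx_mult (I \<times> I) (X.act_mx f (mx_mult (I \<times> I) (mx_1 (L b)) (mx_2 (L b')))) (cocycle b b') (j, k) (u, v)"
    unfolding mx_mult_def[of "I \<times> I" "X.act_mx _ _"] sum.cartesian_product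
    by (rule sum.cong) (use jk I in \<open>auto simp: X.act_mx_def mx_1_mx_2_entry\<close>)
  finally show "T.act_mx f (mx_mult (I \<times> I) (mx_1 (L b)) (mx_2 (L b'))) (j, k) (u, v)
    \<approx> mx_mult (I \<times> I) (X.act_mx f (mx_mult (I \<times> I) (mx_1 (L b)) (mx_2 (L b')))) (cocycle b b') (j, k) (u, v)" .
qed

lemma act_mx_swap: "X.act_mx f (mx_swap A) = mx_swap (X.act_mx f A)"
  "T.act_mx f (mx_swap A) = mx_swap (T.act_mx f A)"
  by (simp_all add: X.act_mx_def T.act_mx_def mx_swap_def)

lemma tw_21:
  "X.mxc (I \<times> I) (T.act_mx f (mx_mult (I \<times> I) (mx_2 (L b')) (mx_1 (L b))))
     (mx_mult (I \<times> I) (X.act_mx f (mx_mult (I \<times> I) (mx_2 (L b')) (mx_1 (L b)))) (mx_swap (cocycle b' b)))"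
  using X.mxc_swap[OF tw_12[of f b' b]]
  by (simp add: mx_swap_mult flip: act_mx_swap)

text \<open>
  $R\,T(L'_2L_1)f=R\,\xi(L'_2L_1)f\,\tilde M_{21}=\xi(L_1L'_2)f\,R\tilde M_{21}
  =\xi(L_1L'_2)f\,M_{12}R=T(L_1L'_2)f\,R$.
\<close>

lemma exchange_transfer:
  assumes R: "X.mxc (I \<times> I) (mx_mult (I \<times> I) (const_mx R) (mx_swap (cocycle b' b)))
      (mx_mult (I \<times> I) (cocycle b b') (const_mx R))"
    and xi: "\<And>r c. r \<in> I \<times> I \<Longrightarrow> c \<in> I \<times> I \<Longrightarrow>
      xi (mx_prod (I \<times> I) [const_mx R, mx_2 (L b'), mx_1 (L b)] r c
        - mx_prod (I \<times> I) [mx_1 (L b), mx_2 (L b'), const_mx R] r c) f \<approx> 0"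
    and rc: "r \<in> I \<times> I" "c \<in> I \<times> I"
  shows "tw (mx_prod (I \<times> I) [const_mx R, mx_2 (L b'), mx_1 (L b)] r c
      - mx_prod (I \<times> I) [mx_1 (L b), mx_2 (L b'), const_mx R] r c) f \<approx> 0"
proof -
  let ?J = "I \<times> I" and ?R = "const_mx R :: ('i \<times> 'i, 'v \<Rightarrow>\<^sub>0 complex) mx"
  let ?A = "mx_mult ?J (mx_2 (L b')) (mx_1 (L b))" and ?B = "mx_mult ?J (mx_1 (L b)) (mx_2 (L b'))"
  have J: "finite ?J" using I by simp
  have X: "X.mxc ?J (mx_mult ?J ?R (X.act_mx f ?A)) (mx_mult ?J (X.act_mx f ?B) ?R)"
    using xi X.act_exchange_iff[OF J] by blast
  have "X.mxc ?J (mx_mult ?J ?R (T.act_mx f ?A)) (mx_mult ?J ?R (mx_mult ?J (X.act_mx f ?A) (mx_swap (cocycle b' b))))"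
    by (intro X.mxc_mult X.mxc_refl tw_21)
  also have "X.mxc ?J \<dots> (mx_mult ?J (X.act_mx f ?B) (mx_mult ?J ?R (mx_swap (cocycle b' b))))"
    using X.mxc_mult[OF X X.mxc_refl[of ?J "mx_swap (cocycle b' b)"]] by (simp only: mx_mult_assoc)
  also have "X.mxc ?J \<dots> (mx_mult ?J (X.act_mx f ?B) (mx_mult ?J (cocycle b b') ?R))"
    by (intro X.mxc_mult X.mxc_refl R)
  also have "X.mxc ?J \<dots> (mx_mult ?J (T.act_mx f ?B) ?R)"
    using X.mxc_mult[OF X.mxc_sym[OF tw_12[of f b b']] X.mxc_refl[of ?J ?R]] by (simp only: mx_mult_assoc)
  finally have "X.mxc ?J (mx_mult ?J ?R (T.act_mx f ?A)) (mx_mult ?J (T.act_mx f ?B) ?R)" .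
  from T.act_exchange_iff[OF J, THEN iffD2, OF this] rc show ?thesis by blast
qed

text \<open>
  $K\,T(L_2L_1)f=K\,\xi(L_2L_1)f\,M_{21}=f\,KM_{21}=f\,K$.
\<close>

lemma absorb_transfer:
  assumes K: "X.mxc (I \<times> I) (mx_mult (I \<times> I) (const_mx K) (mx_swap (cocycle b b))) (const_mx K)"
    and xi: "\<And>r c. r \<in> I \<times> I \<Longrightarrow> c \<in> I \<times> I \<Longrightarrow>
      xi (mx_prod (I \<times> I) [const_mx K, mx_2 (L b), mx_1 (L b)] r c - const_mx K r c) f \<approx> 0"
    and rc: "r \<in> I \<times> I" "c \<in> I \<times> I"
  shows "tw (mx_prod (I \<times> I) [const_mx K, mx_2 (L b), mx_1 (L b)] r c - const_mx K r c) f \<approx> 0"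
proof -
  let ?J = "I \<times> I" and ?K = "const_mx K :: ('i \<times> 'i, 'v \<Rightarrow>\<^sub>0 complex) mx"
  let ?A = "mx_mult ?J (mx_2 (L b)) (mx_1 (L b))" and ?M = "mx_swap (cocycle b b)"
  define fm where "fm = (\<lambda>A :: ('i \<times> 'i, 'v \<Rightarrow>\<^sub>0 complex) mx. \<lambda>r c. f * A r c)"
  have J: "finite ?J" using I by simp
  have Kf: "(\<lambda>r c. const (K r c) * f) = fm ?K"
    by (intro ext) (simp add: fm_def const_mx_def const_commute)
  have fm_mult: "mx_mult ?J (fm A) B = fm (mx_mult ?J A B)" for A B
    by (intro ext) (simp add: fm_def mx_mult_def sum_distrib_left mult.assoc)
  have X: "X.mxc ?J (mx_mult ?J ?K (X.act_mx f ?A)) (fm ?K)"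
    using xi X.act_absorb_iff[OF J, of K "mx_2 (L b)" "mx_1 (L b)" f] unfolding Kf by blast
  have "X.mxc ?J (mx_mult ?J ?K (T.act_mx f ?A)) (mx_mult ?J ?K (mx_mult ?J (X.act_mx f ?A) ?M))"
    by (intro X.mxc_mult X.mxc_refl tw_21)
  also have "X.mxc ?J \<dots> (mx_mult ?J (fm ?K) ?M)"
    using X.mxc_mult[OF X X.mxc_refl[of ?J ?M]] by (simp only: mx_mult_assoc)
  also have "X.mxc ?J \<dots> (fm ?K)"
    unfolding fm_mult using K by (simp add: fm_def X.mxc_def X.scale)
  finally have "X.mxc ?J (mx_mult ?J ?K (T.act_mx f ?A)) (fm ?K)" .
  from T.act_absorb_iff[OF J, of K _ _ f, unfolded Kf, THEN iffD2, OF this] rc show ?thesis by blast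
qed

end

section \<open>The presentations of the bialgebra and of the big cell\<close>

context presentation
begin

definition eqv :: "'g falg \<Rightarrow> 'g falg \<Rightarrow> bool" where
  "eqv a b \<longleftrightarrow> p a = p b"

lemma ring_cong_eqv: "ring_cong eqv"
proof
  fix a b c d assume "eqv a b" "eqv c d"
  then have "p a \<oplus>\<^bsub>A\<^esub> p c = p b \<oplus>\<^bsub>A\<^esub> p d" "p a \<otimes>\<^bsub>A\<^esub> p c = p b \<otimes>\<^bsub>A\<^esub> p d"
    by (simp_all add: eqv_def)
  then show "eqv (a + c) (b + d)" "eqv (a * c) (b * d)"
    by (simp_all add: eqv_def pres_add pres_mult)
qed (simp_all add: eqv_def)

end

text \<open>
  Membership of the entries in the carrier of \<open>free_algebra G\<close>.
\<close>

definition fixed_on :: "'g set \<Rightarrow> 'i set \<Rightarrow> ('i, 'g falg) mx \<Rightarrow> bool" where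
  "fixed_on G J A \<longleftrightarrow> (\<forall>i\<in>J. \<forall>j\<in>J. retr G (A i j) = A i j)"

lemma fixed_const: "fixed_on G J (const_mx A)"
  by (simp add: fixed_on_def const_mx_def)

lemma fixed_one: "fixed_on G J mx_one"
  by (simp add: fixed_on_def mx_one_def)

lemma fixed_mult: "fixed_on G J A \<Longrightarrow> fixed_on G J B \<Longrightarrow> fixed_on G J (mx_mult J A B)"
  by (simp add: fixed_on_def mx_mult_def retr_sum retr_mult)

lemma fixed_prod: "\<forall>A\<in>set As. fixed_on G J A \<Longrightarrow> fixed_on G J (mx_prod J As)"
  by (induction As) (simp_all add: fixed_one fixed_mult)

lemma fixed_diag: "fixed_on G J A \<Longrightarrow> fixed_on G J (mx_diag A)"
  by (simp add: fixed_on_def mx_diag_def)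

lemma fixed_1: "fixed_on G I A \<Longrightarrow> fixed_on G (I \<times> I) (mx_1 A)"
  by (auto simp: fixed_on_def mx_1_def kron_def mx_one_def retr_mult)

lemma fixed_2: "fixed_on G I A \<Longrightarrow> fixed_on G (I \<times> I) (mx_2 A)"
  by (auto simp: fixed_on_def mx_2_def kron_def mx_one_def retr_mult)

lemma fixed_rel: "fixed_on G J A \<Longrightarrow> fixed_on G J B \<Longrightarrow> r \<in> mx_rel J A B \<Longrightarrow> retr G r = r"
  by (auto simp: fixed_on_def mx_rel_def retr_diff)

lemma retr_gen: "g \<in> G \<Longrightarrow> retr G (gen g) = gen g"
  by (simp add: gen_def retr_single)

lemma retr_prod_list: "\<forall>a\<in>set as. retr G a = a \<Longrightarrow> retr G (prod_list as) = prod_list as"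
  by (induction as) (simp_all add: retr_mult)

text \<open>
  The Boolean is the sign: $L^+$ for true, $L^-$ for false. It lets the two triangular
  matrices share one proof.
\<close>

definition Lmat :: "bool \<Rightarrow> (nat, ugen falg) mx" where
  "Lmat b = (if b then Lplus else Lminus)"

definition Lgen :: "bool \<Rightarrow> nat \<Rightarrow> nat \<Rightarrow> ugen" where
  "Lgen b i j = (if b then LP i j else LM i j)"

definition tri :: "bool \<Rightarrow> nat \<Rightarrow> nat \<Rightarrow> bool" where
  "tri b i j \<longleftrightarrow> (if b then i \<le> j else j \<le> i)"

lemma tri_refl [simp]: "tri b i i" by (simp add: tri_def)
lemma tri_trans: "tri b i k \<Longrightarrow> tri b k j \<Longrightarrow> tri b i j" by (auto simp: tri_def split: if_splits)
lemma tri_antisym: "tri b i k \<Longrightarrow> tri b k i \<Longrightarrow> i = k" by (auto simp: tri_def split: if_splits)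

lemma Lmat_eq: "Lmat b i j = (if tri b i j then gen (Lgen b i j) else 0)"
  by (simp add: Lmat_def Lgen_def tri_def Lplus_def Lminus_def)

lemma Lgen_in: "i \<in> idx s l \<Longrightarrow> j \<in> idx s l \<Longrightarrow> tri b i j \<Longrightarrow> Lgen b i j \<in> U_gens s l"
  by (auto simp: Lgen_def tri_def U_gens_def split: if_splits)

lemma U_gens_cases:
  assumes "g \<in> U_gens s l"
  obtains b i j where "i \<in> idx s l" "j \<in> idx s l" "tri b i j" "g = Lgen b i j"
  using assms unfolding U_gens_def
proof (elim UnE CollectE exE conjE)
  fix i j assume "g = LP i j" "i \<in> idx s l" "j \<in> idx s l" "i \<le> j"
  then show ?thesis using that[of i j True] by (simp add: tri_def Lgen_def)
next
  fix i j assume "g = LM i j" "i \<in> idx s l" "j \<in> idx s l" "j \<le> i"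
  then show ?thesis using that[of i j False] by (simp add: tri_def Lgen_def)
qed

lemma fixed_Lmat: "fixed_on (U_gens s l) (idx s l) (Lmat b)"
  by (auto simp: fixed_on_def Lmat_eq retr_gen Lgen_in)

lemma fixed_Lplus: "fixed_on (U_gens s l) (idx s l) Lplus"
  using fixed_Lmat[of s l True] by (simp add: Lmat_def)

lemma fixed_Lminus: "fixed_on (U_gens s l) (idx s l) Lminus"
  using fixed_Lmat[of s l False] by (simp add: Lmat_def)

text \<open>
  No ideal contains relators from outside the carrier, and the generated ideal would then be the
  whole type; so all relators have to be words in the generators.
\<close>

lemma presentation_U: "presentation (U_gens s l) (U_rels s l q)"
proof
  let ?G = "U_gens s l" and ?I = "idx s l" and ?J = "idx s l \<times> idx s l"
  note fx = fixed_const fixed_1[OF fixed_Lplus] fixed_2[OF fixed_Lplus] fixed_1[OF fixed_Lminus]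
    fixed_2[OF fixed_Lminus] fixed_diag[OF fixed_Lplus] fixed_diag[OF fixed_Lminus] fixed_one
  have sub: "mx_rel X A B \<subseteq> {r. retr ?G r = r}" if "fixed_on ?G X A" "fixed_on ?G X B"
    for X and A B :: "('i, ugen falg) mx"
    using fixed_rel[OF that] by blast
  have P: "fixed_on ?G X (mx_prod X [A, B])" if "fixed_on ?G X A" "fixed_on ?G X B"
    for X and A B :: "('i, ugen falg) mx"
    using that by (intro fixed_prod) simp
  have P3: "fixed_on ?G X (mx_prod X [A, B, C])" if "fixed_on ?G X A" "fixed_on ?G X B" "fixed_on ?G X C"
    for X and A B C :: "('i, ugen falg) mx"
    using that by (intro fixed_prod) simp
  have det: "retr ?G (prod_list (map (\<lambda>i. Lplus i i) [1..<vdim s l + 1])) = prod_list (map (\<lambda>i. Lplus i i) [1..<vdim s l + 1])"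
  proof (rule retr_prod_list)
    show "\<forall>a\<in>set (map (\<lambda>i. Lplus i i) [1..<vdim s l + 1]). retr ?G a = a"
      using fixed_Lplus[of s l] by (auto simp: fixed_on_def idx_def)
  qed
  have "U_rels s l q \<subseteq> {r. retr ?G r = r}"
    unfolding U_rels_def Let_def idx2_def
  proof (intro Un_least)
    show "(if s = TypeA then {} else mx_rel ?J (mx_prod ?J [const_mx (K_mx s l q), mx_2 Lplus, mx_1 Lplus]) (const_mx (K_mx s l q))
        \<union> mx_rel ?J (mx_prod ?J [const_mx (K_mx s l q), mx_2 Lminus, mx_1 Lminus]) (const_mx (K_mx s l q)))
      \<subseteq> {r. retr ?G r = r}"
    proof (cases "s = TypeA")
      case False
      show ?thesis unfolding if_not_P[OF False] by (intro Un_least sub P3 fx)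
    qed simp
    show "{prod_list (map (\<lambda>i. Lplus i i) [1..<vdim s l + 1]) - 1} \<subseteq> {r. retr ?G r = r}"
      unfolding insert_subset mem_Collect_eq retr_diff det retr_1 by simp
  qed (intro sub P P3 fx)+
  then show "retr ?G r = r" if "r \<in> U_rels s l q" for r
    using that by blast
qed

lemma fixed_Zstar: "fixed_on (C_gens s l) (idx s l) Zstar"
  by (auto simp: fixed_on_def Zstar_def C_gens_def retr_gen)

lemma presentation_C: "presentation (C_gens s l) (C_rels s l q)"
proof
  fix r assume "r \<in> C_rels s l q"
  then show "retr (C_gens s l) r = r"
    unfolding C_rels_def Let_def idx2_def
    by (rule fixed_rel[rotated 2]; intro fixed_prod)
       (auto intro: fixed_const fixed_1 fixed_2 fixed_Zstar)
qed

definition Winv :: "series \<Rightarrow> nat \<Rightarrow> (nat, (nat \<times> nat) falg) mx" where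
  "Winv s l = mx_inv (idx s l) Zstar"

lemma
  shows Zstar_Winv: "mx_eq (idx s l) (mx_mult (idx s l) Zstar (Winv s l)) mx_one"
    and Winv_Zstar: "mx_eq (idx s l) (mx_mult (idx s l) (Winv s l) Zstar) mx_one"
    and Winv_tri: "\<And>i j. i \<in> idx s l \<Longrightarrow> j \<in> idx s l \<Longrightarrow> \<not> j \<le> i \<Longrightarrow> Winv s l i j = 0"
    and Winv_diag: "\<And>i. i \<in> idx s l \<Longrightarrow> Winv s l i i = 1"
proof -
  have tri: "tri_on (idx s l) id Zstar" by (auto simp: tri_on_def Zstar_def)
  note inv = tri_inverse[OF finite_idx(1) tri, of "\<lambda>_. 1", folded Winv_def]
  show "mx_eq (idx s l) (mx_mult (idx s l) Zstar (Winv s l)) mx_one"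
    "mx_eq (idx s l) (mx_mult (idx s l) (Winv s l) Zstar) mx_one"
    "\<And>i. i \<in> idx s l \<Longrightarrow> Winv s l i i = 1"
    by (rule inv; simp add: Zstar_def)+
  have "tri_on (idx s l) id (Winv s l)" by (rule inv) (simp_all add: Zstar_def)
  then show "\<And>i j. i \<in> idx s l \<Longrightarrow> j \<in> idx s l \<Longrightarrow> \<not> j \<le> i \<Longrightarrow> Winv s l i j = 0"
    by (force simp: tri_on_def)
qed

text \<open>
  The inverse is formed in the free algebra on the whole type. Applying the retraction to
  its entries gives another inverse of the same matrix, so the entries are fixed by it.
\<close>

lemma fixed_Winv: "fixed_on (C_gens s l) (idx s l) (Winv s l)"
proof -
  let ?I = "idx s l" and ?r = "retr (C_gens s l)"
  let ?B = "\<lambda>i j. ?r (Winv s l i j)"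
  have Z: "?r (Zstar i j) = Zstar i j" if "i \<in> ?I" "j \<in> ?I" for i j
    using that fixed_Zstar by (simp add: fixed_on_def)
  have one: "?r (mx_one i j) = mx_one i j" for i j :: nat by (simp add: mx_one_def)
  have "mx_eq ?I (mx_mult ?I Zstar ?B) mx_one"
    unfolding mx_eq_def
  proof (intro ballI)
    fix i j assume ij: "i \<in> ?I" "j \<in> ?I"
    have "mx_mult ?I Zstar ?B i j = ?r (mx_mult ?I Zstar (Winv s l) i j)"
      using ij by (simp add: mx_mult_def retr_sum retr_mult Z)
    then show "mx_mult ?I Zstar ?B i j = mx_one i j"
      using Zstar_Winv[of s l] ij one by (simp add: mx_eq_def)
  qed
  moreover have "mx_eq ?I (mx_mult ?I ?B Zstar) mx_one"
    unfolding mx_eq_def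
  proof (intro ballI)
    fix i j assume ij: "i \<in> ?I" "j \<in> ?I"
    have "mx_mult ?I ?B Zstar i j = ?r (mx_mult ?I (Winv s l) Zstar i j)"
      using ij by (simp add: mx_mult_def retr_sum retr_mult Z)
    then show "mx_mult ?I ?B Zstar i j = mx_one i j"
      using Winv_Zstar[of s l] ij one by (simp add: mx_eq_def)
  qed
  ultimately have "mx_eq ?I (mx_inv ?I Zstar) ?B" by (rule mx_inv_props(3)[OF finite_idx(1)])
  then show ?thesis by (simp add: fixed_on_def mx_eq_def Winv_def)
qed

lemma mx_inv_Z1: "mx_eq (idx s l \<times> idx s l) (mx_inv (idx s l \<times> idx s l) (mx_1 Zstar)) (mx_1 (Winv s l))"
proof (rule mx_inv_props(3))
  let ?J = "idx s l \<times> idx s l"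
  have *: "mx_eq ?J (mx_mult ?J (mx_1 A) (mx_1 B)) mx_one"
    if "mx_eq (idx s l) (mx_mult (idx s l) A B) mx_one" for A B :: "(nat, (nat \<times> nat) falg) mx"
  proof -
    have "req.mxc ?J (mx_mult ?J (mx_1 A) (mx_1 B)) (mx_1 (mx_mult (idx s l) A B))"
      by (rule req.mxc_sym[OF req.mx_1_mult[OF finite_idx(1)]])
    also have "req.mxc ?J \<dots> (mx_1 mx_one)"
      by (rule req.mx_1_cong) (simp add: req_mxc that)
    finally show ?thesis by (simp add: req_mxc req.mx_1_one)
  qed
  show "mx_eq ?J (mx_mult ?J (mx_1 Zstar) (mx_1 (Winv s l))) mx_one" by (rule *[OF Zstar_Winv])
  show "mx_eq ?J (mx_mult ?J (mx_1 (Winv s l)) (mx_1 Zstar)) mx_one" by (rule *[OF Winv_Zstar])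
qed simp

section \<open>The comultiplication on words\<close>

lemma comult_lin: "comult s l = lin (\<lambda>w. prod_list (map (\<lambda>g. case g of
       LP i j \<Rightarrow> \<Sum>k\<in>idx s l. tens (Lplus i k) (Lplus k j)
     | LM i j \<Rightarrow> \<Sum>k\<in>idx s l. tens (Lminus i k) (Lminus k j)) (letters w)))"
  by (simp add: comult_def free_hom_const)

lemma comult_single_Nil: "comult s l (Poly_Mapping.single (Word []) 1) = 1"
  by (simp add: comult_lin lin_single)

lemma comult_single_Cons:
  "comult s l (Poly_Mapping.single (Word (Lgen b i j # w)) 1)
    = (\<Sum>k\<in>idx s l. tens (Lmat b i k) (Lmat b k j)) * comult s l (Poly_Mapping.single (Word w) 1)"
  by (simp add: comult_lin lin_single Lgen_def Lmat_def)

lemma comult_Lgen: "comult s l (gen (Lgen b i j)) = (\<Sum>k\<in>idx s l. tens (Lmat b i k) (Lmat b k j))"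
  using comult_single_Cons[of s l b i j "[]"] by (simp add: gen_def comult_single_Nil)

lemma tens_Lmat:
  "tens (Lmat b i k) (Lmat b k j) = (if tri b i k \<and> tri b k j
     then Poly_Mapping.single (Word [Lgen b i k], Word [Lgen b k j]) 1 else 0)"
  by (simp add: Lmat_eq gen_def tens_single)

lemma comult_words:
  "comult s l a = (\<Sum>w\<in>Poly_Mapping.keys a. const (Poly_Mapping.lookup a w) * comult s l (Poly_Mapping.single w 1))"
  by (simp add: comult_lin lin_single lin_def[of _ a])

definition words_on :: "'g set \<Rightarrow> ('g word \<times> 'g word) set" where
  "words_on G = {(u, v). set (letters u) \<subseteq> G \<and> set (letters v) \<subseteq> G}"

lemma keys_mult_words_on:
  assumes "Poly_Mapping.keys x \<subseteq> words_on G" "Poly_Mapping.keys y \<subseteq> words_on G"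
  shows "Poly_Mapping.keys (x * y :: 'g falg2) \<subseteq> words_on G"
proof
  fix k assume "k \<in> Poly_Mapping.keys (x * y)"
  then obtain a b where "k = a + b" "a \<in> Poly_Mapping.keys x" "b \<in> Poly_Mapping.keys y"
    using keys_mult[of x y] by blast
  with assms show "k \<in> words_on G" by (cases a; cases b) (auto simp: words_on_def)
qed

lemma keys_sum_subset:
  "(\<And>x. x \<in> X \<Longrightarrow> Poly_Mapping.keys (f x) \<subseteq> W) \<Longrightarrow> Poly_Mapping.keys (sum f X) \<subseteq> W"
proof (induction X rule: infinite_finite_induct)
  case (insert x X)
  then show ?case using keys_add[of "f x" "sum f X"] by auto
qed simp_all

lemma keys_comult_word:
  assumes "set w \<subseteq> U_gens s l"
  shows "Poly_Mapping.keys (comult s l (Poly_Mapping.single (Word w) 1)) \<subseteq> words_on (U_gens s l)"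
  using assms
proof (induction w)
  case Nil
  show ?case by (simp add: comult_single_Nil words_on_def zero_prod_def)
next
  case (Cons g w)
  have "g \<in> U_gens s l" using Cons.prems by simp
  then obtain b i j where g: "i \<in> idx s l" "j \<in> idx s l" "tri b i j" "g = Lgen b i j"
    by (rule U_gens_cases)
  have "Poly_Mapping.keys (\<Sum>k\<in>idx s l. tens (Lmat b i k) (Lmat b k j)) \<subseteq> words_on (U_gens s l)"
    by (intro keys_sum_subset) (auto simp: tens_Lmat words_on_def Lgen_in g)
  then show ?case
    unfolding g(4) comult_single_Cons using Cons by (intro keys_mult_words_on) auto
qed

text \<open>
  The Sweedler sum takes classes of single words, which are meaningful only for words in
  the generators.
\<close>

lemma keys_comult:
  assumes "a \<in> carrier (free_algebra (U_gens s l))"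
  shows "Poly_Mapping.keys (comult s l a) \<subseteq> words_on (U_gens s l)"
proof -
  have 1: "Poly_Mapping.keys (const c * x) \<subseteq> Poly_Mapping.keys x" for c and x :: "ugen falg2"
  proof -
    have "Poly_Mapping.lookup (const c * x) k = c * Poly_Mapping.lookup x k" for k
      by (induction x rule: poly_mapping_induct)
         (simp_all add: distrib_left const_times_single lookup_add lookup_single when_def)
    then show ?thesis by (auto simp: in_keys_iff)
  qed
  have 2: "Poly_Mapping.keys (comult s l (Poly_Mapping.single w 1)) \<subseteq> words_on (U_gens s l)"
    if "w \<in> Poly_Mapping.keys a" for w
    using keys_comult_word[of "letters w" s l] that assms by (auto simp: free_algebra_def)
  show ?thesis unfolding comult_words[of s l a] by (rule keys_sum_subset) (rule order_trans[OF 1 2])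
qed

lemma counit_Lmat: "counit (Lmat b i j) = (if i = j then 1 else 0)"
  by (simp add: Lmat_def Lplus_def Lminus_def counit_def free_hom_def gen_def)

lemma left_action_linear: "is_left_action U V act \<Longrightarrow> f \<in> carrier V \<Longrightarrow> is_linear U V (\<lambda>x. act x f)"
  and left_action_one: "is_left_action U V act \<Longrightarrow> f \<in> carrier V \<Longrightarrow> act \<one>\<^bsub>U\<^esub> f = f"
  and left_action_mult: "is_left_action U V act \<Longrightarrow> x \<in> carrier U \<Longrightarrow> y \<in> carrier U \<Longrightarrow> f \<in> carrier V \<Longrightarrow>
    act (x \<otimes>\<^bsub>U\<^esub> y) f = act x (act y f)"
  by (simp_all add: is_left_action_def)

section \<open>The action lifted to free algebras\<close>

text \<open>
  Inside this locale \<open>up\<close> and \<open>cp\<close> are the projections of the free algebras onto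
  $\mathcal U$ and $\mathcal C$.
\<close>

locale cell_action =
  fixes s :: series and l :: nat and q :: real
    and Dm :: "(nat, complex) mx"
    and \<xi> :: "ugen falg set \<Rightarrow> (nat \<times> nat) falg set \<Rightarrow> (nat \<times> nat) falg set"
  assumes simple: "simple_type s l"
    and q: "q > 0" "q \<noteq> 1"
    and xi: "is_xi s l q \<xi>"
    and D_diag: "\<And>i j. i \<in> idx s l \<Longrightarrow> j \<in> idx s l \<Longrightarrow> i \<noteq> j \<Longrightarrow> Dm i j = 0"
    and D_det: "det (mat (vdim s l) (vdim s l) (\<lambda>(i, j). Dm (i + 1) (j + 1))) = 1"
    and D_K: "mx_eq (idx2 s l) (mx_prod (idx2 s l) [K_mx s l q, mx_1 Dm, mx_2 Dm]) (K_mx s l q)"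
begin

abbreviation "UA \<equiv> U_alg s l q"
abbreviation "CA \<equiv> C_alg s l q"
abbreviation "I \<equiv> idx s l"
abbreviation "J \<equiv> idx s l \<times> idx s l"

sublocale U: presentation "U_gens s l" "U_rels s l q" by (rule presentation_U)
sublocale C: presentation "C_gens s l" "C_rels s l q" by (rule presentation_C)

abbreviation "up \<equiv> pres (U_gens s l) (U_rels s l q)"
abbreviation "cp \<equiv> pres (C_gens s l) (C_rels s l q)"

lemmas UA = U.pres_mult[folded U_alg_def] U.pres_add[folded U_alg_def] U.pres_one[folded U_alg_def]
  U.pres_smult[folded U_alg_def] U.pres_in[folded U_alg_def]
lemmas CA = C.pres_mult[folded C_alg_def] C.pres_add[folded C_alg_def] C.pres_one[folded C_alg_def]
  C.pres_smult[folded C_alg_def] C.pres_in[folded C_alg_def]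

lemma U_cls: "a \<in> carrier (U_free s l) \<Longrightarrow> U_cls s l q a = up a"
  unfolding U_cls_def U_free_def by (rule U.pres_cls)

lemma C_cls: "retr (C_gens s l) a = a \<Longrightarrow> C_cls s l q a = cp a"
  unfolding C_cls_def by (rule C.pres_cls) (simp add: in_free_algebra_iff)

lemma UA_cases:
  assumes "X \<in> carrier UA" obtains a where "a \<in> carrier (U_free s l)" "X = up a"
  using U.A_cases[folded U_alg_def, OF assms] unfolding U_free_def in_free_algebra_iff by blast

lemma CA_cases:
  assumes "X \<in> carrier CA" obtains a where "X = cp a"
  using C.A_cases[folded C_alg_def, OF assms] by blast

lemma action: "is_left_action UA CA \<xi>"
  and xi_one: "\<And>a. a \<in> carrier (U_free s l) \<Longrightarrow> \<xi> (U_cls s l q a) \<one>\<^bsub>CA\<^esub> = counit a \<odot>\<^bsub>CA\<^esub> \<one>\<^bsub>CA\<^esub>"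
  and xi_mult: "\<And>a f g. a \<in> carrier (U_free s l) \<Longrightarrow> f \<in> carrier CA \<Longrightarrow> g \<in> carrier CA \<Longrightarrow>
        \<xi> (U_cls s l q a) (f \<otimes>\<^bsub>CA\<^esub> g)
          = sweedler s l q CA (\<lambda>x1 x2. \<xi> x1 f \<otimes>\<^bsub>CA\<^esub> \<xi> x2 g) a"
  and xi_gen: "\<And>j k u v. j \<in> I \<Longrightarrow> k \<in> I \<Longrightarrow> u \<in> I \<Longrightarrow> v \<in> I \<Longrightarrow>
        \<xi> (U_cls s l q (Lplus j u)) (C_cls s l q (Zstar k v))
          = C_cls s l q (mx_prod J [const_mx (R21inv_mx s l q), mx_2 Zstar, const_mx (Q_mx s l q)] (j, k) (u, v)) \<and>
        \<xi> (U_cls s l q (Lminus j u)) (C_cls s l q (Zstar k v))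
          = C_cls s l q (mx_prod J [mx_1 Zstar, const_mx (Q_mx s l q), mx_2 Zstar, const_mx (Qinv_mx s l q),
              mx_inv J (mx_1 Zstar)] (j, k) (u, v))"
  using xi unfolding is_xi_def Let_def idx2_def by fast+

lemma action_linear: "is_linear CA CA (\<xi> (up a))" "is_linear UA CA (\<lambda>x. \<xi> x (cp f))"
  using action unfolding is_left_action_def by (simp_all add: UA CA)

definition lift :: "(nat \<times> nat) falg set \<Rightarrow> (nat \<times> nat) falg" where
  "lift X = (SOME g. cp g = X)"

lemma cp_lift: "X \<in> carrier CA \<Longrightarrow> cp (lift X) = X"
  unfolding lift_def by (rule someI_ex) (metis CA_cases)

text \<open>
  The action $\xi$ on representatives. It depends on the choice in \<open>lift\<close> only up to the
  congruence.
\<close>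

definition Xi :: "ugen falg \<Rightarrow> (nat \<times> nat) falg \<Rightarrow> (nat \<times> nat) falg" where
  "Xi a f = lift (\<xi> (up a) (cp f))"

lemma cp_Xi: "cp (Xi a f) = \<xi> (up a) (cp f)"
proof -
  have "\<xi> (up a) (cp f) \<in> carrier CA"
    using action_linear(1)[of a] CA(5)[of f] unfolding is_linear_def by blast
  then show ?thesis unfolding Xi_def by (rule cp_lift)
qed

sublocale X: operators C.eqv Xi
proof (intro operators.intro operators_axioms.intro C.ring_cong_eqv)
  note lin1 = action_linear(1)[unfolded is_linear_def] and lin2 = action_linear(2)[unfolded is_linear_def]
  fix a b f g c
  show "C.eqv (Xi a f) (Xi a g)" if "C.eqv f g"
    using that by (simp add: C.eqv_def cp_Xi)
  have "\<xi> (up a \<oplus>\<^bsub>UA\<^esub> up b) (cp f) = \<xi> (up a) (cp f) \<oplus>\<^bsub>CA\<^esub> \<xi> (up b) (cp f)"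
    using lin2[of f] UA(5)[of a] UA(5)[of b] by blast
  then show "C.eqv (Xi (a + b) f) (Xi a f + Xi b f)"
    unfolding C.eqv_def cp_Xi CA(2)[symmetric] by (simp only: UA(2))
  have "\<xi> (c \<odot>\<^bsub>UA\<^esub> up a) (cp f) = c \<odot>\<^bsub>CA\<^esub> \<xi> (up a) (cp f)"
    using lin2[of f] UA(5)[of a] by blast
  then show "C.eqv (Xi (const c * a) f) (const c * Xi a f)"
    unfolding C.eqv_def CA(4)[symmetric] cp_Xi by (simp only: UA(4))
  have "\<xi> (up a) (cp f \<oplus>\<^bsub>CA\<^esub> cp g) = \<xi> (up a) (cp f) \<oplus>\<^bsub>CA\<^esub> \<xi> (up a) (cp g)"
    using lin1[of a] CA(5)[of f] CA(5)[of g] by blast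
  then show "C.eqv (Xi a (f + g)) (Xi a f + Xi a g)"
    unfolding C.eqv_def CA(2)[symmetric] cp_Xi by (simp only: CA(2))
  have "\<xi> (up a) (c \<odot>\<^bsub>CA\<^esub> cp f) = c \<odot>\<^bsub>CA\<^esub> \<xi> (up a) (cp f)"
    using lin1[of a] CA(5)[of f] by blast
  then show "C.eqv (Xi a (const c * f)) (const c * Xi a f)"
    unfolding C.eqv_def CA(4)[symmetric] cp_Xi by (simp only: CA(4))
  have "\<xi> (up a \<otimes>\<^bsub>UA\<^esub> up b) (cp f) = \<xi> (up a) (\<xi> (up b) (cp f))"
    using action UA(5)[of a] UA(5)[of b] CA(5)[of f] unfolding is_left_action_def by blast
  then show "C.eqv (Xi (a * b) f) (Xi a (Xi b f))"
    unfolding C.eqv_def cp_Xi by (simp only: UA(1))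
  have "\<xi> \<one>\<^bsub>UA\<^esub> (cp f) = cp f"
    using action CA(5)[of f] unfolding is_left_action_def by blast
  then show "C.eqv (Xi 1 f) f"
    unfolding C.eqv_def cp_Xi by (simp only: UA(3))
qed

notation C.eqv (infix "\<approx>" 50)

lemma Xi_up: "up a = up b \<Longrightarrow> Xi a f \<approx> Xi b f"
  by (simp add: C.eqv_def cp_Xi)

lemma sweedler_cp:
  assumes a: "a \<in> carrier (U_free s l)" and \<beta>: "\<And>x y. \<beta> (up x) (up y) = cp (h x y)"
  shows "sweedler s l q CA \<beta> a
    = cp (lin (\<lambda>p. h (Poly_Mapping.single (fst p) 1) (Poly_Mapping.single (snd p) 1)) (comult s l a))"
proof -
  have cls: "U_cls s l q (Poly_Mapping.single w 1) = up (Poly_Mapping.single w 1)"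
    if "set (letters w) \<subseteq> U_gens s l" for w
    using that by (intro U_cls) (simp add: U_free_def in_free_algebra_iff retr_single)
  have "Poly_Mapping.keys (comult s l a) \<subseteq> words_on (U_gens s l)"
    using a unfolding U_free_def by (rule keys_comult)
  then have summand: "Poly_Mapping.lookup (comult s l a) p \<odot>\<^bsub>CA\<^esub>
       \<beta> (U_cls s l q (Poly_Mapping.single (fst p) 1)) (U_cls s l q (Poly_Mapping.single (snd p) 1))
      = cp (const (Poly_Mapping.lookup (comult s l a) p)
          * h (Poly_Mapping.single (fst p) 1) (Poly_Mapping.single (snd p) 1))"
    if "p \<in> Poly_Mapping.keys (comult s l a)" for p
  proof -
    have "p \<in> words_on (U_gens s l)"
      using that \<open>Poly_Mapping.keys (comult s l a) \<subseteq> words_on (U_gens s l)\<close> by blast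
    then have "set (letters (fst p)) \<subseteq> U_gens s l" "set (letters (snd p)) \<subseteq> U_gens s l"
      by (auto simp: words_on_def mem_Times_iff)
    then show ?thesis by (simp only: cls \<beta> CA(4))
  qed
  have "sweedler s l q CA \<beta> a = finsum CA (\<lambda>p. cp (const (Poly_Mapping.lookup (comult s l a) p)
          * h (Poly_Mapping.single (fst p) 1) (Poly_Mapping.single (snd p) 1)))
        (Poly_Mapping.keys (comult s l a))"
    unfolding sweedler_def
    by (rule abelian_monoid.finsum_cong'[OF C.abelian_monoid_A[folded C_alg_def] HOL.refl _ summand])
       (simp_all only: CA(5) Pi_I)
  also have "\<dots> = cp (lin (\<lambda>p. h (Poly_Mapping.single (fst p) 1) (Poly_Mapping.single (snd p) 1)) (comult s l a))"
    unfolding lin_def by (rule C.finsum_pres[folded C_alg_def]) simp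
  finally show ?thesis .
qed

lemma Lmat_in: "i \<in> I \<Longrightarrow> j \<in> I \<Longrightarrow> Lmat b i j \<in> carrier (U_free s l)"
  using fixed_Lmat[of s l b] by (simp add: U_free_def in_free_algebra_iff fixed_on_def)

text \<open>
  The comultiplication on the generator $L_{ij}$ is a sum of tensor products of entries; the
  cases distinguish whether the entries are generators or zero by triangularity.
\<close>

lemma Xi_product:
  assumes ij: "i \<in> I" "j \<in> I"
  shows "Xi (Lmat b i j) (f * g) \<approx> (\<Sum>k\<in>I. Xi (Lmat b i k) f * Xi (Lmat b k j) g)"
proof (cases "tri b i j")
  case True
  define h where "h = (\<lambda>p. Xi (Poly_Mapping.single (fst p) 1) f * Xi (Poly_Mapping.single (snd p) 1) g)"
  have "cp (Xi (Lmat b i j) (f * g)) = \<xi> (U_cls s l q (Lmat b i j)) (cp f \<otimes>\<^bsub>CA\<^esub> cp g)"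
    using Lmat_in[OF ij] by (simp only: cp_Xi U_cls CA(1))
  also have "\<dots> = sweedler s l q CA (\<lambda>x1 x2. \<xi> x1 (cp f) \<otimes>\<^bsub>CA\<^esub> \<xi> x2 (cp g)) (Lmat b i j)"
    by (intro xi_mult Lmat_in ij CA(5))
  also have "\<dots> = cp (lin h (comult s l (Lmat b i j)))"
    unfolding h_def by (rule sweedler_cp[OF Lmat_in[OF ij]]) (simp only: cp_Xi CA(1)[symmetric])
  also have "comult s l (Lmat b i j) = (\<Sum>k\<in>I. tens (Lmat b i k) (Lmat b k j))"
    using True by (simp add: Lmat_eq[of b i j] comult_Lgen)
  finally have "Xi (Lmat b i j) (f * g) \<approx> (\<Sum>k\<in>I. lin h (tens (Lmat b i k) (Lmat b k j)))"
    by (simp only: C.eqv_def lin_sum)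
  also have "\<dots> \<approx> (\<Sum>k\<in>I. Xi (Lmat b i k) f * Xi (Lmat b k j) g)"
  proof (rule X.sum)
    fix k
    show "lin h (tens (Lmat b i k) (Lmat b k j)) \<approx> Xi (Lmat b i k) f * Xi (Lmat b k j) g"
    proof (cases "tri b i k \<and> tri b k j")
      case True
      then show ?thesis unfolding tens_Lmat by (simp add: lin_single h_def Lmat_eq gen_def)
    next
      case False
      then have "Lmat b i k = 0 \<or> Lmat b k j = 0" by (auto simp: Lmat_eq)
      then have "Xi (Lmat b i k) f * Xi (Lmat b k j) g \<approx> 0"
        using X.mult[OF X.act_zero_left X.refl[of "Xi (Lmat b k j) g"], of f]
          X.mult[OF X.refl[of "Xi (Lmat b i k) f"] X.act_zero_left, of g] by auto
      with False show ?thesis unfolding tens_Lmat by (auto intro: X.sym)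
    qed
  qed
  finally show ?thesis .
next
  case False
  have "(\<Sum>k\<in>I. Xi (Lmat b i k) f * Xi (Lmat b k j) g) \<approx> (\<Sum>k\<in>I. 0)"
  proof (rule X.sum)
    fix k
    have "Lmat b i k = 0 \<or> Lmat b k j = 0" using False tri_trans by (auto simp: Lmat_eq)
    then show "Xi (Lmat b i k) f * Xi (Lmat b k j) g \<approx> 0"
      using X.mult[OF X.act_zero_left X.refl[of "Xi (Lmat b k j) g"], of f]
        X.mult[OF X.refl[of "Xi (Lmat b i k) f"] X.act_zero_left, of g] by auto
  qed
  moreover have "Xi (Lmat b i j) (f * g) \<approx> 0"
    using False X.act_zero_left by (simp add: Lmat_eq)
  ultimately show ?thesis by (simp only: sum.neutral_const) (meson X.sym X.trans)
qed

lemma Xi_unit: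
  assumes "i \<in> I" "j \<in> I"
  shows "Xi (Lmat b i j) 1 \<approx> (if i = j then 1 else 0)"
proof -
  have "cp (Xi (Lmat b i j) 1) = counit (Lmat b i j) \<odot>\<^bsub>CA\<^esub> cp 1"
    unfolding cp_Xi CA(3)[symmetric]
    using xi_one[OF Lmat_in[OF assms]] by (simp only: U_cls[OF Lmat_in[OF assms]])
  also have "\<dots> = cp (const (if i = j then 1 else 0) * 1)"
    by (simp only: counit_Lmat CA(4))
  finally show ?thesis by (cases "i = j") (simp_all add: C.eqv_def)
qed

section \<open>The diagonal matrix and the R-matrix\<close>

definition d :: "nat \<Rightarrow> complex" where "d i = Dm i i"

lemma D_dgm: "mx_eq I Dm (dgm d)"
  using D_diag by (auto simp: mx_eq_def dgm_def d_def)

lemma d_prod: "prod_list (map d [1..<vdim s l + 1]) = 1"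
proof -
  let ?A = "mat (vdim s l) (vdim s l) (\<lambda>(i, j). Dm (i + 1) (j + 1))"
  have "Dm (i + 1) (j + 1) = 0" if "i < vdim s l" "j < i" for i j
    using that by (intro D_diag) (auto simp: idx_def)
  then have "upper_triangular ?A" by (auto intro!: upper_triangularI)
  then have "det ?A = prod_list (diag_mat ?A)"
    by (rule det_upper_triangular[of _ "vdim s l"]) simp
  also have "diag_mat ?A = map d (map Suc [0..<vdim s l])"
    by (simp add: diag_mat_def d_def)
  also have "map Suc [0..<vdim s l] = [1..<vdim s l + 1]" by (simp add: map_Suc_upt)
  finally show ?thesis using D_det by simp
qed

lemma d_nonzero:
  assumes "i \<in> I"
  shows "d i \<noteq> 0"
proof
  assume "d i = 0"
  moreover have "i \<in> set [1..<vdim s l + 1]" using assms by (auto simp: idx_def)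
  then have "d i \<in> set (map d [1..<vdim s l + 1])" by (simp only: set_map imageI)
  ultimately have "prod_list (map d [1..<vdim s l + 1]) = 0" by (simp only: prod_list_zero_iff)
  then show False by (simp only: d_prod one_neq_zero)
qed

lemma E_dgm: "mx_eq I (mx_inv I Dm) (dgm (\<lambda>i. 1 / d i))"
  by (rule mx_inv_dgm[OF finite_idx(1) D_dgm d_nonzero])

lemma K_d:
  assumes "r \<in> J" "u \<in> I" "v \<in> I"
  shows "K_mx s l q r (u, v) * (d u * d v) = K_mx s l q r (u, v)"
proof -
  have Dd: "mx_mult J A (mx_1 Dm) r' c = A r' c * d (fst c)" "mx_mult J A (mx_2 Dm) r' c = A r' c * d (snd c)"
    if "c \<in> J" for A r' c
  proof -
    have "mx_eq J (mx_1 Dm) (dgm (\<lambda>r. d (fst r)))" "mx_eq J (mx_2 Dm) (dgm (\<lambda>r. d (snd r)))"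
      unfolding req_mxc[symmetric] by (rule req.mxc_mx_1_diag; use D_dgm in \<open>simp add: mx_eq_def\<close>)+
    from this[THEN mx_mult_cong_right[OF that], of A r']
    show "mx_mult J A (mx_1 Dm) r' c = A r' c * d (fst c)" "mx_mult J A (mx_2 Dm) r' c = A r' c * d (snd c)"
      by (simp_all only: mx_mult_dgm[OF _ that] finite_cartesian_product finite_idx)
  qed
  have "mx_prod J [K_mx s l q, mx_1 Dm, mx_2 Dm] r (u, v)
      = mx_mult J (mx_mult J (K_mx s l q) (mx_1 Dm)) (mx_2 Dm) r (u, v)"
    using assms by (simp add: mx_mult_one_right flip: mx_mult_assoc)
  also have "\<dots> = K_mx s l q r (u, v) * (d u * d v)"
    using assms by (simp add: Dd)
  finally show ?thesis using D_K assms by (simp only: mx_eq_def idx2_def mem_Sigma_iff)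
qed

text \<open>
  For $i<N$ the column $(i,i')$ of $K$ has a nonzero entry, and $KD_1D_2=K$ can be divided
  by it. The case $i=N$ is the case $i=1$ read backwards, since $N'=1$ and $1<N$.
\<close>

lemma d_pair:
  assumes s: "s \<noteq> TypeA" and i: "i \<in> I"
  shows "d i * d (prm s l i) = 1"
proof -
  have N: "2 \<le> vdim s l" using simple by (cases s) auto
  have *: "d j * d (prm s l j) = 1" if j: "1 \<le> j" "j < vdim s l" for j
  proof -
    have "K_mx s l q (vdim s l, 1) (j, prm s l j) * (d j * d (prm s l j)) = K_mx s l q (vdim s l, 1) (j, prm s l j)"
      using j N by (intro K_d prm_in) (auto simp: idx_def)
    then show ?thesis using K_row_nonzero[OF q s j] by simp
  qed
  show ?thesis
  proof (cases "i < vdim s l")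
    case True
    then show ?thesis using * i by (simp add: idx_def)
  next
    case False
    with i have "i = vdim s l" "prm s l i = 1" "prm s l 1 = vdim s l" by (auto simp: idx_def prm_def)
    then show ?thesis using *[of 1] N by (simp add: mult.commute)
  qed
qed

definition dd :: "nat \<times> nat \<Rightarrow> complex" where "dd r = d (fst r) * d (snd r)"

lemma dd_nonzero: "r \<in> J \<Longrightarrow> dd r \<noteq> 0"
  by (auto simp: dd_def d_nonzero)

text \<open>
  The entries of $R$ couple only pairs with the same value of $D_1D_2$, so $R$ commutes with $D_1D_2$.
\<close>

lemma R_d:
  assumes "r \<in> J" "c \<in> J"
  shows "R_mx s l q r c = 0 \<or> dd r = dd c"
proof (rule disjCI)
  obtain a b where r: "r = (a, b)" by (cases r)
  obtain u v where c: "c = (u, v)" by (cases c)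
  assume n: "dd r \<noteq> dd c"
  show "R_mx s l q r c = 0"
  proof (rule ccontr)
    assume "R_mx s l q r c \<noteq> 0"
    then consider "a = u \<and> b = v" | "a = v \<and> b = u" | "s \<noteq> TypeA" "b = prm s l a" "v = prm s l u"
      using R_support[of a b s l u v q] assms by (auto simp: r c idx2_def)
    then have "dd r = dd c"
    proof cases
      case 3
      then show ?thesis using d_pair[OF 3(1), of a] d_pair[OF 3(1), of u] assms by (simp add: r c dd_def)
    qed (simp_all add: r c dd_def mult.commute)
    with n show False by simp
  qed
qed

section \<open>Intertwining relations in the big cell\<close>

abbreviation "Rm \<equiv> const_mx (R_mx s l q) :: (nat \<times> nat, (nat \<times> nat) falg) mx"
abbreviation "Ri \<equiv> const_mx (R21inv_mx s l q) :: (nat \<times> nat, (nat \<times> nat) falg) mx"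
abbreviation "Qm \<equiv> const_mx (Q_mx s l q) :: (nat \<times> nat, (nat \<times> nat) falg) mx"
abbreviation "Qi \<equiv> const_mx (Qinv_mx s l q) :: (nat \<times> nat, (nat \<times> nat) falg) mx"
abbreviation "Km \<equiv> const_mx (K_mx s l q) :: (nat \<times> nat, (nat \<times> nat) falg) mx"
abbreviation "cD \<equiv> const_mx Dm :: (nat, (nat \<times> nat) falg) mx"
abbreviation "cE \<equiv> const_mx (mx_inv I Dm) :: (nat, (nat \<times> nat) falg) mx"
abbreviation "Z1 \<equiv> mx_1 Zstar"
abbreviation "Z2 \<equiv> mx_2 Zstar"
abbreviation "W1 \<equiv> mx_1 (Winv s l)"
abbreviation "W2 \<equiv> mx_2 (Winv s l)"
abbreviation "D1 \<equiv> mx_1 cD"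
abbreviation "D2 \<equiv> mx_2 cD"
abbreviation "E1 \<equiv> mx_1 cE"
abbreviation "E2 \<equiv> mx_2 cE"

lemma finJ: "finite J" by simp

lemma cD_entry: "i \<in> I \<Longrightarrow> j \<in> I \<Longrightarrow> cD i j = dgm (\<lambda>i. const (d i)) i j"
  using D_dgm by (simp add: mx_eq_def const_mx_def dgm_def)

lemma cE_entry: "i \<in> I \<Longrightarrow> j \<in> I \<Longrightarrow> cE i j = dgm (\<lambda>i. const (1 / d i)) i j"
  using E_dgm by (simp add: mx_eq_def const_mx_def dgm_def)

lemma diag_D: "X.mxc J D1 (const_mx (dgm (\<lambda>r. d (fst r))))" "X.mxc J D2 (const_mx (dgm (\<lambda>r. d (snd r))))"
  unfolding const_mx_dgm by (rule X.mxc_mx_1_diag, rule cD_entry, assumption+)+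

lemma diag_E: "X.mxc J E1 (const_mx (dgm (\<lambda>r. 1 / d (fst r))))" "X.mxc J E2 (const_mx (dgm (\<lambda>r. 1 / d (snd r))))"
  unfolding const_mx_dgm by (rule X.mxc_mx_1_diag, rule cE_entry, assumption+)+

lemma Q_dgm: "Q_mx s l q = dgm (\<lambda>r. R_mx s l q r r)"
  by (intro ext) (simp add: Q_mx_def mx_diag_def dgm_def)

lemma R_nonzero: "r \<in> J \<Longrightarrow> R_mx s l q r r \<noteq> 0"
  using R_diag_nonzero[OF q(1)] by (simp add: idx2_def)

lemma diag_Q: "X.mxc J Qm (const_mx (dgm (\<lambda>r. R_mx s l q r r)))"
  by (simp add: Q_dgm)

lemma diag_Qi: "X.mxc J Qi (const_mx (dgm (\<lambda>r. 1 / R_mx s l q r r)))"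
proof -
  have "mx_eq J (Qinv_mx s l q) (dgm (\<lambda>r. 1 / R_mx s l q r r))"
    unfolding Qinv_mx_def idx2_def Q_dgm
    by (rule mx_inv_dgm[OF finJ _ R_nonzero]) (simp add: mx_eq_def)
  then show ?thesis by (simp add: X.mxc_def mx_eq_def const_mx_def)
qed

lemma swap_Q: "X.mxc J (mx_swap Qm) Qm" "X.mxc J (mx_swap Qi) Qi"
proof -
  have sw: "R_mx s l q (prod.swap r) (prod.swap r) = R_mx s l q r r" if "r \<in> J" for r
    using R_diag_swap that by (simp add: idx2_def)
  have "X.mxc J (mx_swap A) A" if A: "X.mxc J A (const_mx (dgm g))"
    and g: "\<And>r. r \<in> J \<Longrightarrow> g (prod.swap r) = g r" for A g
  proof -
    have "X.mxc J (mx_swap A) (mx_swap (const_mx (dgm g)))" by (rule X.mxc_swap[OF A])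
    also have "X.mxc J \<dots> (const_mx (dgm g))"
      unfolding mx_swap_const_mx mx_swap_dgm X.mxc_def
      by (intro ballI) (simp add: const_mx_def dgm_def g)
    also have "X.mxc J \<dots> A" by (rule X.mxc_sym[OF A])
    finally show ?thesis .
  qed
  then show "X.mxc J (mx_swap Qm) Qm" "X.mxc J (mx_swap Qi) Qi"
    using diag_Q diag_Qi sw by simp_all
qed

lemmas diag_rules = C.ring_cong_eqv finJ

lemma QQi: "X.pc J [Qm, Qi] []" "X.pc J [Qi, Qm] []"
  by (rule pc_diag_inverse[OF diag_rules diag_Q diag_Qi]; simp add: R_nonzero)
     (rule pc_diag_inverse[OF diag_rules diag_Qi diag_Q]; simp add: R_nonzero)

lemma ZW_pc: "X.pc J [Z1, W1] []" "X.pc J [W1, Z1] []" "X.pc J [Z2, W2] []" "X.pc J [W2, Z2] []"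
proof -
  have "X.pc I [Zstar, Winv s l] []" "X.pc I [Winv s l, Zstar] []"
    using Zstar_Winv[of s l] Winv_Zstar[of s l]
    by (simp_all add: X.pc_def X.mxc_def mx_eq_def mx_mult_one_right flip: mx_mult_assoc)
  note * = this[THEN X.pc_mx_1[OF finite_idx(1)]]
  show "X.pc J [Z1, W1] []" "X.pc J [W1, Z1] []" using * by simp_all
  show "X.pc J [Z2, W2] []" "X.pc J [W2, Z2] []" using *[THEN X.pc_swap] by simp_all
qed

lemma scalar_legs:
  "X.pc J [mx_2 A, mx_1 (const_mx B)] [mx_1 (const_mx B), mx_2 A]"
  "X.pc J [mx_1 A, mx_2 (const_mx B)] [mx_2 (const_mx B), mx_1 A]"
proof -
  show "X.pc J [mx_2 A, mx_1 (const_mx B)] [mx_1 (const_mx B), mx_2 A]"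
    by (rule X.pc_mx_1_mx_2) (simp_all add: const_mx_def const_commute)
  show "X.pc J [mx_1 A, mx_2 (const_mx B)] [mx_2 (const_mx B), mx_1 A]"
    by (rule X.pc_sym[OF X.pc_mx_1_mx_2]) (simp_all add: const_mx_def const_commute)
qed

text \<open>
  With $W=(Z^*)^{-1}$, the second word below is the inverse of $Y_{12}$.
\<close>

definition Y12 :: "(nat \<times> nat, (nat \<times> nat) falg) mx" where
  "Y12 = mx_prod J [Z1, Qm, Z2, Qi]"

definition V12 :: "(nat \<times> nat, (nat \<times> nat) falg) mx" where
  "V12 = mx_prod J [Qm, W2, Qi, W1]"

lemma cancel: "X.pc J [a, b] [] \<Longrightarrow> X.pc J (us @ [a, b] @ vs) (us @ vs)"
  using X.pc_ctx[OF finJ, of "[a, b]" "[]" us vs] by simp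

lemma YV: "X.pc J [Y12, V12] []" "X.pc J [V12, Y12] []"
proof -
  have Y: "X.pc J [Y12] [Z1, Qm, Z2, Qi]" and V: "X.pc J [V12] [Qm, W2, Qi, W1]"
    unfolding Y12_def V12_def by (rule X.pc_single[OF finJ])+
  have "X.pc J [Y12, V12] [Z1, Qm, Z2, Qi, Qm, W2, Qi, W1]"
    using X.pc_append[OF finJ Y V] by simp
  also have "X.pc J \<dots> [Z1, Qm, Z2, W2, Qi, W1]"
    using cancel[OF QQi(2), of "[Z1, Qm, Z2]" "[W2, Qi, W1]"] by simp
  also have "X.pc J \<dots> [Z1, Qm, Qi, W1]"
    using cancel[OF ZW_pc(3), of "[Z1, Qm]" "[Qi, W1]"] by simp
  also have "X.pc J \<dots> [Z1, W1]"
    using cancel[OF QQi(1), of "[Z1]" "[W1]"] by simp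
  also have "X.pc J \<dots> []" by (rule ZW_pc)
  finally show "X.pc J [Y12, V12] []" .
  have "X.pc J [V12, Y12] [Qm, W2, Qi, W1, Z1, Qm, Z2, Qi]"
    using X.pc_append[OF finJ V Y] by simp
  also have "X.pc J \<dots> [Qm, W2, Qi, Qm, Z2, Qi]"
    using cancel[OF ZW_pc(2), of "[Qm, W2, Qi]" "[Qm, Z2, Qi]"] by simp
  also have "X.pc J \<dots> [Qm, W2, Z2, Qi]"
    using cancel[OF QQi(2), of "[Qm, W2]" "[Z2, Qi]"] by simp
  also have "X.pc J \<dots> [Qm, Qi]"
    using cancel[OF ZW_pc(4), of "[Qm]" "[Qi]"] by simp
  also have "X.pc J \<dots> []" by (rule QQi)
  finally show "X.pc J [V12, Y12] []" .
qed

abbreviation "Y21 \<equiv> mx_swap Y12"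
abbreviation "V21 \<equiv> mx_swap V12"

lemma YV21: "X.pc J [Y21, V21] []" "X.pc J [V21, Y21] []"
  using YV[THEN X.pc_swap] by simp_all

lemma Y21_word: "X.pc J [Y21] [Z2, Qm, Z1, Qi]"
proof -
  have "X.pc J [Y21] (map mx_swap [Z1, Qm, Z2, Qi])"
    unfolding Y12_def mx_swap_prod by (rule X.pc_single[OF finJ])
  also have "X.pc J \<dots> [Z2, Qm, Z1, Qi]"
    using swap_Q by (intro X.mxc_prod) simp
  finally show ?thesis .
qed

text \<open>
  The defining relation of $\mathcal C$, as $Q_{21}=Q$.
\<close>

lemma R_intertwines: "X.pc J [Rm, Y21] [Y12, Rm]"
proof -
  have "X.mxc J (mx_prod J [Rm, Z2, Qm, Z1, Qi]) (mx_prod J [Z1, Qm, Z2, Qi, Rm])"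
    unfolding X.mxc_def
  proof (intro ballI)
    fix r c assume rc: "r \<in> J" "c \<in> J"
    have "mx_prod J [Rm, Z2, Qm, Z1, Qi] r c - mx_prod J [Z1, Qm, Z2, Qi, Rm] r c \<in> C_rels s l q"
      unfolding C_rels_def Let_def idx2_def by (rule mx_relI[OF rc])
    from C.pres_rel[OF this]
    have "mx_prod J [Rm, Z2, Qm, Z1, Qi] r c - mx_prod J [Z1, Qm, Z2, Qi, Rm] r c \<approx> 0"
      by (simp only: C.eqv_def)
    then show "mx_prod J [Rm, Z2, Qm, Z1, Qi] r c \<approx> mx_prod J [Z1, Qm, Z2, Qi, Rm] r c"
      by (rule X.diff_zero[THEN iffD1])
  qed
  then have rel: "X.pc J [Rm, Z2, Qm, Z1, Qi] [Z1, Qm, Z2, Qi, Rm]" by (simp only: X.pc_def)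
  have Y: "X.pc J [Y12] [Z1, Qm, Z2, Qi]" unfolding Y12_def by (rule X.pc_single[OF finJ])
  have "X.pc J [Rm, Y21] [Rm, Z2, Qm, Z1, Qi]"
    using X.pc_ctx[OF finJ Y21_word, of "[Rm]" "[]"] by simp
  also note rel
  also have "X.pc J [Z1, Qm, Z2, Qi, Rm] [Y12, Rm]"
    using X.pc_ctx[OF finJ X.pc_sym[OF Y], of "[]" "[Rm]"] by simp
  finally show ?thesis .
qed

lemma RRi: "X.pc J [mx_swap Rm, Ri] []" "X.pc J [Ri, mx_swap Rm] []"
  using R21_inv(1,2)[OF q(1), of s l]
    pc_const[OF C.ring_cong_eqv, of J "[mx_swap (R_mx s l q), R21inv_mx s l q]" "[]"]
    pc_const[OF C.ring_cong_eqv, of J "[R21inv_mx s l q, mx_swap (R_mx s l q)]" "[]"]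
  by (simp_all add: mx_swap_const_mx mx_eq_def idx2_def mx_mult_one_right flip: mx_mult_assoc)

lemma Ri_intertwines: "X.pc J [Ri, Y21] [Y12, Ri]"
proof -
  let ?S = "mx_swap Rm"
  have S: "X.pc J [?S, Y12] [Y21, ?S]" using X.pc_swap[OF R_intertwines] by simp
  note ctx = X.pc_ctx[OF finJ]
  have "X.pc J [Ri, Y21] [Ri, Y21, ?S, Ri]"
    using ctx[OF X.pc_sym[OF RRi(1)], of "[Ri, Y21]" "[]"] by simp
  also have "X.pc J \<dots> [Ri, ?S, Y12, Ri]" using ctx[OF X.pc_sym[OF S], of "[Ri]" "[Ri]"] by simp
  also have "X.pc J \<dots> [Y12, Ri]" using ctx[OF RRi(2), of "[]" "[Y12, Ri]"] by simp
  finally show ?thesis .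
qed

text \<open>
  $K$ is a combination of the flip, $R$ and $R_{21}^{-1}$. The flip exchanges $Y_{21}$ and
  $Y_{12}$ identically, and the other two intertwine them by the relation of $\mathcal C$.
\<close>

lemma K_intertwines: "X.pc J [Km, Y21] [Y12, Km]"
  unfolding X.pc_two_iff[OF finJ] X.mxc_def
proof clarify
  fix a b u v assume ab: "a \<in> I" "b \<in> I" "u \<in> I" "v \<in> I"
  let ?r = "(a, b)" and ?c = "(u, v)"
  \<comment> \<open>The scalar in $K=P-c_0(R-R_{21}^{-1})$.\<close>
  define c0 where "c0 = (const (1 / complex_of_real (q - 1 / q)) :: (nat \<times> nat) falg)"
  have c0: "x * (c0 * y) = c0 * (x * y)" for x y
  proof -
    have "x * c0 = c0 * x" unfolding c0_def by (rule const_commute[symmetric])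
    then show ?thesis by (simp only: mult.assoc[symmetric])
  qed
  have K: "Km r c = mx_flip r c - c0 * (Rm r c - Ri r c)" for r c
  proof -
    have "const (mx_flip r c) = mx_flip r c" for r c :: "nat \<times> nat"
      by (simp add: mx_flip_def case_prod_beta)
    then show ?thesis
      by (simp add: const_mx_def K_mx_def c0_def const_diff const_mult[symmetric] right_diff_distrib
          diff_divide_distrib)
  qed
  have l: "mx_mult J Km Y21 ?r ?c = mx_mult J mx_flip Y21 ?r ?c - c0 * (mx_mult J Rm Y21 ?r ?c - mx_mult J Ri Y21 ?r ?c)"
    by (simp add: mx_mult_def K left_diff_distrib right_diff_distrib sum_subtractf sum_distrib_left mult.assoc)
  have r: "mx_mult J Y12 Km ?r ?c = mx_mult J Y12 mx_flip ?r ?c - c0 * (mx_mult J Y12 Rm ?r ?c - mx_mult J Y12 Ri ?r ?c)"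
    by (simp add: mx_mult_def K c0 left_diff_distrib right_diff_distrib sum_subtractf sum_distrib_left)
  have f: "mx_mult J mx_flip Y21 ?r ?c = mx_mult J Y12 mx_flip ?r ?c"
    using ab by (simp add: mx_flip_mult mx_mult_flip mx_swap_def)
  have R: "mx_mult J Rm Y21 ?r ?c \<approx> mx_mult J Y12 Rm ?r ?c" "mx_mult J Ri Y21 ?r ?c \<approx> mx_mult J Y12 Ri ?r ?c"
    using R_intertwines Ri_intertwines ab unfolding X.pc_two_iff[OF finJ] X.mxc_def by blast+
  show "mx_mult J Km Y21 ?r ?c \<approx> mx_mult J Y12 Km ?r ?c"
    unfolding l r f by (intro X.diff X.scale X.refl R)
qed

text \<open>
  This and the next matrix are $(D_1D_2)^2$ and $(D_1D_2)^{-1}$.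
\<close>

definition TT :: "(nat \<times> nat, (nat \<times> nat) falg) mx" where
  "TT = const_mx (dgm (\<lambda>r. dd r * dd r))"

definition EE :: "(nat \<times> nat, (nat \<times> nat) falg) mx" where
  "EE = const_mx (dgm (\<lambda>r. 1 / dd r))"

lemma DD_TT: "X.pc J [D2, D2, D1, D1] [TT]"
proof -
  have "X.pc J [D2, D2] [const_mx (dgm (\<lambda>r. d (snd r) * d (snd r)))]"
    "X.pc J [D1, D1] [const_mx (dgm (\<lambda>r. d (fst r) * d (fst r)))]"
    by (rule pc_diag_mult[OF diag_rules]; rule diag_D)+
  from X.pc_append[OF finJ this] have "X.pc J [D2, D2, D1, D1]
     [const_mx (dgm (\<lambda>r. d (snd r) * d (snd r))), const_mx (dgm (\<lambda>r. d (fst r) * d (fst r)))]" by simp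
  also have "X.pc J \<dots> [TT]"
  proof -
    have dd: "(\<lambda>r. (d (snd r) * d (snd r)) * (d (fst r) * d (fst r))) = (\<lambda>r. dd r * dd r)"
      by (simp add: dd_def mult_ac)
    show ?thesis
      using pc_diag_mult[OF diag_rules X.mxc_refl X.mxc_refl,
          of "\<lambda>r. d (snd r) * d (snd r)" "\<lambda>r. d (fst r) * d (fst r)"]
      unfolding TT_def dd .
  qed
  finally show ?thesis .
qed

lemma E_EE: "X.pc J [E2, E1] [EE]" "X.pc J [E1, E2] [EE]"
  using pc_diag_mult[OF diag_rules diag_E(2) diag_E(1)] pc_diag_mult[OF diag_rules diag_E]
  by (simp_all add: EE_def dd_def mult.commute)

lemma scalar_commute:
  assumes "\<And>r c. r \<in> J \<Longrightarrow> c \<in> J \<Longrightarrow> A r c * g c = g r * A r c"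
  shows "X.pc J [const_mx A, const_mx (dgm g)] [const_mx (dgm g), const_mx A]"
  using pc_const[OF C.ring_cong_eqv, of J "[A, dgm g]" "[dgm g, A]"] assms
  by (simp add: mx_eq_def mx_mult_one_right mx_mult_dgm dgm_mx_mult flip: mx_mult_assoc)

lemma R_TT: "X.pc J [Rm, TT] [TT, Rm]" and R_EE: "X.pc J [Rm, EE] [EE, Rm]"
  unfolding TT_def EE_def by (rule scalar_commute; use R_d in fastforce)+

lemma scalar_absorb:
  assumes "\<And>r c. r \<in> J \<Longrightarrow> c \<in> J \<Longrightarrow> A r c * g c = A r c"
  shows "X.pc J [const_mx A, const_mx (dgm g)] [const_mx A]"
  using pc_const[OF C.ring_cong_eqv, of J "[A, dgm g]" "[A]"] assms
  by (simp add: mx_eq_def mx_mult_one_right mx_mult_dgm flip: mx_mult_assoc)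

lemma K_dd: "r \<in> J \<Longrightarrow> c \<in> J \<Longrightarrow> K_mx s l q r c * dd c = K_mx s l q r c"
  using K_d[of r "fst c" "snd c"] by (simp add: dd_def mem_Times_iff)

lemma K_TT: "X.pc J [Km, TT] [Km]" and K_EE: "X.pc J [Km, EE] [Km]"
proof -
  show "X.pc J [Km, TT] [Km]"
    unfolding TT_def by (rule scalar_absorb) (simp only: mult.assoc[symmetric] K_dd)
  show "X.pc J [Km, EE] [Km]"
    unfolding EE_def
  proof (rule scalar_absorb)
    fix r c assume rc: "r \<in> J" "c \<in> J"
    then show "K_mx s l q r c * (1 / dd c) = K_mx s l q r c"
      using K_dd[OF rc] dd_nonzero[OF rc(2)] by (simp add: field_simps)
  qed
qed

section \<open>The operators of the twisted action\<close>

definition Phi :: "bool \<Rightarrow> (nat, (nat \<times> nat) falg) mx" where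
  "Phi b = (if b then cE else mx_prod I [Zstar, cD, cD, Winv s l, cE])"

definition Phi_diag :: "bool \<Rightarrow> nat \<Rightarrow> complex" where
  "Phi_diag b i = (if b then 1 / d i else d i)"

text \<open>
  $\Phi^-$ is a product of lower triangular matrices, of which $Z^*$ and its inverse have unit
  diagonal; its diagonal is therefore $D^2D^{-1}=D$.
\<close>

lemma Phi_entries:
  assumes ij: "i \<in> I" "j \<in> I"
  shows "\<not> tri b i j \<Longrightarrow> Phi b i j = 0" and "Phi b i i = const (Phi_diag b i)"
proof -
  have E: "mx_mult I A cE i' j' = A i' j' * const (1 / d j')" if "j' \<in> I" for A i' j'
  proof -
    have "mx_mult I A cE i' j' = mx_mult I A (dgm (\<lambda>i. const (1 / d i))) i' j'"
      by (rule mx_mult_cong_right[OF that]) (simp add: mx_eq_def cE_entry)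
    then show ?thesis using that by (simp add: mx_mult_dgm)
  qed
  have D: "mx_mult I A cD i' j' = A i' j' * const (d j')" if "j' \<in> I" for A i' j'
  proof -
    have "mx_mult I A cD i' j' = mx_mult I A (dgm (\<lambda>i. const (d i))) i' j'"
      by (rule mx_mult_cong_right[OF that]) (simp add: mx_eq_def cD_entry)
    then show ?thesis using that by (simp add: mx_mult_dgm)
  qed
  have Phi_False: "Phi False i' j' = (\<Sum>k\<in>I. Zstar i' k * const (d k) * const (d k) * Winv s l k j') * const (1 / d j')"
    if "j' \<in> I" for i' j'
  proof -
    have "Phi False i' j' = mx_mult I (mx_mult I (mx_mult I (mx_mult I Zstar cD) cD) (Winv s l)) cE i' j'"
      using that by (simp add: Phi_def mx_mult_one_right flip: mx_mult_assoc)
    also have "\<dots> = mx_mult I (mx_mult I (mx_mult I Zstar cD) cD) (Winv s l) i' j' * const (1 / d j')"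
      by (rule E[OF that])
    also have "mx_mult I (mx_mult I (mx_mult I Zstar cD) cD) (Winv s l) i' j'
        = (\<Sum>k\<in>I. Zstar i' k * const (d k) * const (d k) * Winv s l k j')"
      unfolding mx_mult_def[of I "mx_mult I (mx_mult I Zstar cD) cD"] by (simp only: D cong: sum.cong)
    finally show ?thesis .
  qed
  show "Phi b i j = 0" if n: "\<not> tri b i j"
  proof (cases b)
    case True
    then show ?thesis using n ij cE_entry[of i j] by (auto simp: Phi_def tri_def dgm_def)
  next
    case False
    have "Zstar i k * const (d k) * const (d k) * Winv s l k j = 0" if "k \<in> I" for k
    proof (cases "j \<le> k")
      case True
      then have "Zstar i k = 0" using n False by (simp add: tri_def Zstar_def)
      then show ?thesis by simp
    next
      case False
      then show ?thesis using Winv_tri[of k s l j] that ij by simp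
    qed
    then show ?thesis using False Phi_False[OF ij(2), of i] by simp
  qed
  show "Phi b i i = const (Phi_diag b i)"
  proof (cases b)
    case True
    then show ?thesis using ij cE_entry[of i i] by (simp add: Phi_def Phi_diag_def dgm_def)
  next
    case False
    have "Zstar i k * const (d k) * const (d k) * Winv s l k i = (if k = i then const (d i * d i) else 0)"
      if "k \<in> I" for k
    proof -
      consider "k = i" | "k < i" | "i < k" by linarith
      then show ?thesis
      proof cases
        case 1
        then show ?thesis using Winv_diag[OF ij(1)] by (simp add: Zstar_def const_mult)
      next
        case 2
        then show ?thesis using Winv_tri[of k s l i] that ij by simp
      next
        case 3
        then show ?thesis by (simp add: Zstar_def)
      qed
    qed
    then have "Phi False i i = const (d i * d i) * const (1 / d i)"
      using Phi_False[OF ij(1), of i] ij by simp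
    also have "\<dots> = const (d i)"
      using d_nonzero[OF ij(1)] by (simp flip: const_mult)
    finally show ?thesis using False by (simp add: Phi_diag_def)
  qed
qed

text \<open>
  The action of the generators forced by the values of $\varphi$ on them.
\<close>

definition tg :: "ugen \<Rightarrow> (nat \<times> nat) falg \<Rightarrow> (nat \<times> nat) falg" where
  "tg g f = (case g of
       LP i j \<Rightarrow> \<Sum>k\<in>I. Xi (Lplus i k) f * Phi True k j
     | LM i j \<Rightarrow> \<Sum>k\<in>I. Xi (Lminus i k) f * Phi False k j)"

lemma tg_Lgen: "tg (Lgen b i j) f = (\<Sum>k\<in>I. Xi (Lmat b i k) f * Phi b k j)"
  by (simp add: tg_def Lgen_def Lmat_def)

sublocale G: generator_operators C.eqv tg
proof (intro generator_operators.intro generator_operators_axioms.intro C.ring_cong_eqv)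
  fix f h :: "(nat \<times> nat) falg" and g :: ugen and c
  obtain b i j where g: "g = Lgen b i j"
  proof (cases g)
    case (LP i j)
    then show ?thesis using that[of True i j] by (simp add: Lgen_def)
  next
    case (LM i j)
    then show ?thesis using that[of False i j] by (simp add: Lgen_def)
  qed
  show "tg g f \<approx> tg g h" if "f \<approx> h"
    unfolding g tg_Lgen by (intro X.sum X.mult X.refl X.act_cong that)
  have "tg g (f + h) \<approx> (\<Sum>k\<in>I. (Xi (Lmat b i k) f + Xi (Lmat b i k) h) * Phi b k j)"
    unfolding g tg_Lgen by (intro X.sum X.mult X.refl X.act_add)
  then show "tg g (f + h) \<approx> tg g f + tg g h"
    by (simp add: g tg_Lgen distrib_right sum.distrib)
  have "tg g (const c * f) \<approx> (\<Sum>k\<in>I. (const c * Xi (Lmat b i k) f) * Phi b k j)"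
    unfolding g tg_Lgen by (intro X.sum X.mult X.refl X.act_const)
  then show "tg g (const c * f) \<approx> const c * tg g f"
    by (simp add: g tg_Lgen sum_distrib_left mult.assoc)
qed

abbreviation "T \<equiv> G.ext"

sublocale T: operators C.eqv T by (rule G.operators_ext)

sublocale W: twisted_operators C.eqv Xi T I Lmat Phi
proof unfold_locales
  show "finite I" by simp
  fix b i j f g assume ij: "i \<in> I" "j \<in> I"
  show "Xi (Lmat b i j) (f * g) \<approx> (\<Sum>k\<in>I. Xi (Lmat b i k) f * Xi (Lmat b k j) g)"
    by (rule Xi_product[OF ij])
  show "Xi (Lmat b i j) 1 \<approx> (if i = j then 1 else 0)" by (rule Xi_unit[OF ij])
  show "T (Lmat b i j) f \<approx> (\<Sum>k\<in>I. Xi (Lmat b i k) f * Phi b k j)"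
  proof (cases "tri b i j")
    case True
    then show ?thesis by (simp add: Lmat_eq[of b i j] G.ext_gen tg_Lgen)
  next
    case False
    have "(\<Sum>k\<in>I. Xi (Lmat b i k) f * Phi b k j) \<approx> (\<Sum>k\<in>I. 0)"
    proof (rule X.sum)
      fix k assume k: "k \<in> I"
      show "Xi (Lmat b i k) f * Phi b k j \<approx> 0"
      proof (cases "tri b i k")
        case True
        then have "\<not> tri b k j" using False tri_trans by blast
        then show ?thesis by (simp add: Phi_entries(1)[OF k ij(2)])
      next
        case False
        then show ?thesis
          using X.mult[OF X.act_zero_left[of f] X.refl[of "Phi b k j"]] by (simp add: Lmat_eq)
      qed
    qed
    moreover have "T (Lmat b i j) f \<approx> 0" using False T.act_zero_left by (simp add: Lmat_eq)
    ultimately show ?thesis by (simp only: sum.neutral_const) (meson X.sym X.trans)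
  qed
qed

section \<open>Evaluation of the cocycles\<close>

lemma Xi_entry:
  assumes b: "a \<in> carrier (U_free s l)" and z: "k \<in> I" "v \<in> I"
    and e: "\<xi> (U_cls s l q a) (C_cls s l q (Zstar k v)) = C_cls s l q w" and w: "retr (C_gens s l) w = w"
  shows "Xi a (Zstar k v) \<approx> w"
proof -
  have "retr (C_gens s l) (Zstar k v) = Zstar k v"
    using fixed_Zstar[of s l] z by (simp add: fixed_on_def)
  then show ?thesis
    using e by (simp only: C.eqv_def cp_Xi U_cls[OF b] C_cls w)
qed

lemma ximx_plus_Z: "X.pc J [W.ximx True Zstar] [Ri, Z2, Qm]"
proof -
  have "X.mxc J (W.ximx True Zstar) (mx_prod J [Ri, Z2, Qm])"
    unfolding X.mxc_def
  proof clarify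
    fix j k u v assume jk: "j \<in> I" "k \<in> I" "u \<in> I" "v \<in> I"
    have "fixed_on (C_gens s l) J (mx_prod J [Ri, Z2, Qm])"
      by (intro fixed_prod) (auto intro: fixed_const fixed_2 fixed_Zstar)
    then have "retr (C_gens s l) (mx_prod J [Ri, Z2, Qm] (j, k) (u, v)) = mx_prod J [Ri, Z2, Qm] (j, k) (u, v)"
      using jk by (simp only: fixed_on_def mem_Sigma_iff)
    moreover have "Lplus j u \<in> carrier (U_free s l)"
      using Lmat_in[of j u True] jk by (simp add: Lmat_def)
    ultimately have "Xi (Lplus j u) (Zstar k v) \<approx> mx_prod J [Ri, Z2, Qm] (j, k) (u, v)"
      using xi_gen[OF jk] jk by (intro Xi_entry) blast+
    then show "W.ximx True Zstar (j, k) (u, v) \<approx> mx_prod J [Ri, Z2, Qm] (j, k) (u, v)"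
      by (simp only: W.ximx_def Lmat_def if_True prod.case)
  qed
  then have "X.pc J [W.ximx True Zstar] [mx_prod J [Ri, Z2, Qm]]"
    unfolding X.pc_single_iff[OF finJ] .
  also have "X.pc J [mx_prod J [Ri, Z2, Qm]] [Ri, Z2, Qm]" by (rule X.pc_single[OF finJ])
  finally show ?thesis .
qed

lemma ximx_minus_Z: "X.pc J [W.ximx False Zstar] [Z1, Qm, Z2, Qi, W1]"
proof -
  let ?w = "[Z1, Qm, Z2, Qi, mx_inv J Z1]"
  have inv: "X.mxc J (mx_inv J Z1) W1" by (rule X.mx_eq_mxc[OF mx_inv_Z1])
  have "X.mxc J (W.ximx False Zstar) (mx_prod J ?w)"
    unfolding X.mxc_def
  proof clarify
    fix j k u v assume jk: "j \<in> I" "k \<in> I" "u \<in> I" "v \<in> I"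
    have "fixed_on (C_gens s l) J (mx_inv J Z1)"
      unfolding fixed_on_def
    proof (intro ballI)
      fix r c assume rc: "r \<in> J" "c \<in> J"
      then have eq: "mx_inv J Z1 r c = W1 r c"
        using mx_inv_Z1[of s l] unfolding mx_eq_def by blast
      show "retr (C_gens s l) (mx_inv J Z1 r c) = mx_inv J Z1 r c"
        unfolding eq using fixed_1[OF fixed_Winv[of s l]] rc unfolding fixed_on_def by blast
    qed
    then have "fixed_on (C_gens s l) J (mx_prod J ?w)"
      by (intro fixed_prod) (auto intro: fixed_const fixed_1 fixed_2 fixed_Zstar)
    then have "retr (C_gens s l) (mx_prod J ?w (j, k) (u, v)) = mx_prod J ?w (j, k) (u, v)"
      using jk by (simp only: fixed_on_def mem_Sigma_iff)
    moreover have "Lminus j u \<in> carrier (U_free s l)"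
      using Lmat_in[of j u False] jk by (simp add: Lmat_def)
    ultimately have "Xi (Lminus j u) (Zstar k v) \<approx> mx_prod J ?w (j, k) (u, v)"
      using xi_gen[OF jk] jk by (intro Xi_entry) blast+
    then show "W.ximx False Zstar (j, k) (u, v) \<approx> mx_prod J ?w (j, k) (u, v)"
      by (simp only: W.ximx_def Lmat_def if_False prod.case)
  qed
  then have "X.pc J [W.ximx False Zstar] [mx_prod J ?w]"
    unfolding X.pc_single_iff[OF finJ] .
  also have "X.pc J [mx_prod J ?w] ?w" by (rule X.pc_single[OF finJ])
  also have "X.pc J ?w [Z1, Qm, Z2, Qi, W1]"
    by (rule X.mxc_prod) (simp only: list_all2_Cons list_all2_Nil inv X.mxc_refl simp_thms)
  finally show ?thesis .
qed

lemma ximx_plus_W: "X.pc J [W.ximx True (Winv s l)] [Qi, W2, mx_swap Rm]"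
proof (rule W.ximx_inverse[OF Zstar_Winv ximx_plus_Z])
  have "X.pc J [Qi, W2, mx_swap Rm, Ri, Z2, Qm] [Qi, W2, Z2, Qm]"
    using cancel[OF RRi(1), of "[Qi, W2]" "[Z2, Qm]"] by simp
  also have "X.pc J \<dots> [Qi, Qm]" using cancel[OF ZW_pc(4), of "[Qi]" "[Qm]"] by simp
  also have "X.pc J \<dots> []" by (rule QQi)
  finally show "X.pc J ([Qi, W2, mx_swap Rm] @ [Ri, Z2, Qm]) []" by simp
qed

lemma ximx_minus_W: "X.pc J [W.ximx False (Winv s l)] [Z1, Qm, W2, Qi, W1]"
proof (rule W.ximx_inverse[OF Zstar_Winv ximx_minus_Z])
  have "X.pc J [Z1, Qm, W2, Qi, W1, Z1, Qm, Z2, Qi, W1] [Z1, Qm, W2, Qi, Qm, Z2, Qi, W1]"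
    using cancel[OF ZW_pc(2), of "[Z1, Qm, W2, Qi]" "[Qm, Z2, Qi, W1]"] by simp
  also have "X.pc J \<dots> [Z1, Qm, W2, Z2, Qi, W1]"
    using cancel[OF QQi(2), of "[Z1, Qm, W2]" "[Z2, Qi, W1]"] by simp
  also have "X.pc J \<dots> [Z1, Qm, Qi, W1]"
    using cancel[OF ZW_pc(4), of "[Z1, Qm]" "[Qi, W1]"] by simp
  also have "X.pc J \<dots> [Z1, W1]" using cancel[OF QQi(1), of "[Z1]" "[W1]"] by simp
  also have "X.pc J \<dots> []" by (rule ZW_pc)
  finally show "X.pc J ([Z1, Qm, W2, Qi, W1] @ [Z1, Qm, Z2, Qi, W1]) []" by simp
qed

lemma ximx_D: "X.pc J [W.ximx b cD] [D2]" and ximx_E: "X.pc J [W.ximx b cE] [E2]"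
  unfolding X.pc_single_iff[OF finJ] by (rule W.ximx_const)+

lemma mx_1_Phi: "X.pc J [mx_1 (Phi True)] [E1]" "X.pc J [mx_1 (Phi False)] [Z1, D1, D1, W1, E1]"
proof -
  show "X.pc J [mx_1 (Phi True)] [E1]" by (simp add: Phi_def)
  have "X.pc J [mx_1 (mx_prod I [Zstar, cD, cD, Winv s l, cE])] [mx_prod J (map mx_1 [Zstar, cD, cD, Winv s l, cE])]"
    unfolding X.pc_single_iff[OF finJ] by (rule X.mx_1_prod[OF finite_idx(1)])
  also have "X.pc J \<dots> (map mx_1 [Zstar, cD, cD, Winv s l, cE])" by (rule X.pc_single[OF finJ])
  finally show "X.pc J [mx_1 (Phi False)] [Z1, D1, D1, W1, E1]"
    by (simp only: Phi_def if_False list.map)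
qed

lemma ximx_Phi_False:
  "X.pc J [W.ximx b (Phi False)] ([W.ximx b Zstar] @ [D2] @ [D2] @ [W.ximx b (Winv s l)] @ [E2])"
proof -
  have "X.pc J [W.ximx b (mx_prod I [Zstar, cD, cD, Winv s l, cE])]
      [mx_prod J (map (W.ximx b) [Zstar, cD, cD, Winv s l, cE])]"
    unfolding X.pc_single_iff[OF finJ] by (rule W.ximx_prod)
  also have "X.pc J \<dots> (map (W.ximx b) [Zstar, cD, cD, Winv s l, cE])" by (rule X.pc_single[OF finJ])
  also have "X.pc J \<dots> ([W.ximx b Zstar] @ [D2] @ [D2] @ [W.ximx b (Winv s l)] @ [E2])"
    using X.pc_append[OF finJ X.pc_append[OF finJ X.pc_refl[of J "[W.ximx b Zstar]"]
        X.pc_append[OF finJ ximx_D[of b] ximx_D[of b]]]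
        X.pc_append[OF finJ X.pc_refl[of J "[W.ximx b (Winv s l)]"] ximx_E[of b]]] by simp
  finally show ?thesis by (simp only: Phi_def if_False)
qed

lemma cocycle_word: "X.pc J [W.cocycle b b'] ([W.ximx b (Phi b')] @ [mx_1 (Phi b)])"
  unfolding W.cocycle_def X.pc_def by (simp add: mx_mult_assoc)

lemma cocycle_plus_plus: "X.pc J [W.cocycle True True] [EE]"
proof -
  note cocycle_word[of True True]
  also have "X.pc J ([W.ximx True (Phi True)] @ [mx_1 (Phi True)]) [E2, E1]"
    using X.pc_append[OF finJ ximx_E[of True] mx_1_Phi(1)] by (simp add: Phi_def)
  also note E_EE(1)
  finally show ?thesis .
qed

text \<open>
  Written out, the cocycle is
  $(Z^*_1QZ^*_2Q^{-1}W_1)\,D_2^2\,(Z^*_1QW_2Q^{-1}W_1)\,D_2^{-1}\cdot Z^*_1D_1^2W_1D_1^{-1}$ with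
  $W=(Z^*)^{-1}$.
\<close>

lemma cocycle_minus_minus: "X.pc J [W.cocycle False False] [Y12, TT, V12, EE]"
proof -
  note ap = X.pc_append[OF finJ]
  have Y: "X.pc J [Y12] [Z1, Qm, Z2, Qi]" and V: "X.pc J [V12] [Qm, W2, Qi, W1]"
    unfolding Y12_def V12_def by (rule X.pc_single[OF finJ])+
  note cocycle_word[of False False]
  also have "X.pc J ([W.ximx False (Phi False)] @ [mx_1 (Phi False)])
      (([W.ximx False Zstar] @ [D2] @ [D2] @ [W.ximx False (Winv s l)] @ [E2]) @ [Z1, D1, D1, W1, E1])"
    by (rule ap[OF ximx_Phi_False mx_1_Phi(2)])
  also have "X.pc J \<dots> (([Z1, Qm, Z2, Qi, W1] @ [D2] @ [D2] @ [Z1, Qm, W2, Qi, W1] @ [E2]) @ [Z1, D1, D1, W1, E1])"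
    by (intro ap X.pc_refl ximx_minus_Z ximx_minus_W)
  also have "(([Z1, Qm, Z2, Qi, W1] @ [D2] @ [D2] @ [Z1, Qm, W2, Qi, W1] @ [E2]) @ [Z1, D1, D1, W1, E1])
      = [Z1, Qm, Z2, Qi, W1, D2, D2, Z1, Qm, W2, Qi, W1, E2, Z1, D1, D1, W1, E1]" by simp
  also have "X.pc J \<dots> [Z1, Qm, Z2, Qi, D2, D2, D1, D1, Qm, W2, Qi, W1, E2, E1]"
    by (rule X.word_conjugate_form[OF finJ ZW_pc(2) scalar_legs(2) scalar_legs(2) scalar_legs(1)
          pc_diag_commute[OF diag_rules diag_E(2) diag_D(1)]
          pc_diag_commute[OF diag_rules diag_Q diag_D(1)]
          pc_diag_commute[OF diag_rules diag_Qi diag_D(1)]])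
  also have "\<dots> = [Z1, Qm, Z2, Qi] @ [D2, D2, D1, D1] @ [Qm, W2, Qi, W1] @ [E2, E1]" by simp
  also have "X.pc J \<dots> ([Y12] @ [TT] @ [V12] @ [EE])"
    by (intro ap X.pc_sym[OF Y] DD_TT X.pc_sym[OF V] E_EE)
  finally show ?thesis by simp
qed

lemma cocycle_minus_plus: "X.pc J [W.cocycle False True] [E2, Z1, D1, D1, W1, E1]"
proof -
  note cocycle_word[of False True]
  also have "X.pc J ([W.ximx False (Phi True)] @ [mx_1 (Phi False)]) ([E2] @ [Z1, D1, D1, W1, E1])"
    using X.pc_append[OF finJ ximx_E[of False] mx_1_Phi(2)] by (simp add: Phi_def)
  finally show ?thesis by simp
qed

lemma cocycle_plus_minus:
  "X.pc J [W.cocycle True False] [Ri, Z2, Qm, D2, D2, Qi, W2, mx_swap Rm, E2, E1]"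
proof -
  note ap = X.pc_append[OF finJ]
  note cocycle_word[of True False]
  also have "X.pc J ([W.ximx True (Phi False)] @ [mx_1 (Phi True)])
      (([W.ximx True Zstar] @ [D2] @ [D2] @ [W.ximx True (Winv s l)] @ [E2]) @ [E1])"
    by (rule ap[OF ximx_Phi_False mx_1_Phi(1)])
  also have "X.pc J \<dots> (([Ri, Z2, Qm] @ [D2] @ [D2] @ [Qi, W2, mx_swap Rm] @ [E2]) @ [E1])"
    by (intro ap X.pc_refl ximx_plus_Z ximx_plus_W)
  finally show ?thesis by simp
qed

lemma swapped: "X.pc J [A] As \<Longrightarrow> X.pc J [mx_swap A] (map mx_swap As)"
  using X.pc_swap[of I "[A]" As] by simp

lemma swap_scalar:
  assumes "\<And>r. g (prod.swap r) = g r"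
  shows "mx_swap (const_mx (dgm g)) = const_mx (dgm g)"
  by (simp add: mx_swap_const_mx mx_swap_dgm assms)

lemma swap_TT [simp]: "mx_swap TT = TT" and swap_EE [simp]: "mx_swap EE = EE"
  unfolding TT_def EE_def by (rule swap_scalar; simp add: dd_def mult_ac)+

lemma exchange_plus_plus: "X.pc J [Rm, mx_swap (W.cocycle True True)] [W.cocycle True True, Rm]"
proof -
  have "X.pc J [Rm, mx_swap (W.cocycle True True)] [Rm, EE]"
    using X.pc_ctx[OF finJ swapped[OF cocycle_plus_plus], of "[Rm]" "[]"] by simp
  also note R_EE
  also have "X.pc J [EE, Rm] [W.cocycle True True, Rm]"
    using X.pc_ctx[OF finJ X.pc_sym[OF cocycle_plus_plus], of "[]" "[Rm]"] by simp
  finally show ?thesis .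
qed

lemma exchange_minus_minus: "X.pc J [Rm, mx_swap (W.cocycle False False)] [W.cocycle False False, Rm]"
proof -
  have "X.pc J [Rm, mx_swap (W.cocycle False False)] [Rm, Y21, TT, V21, EE]"
    using X.pc_ctx[OF finJ swapped[OF cocycle_minus_minus], of "[Rm]" "[]"] by simp
  also have "X.pc J \<dots> [Y12, TT, V12, EE, Rm]"
    by (rule X.word_intertwines_conjugate[OF finJ R_intertwines YV21(1) YV(2) R_TT R_EE])
  also have "X.pc J \<dots> [W.cocycle False False, Rm]"
    using X.pc_ctx[OF finJ X.pc_sym[OF cocycle_minus_minus], of "[]" "[Rm]"] by simp
  finally show ?thesis .
qed

text \<open>
  The leading $R_{21}^{-1}$ of the swapped cocycle becomes $R^{-1}$ and cancels against $R$,
  while its trailing $R_{21}$ becomes the factor $R$ that is needed on the right.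
\<close>

lemma exchange_plus_minus: "X.pc J [Rm, mx_swap (W.cocycle True False)] [W.cocycle False True, Rm]"
proof -
  have Q: "X.mxc J (mx_swap Qm) Qm" "X.mxc J (mx_swap Qi) Qi" by (rule swap_Q)+
  have RR: "X.pc J [Rm, mx_swap Ri] []" using X.pc_swap[OF RRi(1)] by simp
  have RE: "X.pc J [Rm, E1, E2] [E1, E2, Rm]"
  proof -
    have "X.pc J [Rm, E1, E2] [Rm, EE]" using X.pc_ctx[OF finJ E_EE(2), of "[Rm]" "[]"] by simp
    also note R_EE
    also have "X.pc J [EE, Rm] [E1, E2, Rm]" using X.pc_ctx[OF finJ X.pc_sym[OF E_EE(2)], of "[]" "[Rm]"] by simp
    finally show ?thesis .
  qed
  have "X.pc J [Rm, mx_swap (W.cocycle True False)]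
      ([Rm] @ map mx_swap [Ri, Z2, Qm, D2, D2, Qi, W2, mx_swap Rm, E2, E1])"
    using X.pc_ctx[OF finJ swapped[OF cocycle_plus_minus], of "[Rm]" "[]"] by simp
  also have "X.pc J \<dots> [Rm, mx_swap Ri, Z1, Qm, D1, D1, Qi, W1, Rm, E1, E2]"
    by (rule X.mxc_prod)
       (simp only: append.simps list.map mx_swap_swap mx_swap_1 mx_swap_2 list_all2_Cons list_all2_Nil Q X.mxc_refl simp_thms)
  also have "X.pc J \<dots> [E2, Z1, D1, D1, W1, E1, Rm]"
    by (rule X.word_mixed[OF finJ RR pc_diag_commute[OF diag_rules diag_Q diag_D(1)] QQi(1)
          scalar_legs(2) scalar_legs(2) pc_diag_commute[OF diag_rules diag_D(1) diag_E(2)]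
          pc_diag_commute[OF diag_rules diag_E] RE])
  also have "X.pc J \<dots> [W.cocycle False True, Rm]"
    using X.pc_ctx[OF finJ X.pc_sym[OF cocycle_minus_plus], of "[]" "[Rm]"] by simp
  finally show ?thesis .
qed

lemma absorb_plus: "X.pc J [Km, mx_swap (W.cocycle True True)] [Km]"
proof -
  have "X.pc J [Km, mx_swap (W.cocycle True True)] [Km, EE]"
    using X.pc_ctx[OF finJ swapped[OF cocycle_plus_plus], of "[Km]" "[]"] by simp
  also note K_EE
  finally show ?thesis .
qed

lemma absorb_minus: "X.pc J [Km, mx_swap (W.cocycle False False)] [Km]"
proof -
  have "X.pc J [Km, mx_swap (W.cocycle False False)] [Km, Y21, TT, V21, EE]"
    using X.pc_ctx[OF finJ swapped[OF cocycle_minus_minus], of "[Km]" "[]"] by simp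
  also have "X.pc J \<dots> [Km]"
    by (rule X.word_absorbs_conjugate[OF finJ K_intertwines YV21(1) YV(2) YV(1) K_TT K_EE])
  finally show ?thesis .
qed

section \<open>The relations of the bialgebra for the twisted operators\<close>

lemma Xi_rel: "r \<in> U_rels s l q \<Longrightarrow> Xi r f \<approx> 0"
  by (rule X.trans[OF Xi_up[OF U.pres_rel] X.act_zero_left])

definition vanishing :: "ugen falg set" where
  "vanishing = {a. \<forall>f. T a f \<approx> 0}"

lemma vanishing_exchange:
  assumes rel: "mx_rel J (mx_prod J [const_mx (R_mx s l q), mx_2 (Lmat b'), mx_1 (Lmat b)])
      (mx_prod J [mx_1 (Lmat b), mx_2 (Lmat b'), const_mx (R_mx s l q)]) \<subseteq> U_rels s l q"
    and R: "X.pc J [Rm, mx_swap (W.cocycle b' b)] [W.cocycle b b', Rm]"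
  shows "mx_rel J (mx_prod J [const_mx (R_mx s l q), mx_2 (Lmat b'), mx_1 (Lmat b)])
      (mx_prod J [mx_1 (Lmat b), mx_2 (Lmat b'), const_mx (R_mx s l q)]) \<subseteq> vanishing"
proof (rule mx_rel_subset)
  fix r c assume rc: "r \<in> J" "c \<in> J"
  show "mx_prod J [const_mx (R_mx s l q), mx_2 (Lmat b'), mx_1 (Lmat b)] r c
      - mx_prod J [mx_1 (Lmat b), mx_2 (Lmat b'), const_mx (R_mx s l q)] r c \<in> vanishing"
    unfolding vanishing_def mem_Collect_eq
    by (intro allI W.exchange_transfer[OF R[unfolded X.pc_two_iff[OF finJ]] _ rc] Xi_rel
        subsetD[OF rel] mx_relI)
qed

lemma vanishing_absorb:
  assumes rel: "mx_rel J (mx_prod J [const_mx (K_mx s l q), mx_2 (Lmat b), mx_1 (Lmat b)])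
      (const_mx (K_mx s l q)) \<subseteq> U_rels s l q"
    and K: "X.pc J [Km, mx_swap (W.cocycle b b)] [Km]"
  shows "mx_rel J (mx_prod J [const_mx (K_mx s l q), mx_2 (Lmat b), mx_1 (Lmat b)])
      (const_mx (K_mx s l q)) \<subseteq> vanishing"
proof (rule mx_rel_subset)
  fix r c assume rc: "r \<in> J" "c \<in> J"
  have K': "X.mxc J (mx_mult J Km (mx_swap (W.cocycle b b))) Km"
    using K by (simp add: X.pc_def X.mxc_def mx_mult_one_right flip: mx_mult_assoc)
  show "mx_prod J [const_mx (K_mx s l q), mx_2 (Lmat b), mx_1 (Lmat b)] r c
      - const_mx (K_mx s l q) r c \<in> vanishing"
    unfolding vanishing_def mem_Collect_eq
    by (intro allI W.absorb_transfer[OF K' _ rc] Xi_rel subsetD[OF rel] mx_relI)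
qed

text \<open>
  Of the sum over $k$ only $k=i$ survives, because $L$ and $\Phi$ are triangular of the
  same kind.
\<close>

lemma T_diag:
  assumes i: "i \<in> I"
  shows "T (Lmat b i i) f \<approx> const (Phi_diag b i) * Xi (Lmat b i i) f"
proof -
  have "T (Lmat b i i) f \<approx> (\<Sum>k\<in>I. Xi (Lmat b i k) f * Phi b k i)" by (rule W.tw_L[OF i i])
  also have "\<dots> \<approx> (\<Sum>k\<in>I. if k = i then const (Phi_diag b i) * Xi (Lmat b i i) f else 0)"
  proof (rule X.sum)
    fix k assume k: "k \<in> I"
    consider "k = i" | "\<not> tri b i k" | "\<not> tri b k i" using tri_antisym by blast
    then show "Xi (Lmat b i k) f * Phi b k i \<approx> (if k = i then const (Phi_diag b i) * Xi (Lmat b i i) f else 0)"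
    proof cases
      case 1
      then show ?thesis using Phi_entries(2)[OF i i, of b] by (simp add: const_commute)
    next
      case 2
      then have "k \<noteq> i" by auto
      with 2 show ?thesis
        using X.mult[OF X.act_zero_left[of f] X.refl[of "Phi b k i"]] by (simp add: Lmat_eq)
    next
      case 3
      then have "k \<noteq> i" by auto
      with 3 show ?thesis by (simp add: Phi_entries(1)[OF k i])
    qed
  qed
  also have "\<dots> = const (Phi_diag b i) * Xi (Lmat b i i) f" using i by simp
  finally show ?thesis .
qed

lemma T_diag_prod:
  assumes "\<forall>x\<in>set xs. snd x \<in> I"
  shows "T (prod_list (map (\<lambda>x. Lmat (fst x) (snd x) (snd x)) xs)) f
    \<approx> const (prod_list (map (\<lambda>x. Phi_diag (fst x) (snd x)) xs))
        * Xi (prod_list (map (\<lambda>x. Lmat (fst x) (snd x) (snd x)) xs)) f"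
  using assms
proof (induction xs)
  case Nil
  have "T 1 f \<approx> f" by (rule T.act_one)
  also have "f \<approx> Xi 1 f" by (rule X.sym[OF X.act_one])
  finally show ?case by simp
next
  case (Cons x xs)
  let ?L = "Lmat (fst x) (snd x) (snd x)" and ?P = "prod_list (map (\<lambda>x. Lmat (fst x) (snd x) (snd x)) xs)"
  let ?c = "Phi_diag (fst x) (snd x)" and ?e = "prod_list (map (\<lambda>x. Phi_diag (fst x) (snd x)) xs)"
  have x: "snd x \<in> I" using Cons.prems by simp
  have "T (?L * ?P) f \<approx> T ?L (T ?P f)" by (rule T.act_mult)
  also have "\<dots> \<approx> T ?L (const ?e * Xi ?P f)" using Cons by (intro T.act_cong) simp
  also have "\<dots> \<approx> const ?e * T ?L (Xi ?P f)" by (rule T.act_const)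
  also have "\<dots> \<approx> const ?e * (const ?c * Xi ?L (Xi ?P f))" by (intro X.scale T_diag x)
  also have "\<dots> \<approx> const ?e * (const ?c * Xi (?L * ?P) f)" by (intro X.scale X.sym[OF X.act_mult])
  also have "\<dots> = const (?c * ?e) * Xi (?L * ?P) f"
    by (simp only: const_mult const_commute[of ?c "const ?e"] mult.assoc)
  finally show ?case by simp
qed

text \<open>
  Diagonal generators act as under $\xi$, up to the scalar on the diagonal of $\Phi$. This
  settles the relations between the diagonals of $L^+$ and $L^-$ and the determinant relation
  together.
\<close>

lemma vanishing_diag_prod:
  assumes "\<forall>x\<in>set xs. snd x \<in> I" and "prod_list (map (\<lambda>x. Phi_diag (fst x) (snd x)) xs) = 1"
    and rel: "prod_list (map (\<lambda>x. Lmat (fst x) (snd x) (snd x)) xs) - 1 \<in> U_rels s l q"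
  shows "prod_list (map (\<lambda>x. Lmat (fst x) (snd x) (snd x)) xs) - 1 \<in> vanishing"
  unfolding vanishing_def mem_Collect_eq
proof
  fix f
  let ?P = "prod_list (map (\<lambda>x. Lmat (fst x) (snd x) (snd x)) xs)"
  have "T ?P f \<approx> Xi ?P f" using T_diag_prod[OF assms(1), of f] assms(2) by simp
  moreover have "Xi ?P f - Xi 1 f \<approx> 0"
    by (rule X.trans[OF X.sym[OF X.act_diff_left] Xi_rel[OF rel]])
  then have "Xi ?P f \<approx> Xi 1 f" by (rule X.diff_zero[THEN iffD1])
  ultimately have "T ?P f \<approx> T 1 f" by (meson X.act_one T.act_one X.sym X.trans)
  then have "T ?P f - T 1 f \<approx> 0" by (rule X.diff_zero[THEN iffD2])
  then show "T (?P - 1) f \<approx> 0" by (rule X.trans[OF T.act_diff_left])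
qed

lemma vanishing_zero: "0 \<in> vanishing"
  by (simp add: vanishing_def T.act_zero_left)

lemma vanishing_diag:
  assumes rel: "mx_rel I (mx_prod I [mx_diag (Lmat b), mx_diag (Lmat (\<not> b))]) mx_one \<subseteq> U_rels s l q"
  shows "mx_rel I (mx_prod I [mx_diag (Lmat b), mx_diag (Lmat (\<not> b))]) mx_one \<subseteq> vanishing"
proof (rule mx_rel_subset)
  fix i j assume ij: "i \<in> I" "j \<in> I"
  have "mx_mult I (mx_diag (Lmat b)) (mx_diag (Lmat (\<not> b))) i j = (\<Sum>k\<in>I. if k = i then
      (if i = j then Lmat b i i * Lmat (\<not> b) i i else 0) else 0)"
    unfolding mx_mult_def by (rule sum.cong) (simp_all add: mx_diag_def)
  then have e: "mx_prod I [mx_diag (Lmat b), mx_diag (Lmat (\<not> b))] i j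
      = (if i = j then Lmat b i i * Lmat (\<not> b) i i else 0)"
    using ij by (simp add: mx_mult_one_right flip: mx_mult_assoc)
  have r: "mx_prod I [mx_diag (Lmat b), mx_diag (Lmat (\<not> b))] i j - mx_one i j \<in> U_rels s l q"
    by (rule subsetD[OF rel mx_relI[OF ij]])
  show "mx_prod I [mx_diag (Lmat b), mx_diag (Lmat (\<not> b))] i j - mx_one i j \<in> vanishing"
  proof (cases "i = j")
    case True
    have "Phi_diag b i * Phi_diag (\<not> b) i = 1" using d_nonzero[OF ij(1)] by (simp add: Phi_diag_def)
    then show ?thesis
      using vanishing_diag_prod[of "[(b, i), (\<not> b, i)]"] r ij unfolding e by (simp add: True mx_one_def)
  next
    case False
    then show ?thesis unfolding e by (simp add: mx_one_def vanishing_zero)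
  qed
qed

lemma vanishing_det: "prod_list (map (\<lambda>i. Lplus i i) [1..<vdim s l + 1]) - 1 \<in> vanishing"
proof -
  let ?xs = "map (Pair True) [1..<vdim s l + 1]"
  have L: "map (\<lambda>x. Lmat (fst x) (snd x) (snd x)) ?xs = map (\<lambda>i. Lplus i i) [1..<vdim s l + 1]"
    by (simp only: map_map o_def fst_conv snd_conv Lmat_def if_True)
  have "prod_list (map (\<lambda>i. 1 / d i) ns) = 1 / prod_list (map d ns)" for ns
    by (induction ns) simp_all
  then have "prod_list (map (\<lambda>x. Phi_diag (fst x) (snd x)) ?xs) = 1"
    using d_prod by (simp only: map_map o_def fst_conv snd_conv Phi_diag_def if_True div_by_1)
  moreover have "\<forall>x\<in>set ?xs. snd x \<in> I" by (auto simp: idx_def)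
  moreover have "prod_list (map (\<lambda>x. Lmat (fst x) (snd x) (snd x)) ?xs) - 1 \<in> U_rels s l q"
    unfolding L unfolding U_rels_def Let_def
    by (rule UnI1, rule UnI2, rule singletonI)
  ultimately have "prod_list (map (\<lambda>x. Lmat (fst x) (snd x) (snd x)) ?xs) - 1 \<in> vanishing"
    by (intro vanishing_diag_prod)
  then show ?thesis unfolding L .
qed

lemma U_rels_vanish: "U_rels s l q \<subseteq> vanishing"
proof -
  note parts = U_rels_def[of s l q, unfolded Let_def idx2_def]
  let ?R = "const_mx (R_mx s l q) :: (nat \<times> nat, ugen falg) mx"
    and ?K = "const_mx (K_mx s l q) :: (nat \<times> nat, ugen falg) mx"
  \<comment> \<open>The relators are a union of seven families, nested to the left; the chains of rules select one of them.\<close>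
  have 1: "mx_rel J (mx_prod J [?R, mx_2 Lplus, mx_1 Lplus]) (mx_prod J [mx_1 Lplus, mx_2 Lplus, ?R]) \<subseteq> vanishing"
    by (rule vanishing_exchange[of True True, OF _ exchange_plus_plus, unfolded Lmat_def if_True], unfold parts)
       (rule le_supI1, rule le_supI1, rule le_supI1, rule le_supI1, rule le_supI1, rule le_supI1, rule order_refl)
  have 2: "mx_rel J (mx_prod J [?R, mx_2 Lminus, mx_1 Lminus]) (mx_prod J [mx_1 Lminus, mx_2 Lminus, ?R]) \<subseteq> vanishing"
    by (rule vanishing_exchange[of False False, OF _ exchange_minus_minus, unfolded Lmat_def if_False], unfold parts)
       (rule le_supI1, rule le_supI1, rule le_supI1, rule le_supI1, rule le_supI1, rule le_supI2, rule order_refl)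
  have 3: "mx_rel J (mx_prod J [?R, mx_2 Lplus, mx_1 Lminus]) (mx_prod J [mx_1 Lminus, mx_2 Lplus, ?R]) \<subseteq> vanishing"
    by (rule vanishing_exchange[of True False, OF _ exchange_plus_minus, unfolded Lmat_def if_True if_False], unfold parts)
       (rule le_supI1, rule le_supI1, rule le_supI1, rule le_supI1, rule le_supI2, rule order_refl)
  have 4: "mx_rel I (mx_prod I [mx_diag Lplus, mx_diag Lminus]) mx_one \<subseteq> vanishing"
    by (rule vanishing_diag[of True, unfolded Lmat_def not_True_eq_False if_True if_False], unfold parts)
       (rule le_supI1, rule le_supI1, rule le_supI1, rule le_supI2, rule order_refl)
  have 5: "mx_rel I (mx_prod I [mx_diag Lminus, mx_diag Lplus]) mx_one \<subseteq> vanishing"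
    by (rule vanishing_diag[of False, unfolded Lmat_def not_False_eq_True if_True if_False], unfold parts)
       (rule le_supI1, rule le_supI1, rule le_supI2, rule order_refl)
  have 6: "{prod_list (map (\<lambda>i. Lplus i i) [1..<vdim s l + 1]) - 1} \<subseteq> vanishing"
    using vanishing_det by simp
  have 7: "(if s = TypeA then {} else mx_rel J (mx_prod J [?K, mx_2 Lplus, mx_1 Lplus]) ?K
      \<union> mx_rel J (mx_prod J [?K, mx_2 Lminus, mx_1 Lminus]) ?K) \<subseteq> vanishing"
  proof (cases "s = TypeA")
    case False
    note parts' = parts[unfolded if_not_P[OF False]]
    have "mx_rel J (mx_prod J [?K, mx_2 Lplus, mx_1 Lplus]) ?K \<subseteq> vanishing"
      by (rule vanishing_absorb[of True, OF _ absorb_plus, unfolded Lmat_def if_True], unfold parts')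
         (rule le_supI2, rule le_supI1, rule order_refl)
    moreover have "mx_rel J (mx_prod J [?K, mx_2 Lminus, mx_1 Lminus]) ?K \<subseteq> vanishing"
      by (rule vanishing_absorb[of False, OF _ absorb_minus, unfolded Lmat_def if_False], unfold parts')
         (rule le_supI2, rule le_supI2, rule order_refl)
    ultimately show ?thesis unfolding if_not_P[OF False] by (rule Un_least)
  qed simp
  show ?thesis unfolding parts by (intro Un_least 1 2 3 4 5 6 7)
qed

lemma T_up:
  assumes "a \<in> carrier (U_free s l)" "b \<in> carrier (U_free s l)" "up a = up b"
  shows "T a f \<approx> T b f"
proof -
  have "retr (U_gens s l) (a - b) \<in> vanishing"
  proof (rule U.pres_kernel[OF assms(3) U_rels_vanish vanishing_zero])
    fix x y
    show "x + y \<in> vanishing" if xy: "x \<in> vanishing" "y \<in> vanishing"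
      unfolding vanishing_def mem_Collect_eq
    proof
      fix f
      have "T (x + y) f \<approx> T x f + T y f" by (rule T.act_add_left)
      also have "\<dots> \<approx> 0 + 0" using xy by (intro X.add) (simp_all add: vanishing_def)
      finally show "T (x + y) f \<approx> 0" by simp
    qed
    show "y * x \<in> vanishing" if x: "x \<in> vanishing"
      unfolding vanishing_def mem_Collect_eq
    proof
      fix f
      have "T (y * x) f \<approx> T y (T x f)" by (rule T.act_mult)
      also have "\<dots> \<approx> T y 0" using x by (intro T.act_cong) (simp add: vanishing_def)
      also have "\<dots> \<approx> 0" by (rule T.act_zero)
      finally show "T (y * x) f \<approx> 0" .
    qed
    show "x * y \<in> vanishing" if x: "x \<in> vanishing"
      unfolding vanishing_def mem_Collect_eq
    proof
      fix f
      have "T (x * y) f \<approx> T x (T y f)" by (rule T.act_mult)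
      also have "\<dots> \<approx> 0" using x by (simp add: vanishing_def)
      finally show "T (x * y) f \<approx> 0" .
    qed
  qed
  then have "a - b \<in> vanishing" using assms(1,2) by (simp add: U_free_def in_free_algebra_iff retr_diff)
  then have "T (a - b) f \<approx> 0" by (simp add: vanishing_def)
  then have "T a f - T b f \<approx> 0" by (rule X.trans[OF X.sym[OF T.act_diff_left]])
  then show ?thesis by (rule X.diff_zero[THEN iffD1])
qed

section \<open>The twisted action on the quotient\<close>

definition rep :: "ugen falg set \<Rightarrow> ugen falg" where
  "rep x = (SOME a. a \<in> carrier (U_free s l) \<and> up a = x)"

definition twisted_act :: "ugen falg set \<Rightarrow> (nat \<times> nat) falg set \<Rightarrow> (nat \<times> nat) falg set" where
  "twisted_act x f = cp (T (rep x) (lift f))"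

lemma twisted_act_eq:
  assumes a: "a \<in> carrier (U_free s l)"
  shows "twisted_act (up a) (cp f) = cp (T a f)"
proof -
  have "\<exists>b. b \<in> carrier (U_free s l) \<and> up b = up a" using a by blast
  then have r: "rep (up a) \<in> carrier (U_free s l)" "up (rep (up a)) = up a"
    unfolding rep_def by (metis (mono_tags, lifting) someI_ex)+
  have "T (rep (up a)) (lift (cp f)) \<approx> T a (lift (cp f))" by (rule T_up[OF r(1) a r(2)])
  also have "\<dots> \<approx> T a f"
    using cp_lift[OF CA(5)[of f]] by (intro T.act_cong) (simp add: C.eqv_def)
  finally show ?thesis by (simp add: twisted_act_def C.eqv_def)
qed

lemma U_free_closed:
  "a \<in> carrier (U_free s l) \<Longrightarrow> b \<in> carrier (U_free s l) \<Longrightarrow> a + b \<in> carrier (U_free s l)"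
  "a \<in> carrier (U_free s l) \<Longrightarrow> b \<in> carrier (U_free s l) \<Longrightarrow> a * b \<in> carrier (U_free s l)"
  "const c \<in> carrier (U_free s l)" "1 \<in> carrier (U_free s l)"
  by (simp_all add: U_free_def in_free_algebra_iff retr_add retr_mult)

lemma twisted_act_action: "is_left_action UA CA twisted_act"
  unfolding is_left_action_def
proof (intro conjI ballI)
  fix x assume "x \<in> carrier UA"
  then obtain a where a: "a \<in> carrier (U_free s l)" "x = up a" by (rule UA_cases)
  show "is_linear CA CA (twisted_act x)"
    unfolding is_linear_def
  proof (intro conjI ballI allI)
    show "twisted_act x \<in> carrier CA \<rightarrow> carrier CA"
    proof
      fix f assume "f \<in> carrier CA"
      then obtain f' where "f = cp f'" by (rule CA_cases)
      then show "twisted_act x f \<in> carrier CA" by (simp only: a(2) twisted_act_eq[OF a(1)] CA(5))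
    qed
    fix f assume "f \<in> carrier CA"
    then obtain f' where f: "f = cp f'" by (rule CA_cases)
    show "twisted_act x (c \<odot>\<^bsub>CA\<^esub> f) = c \<odot>\<^bsub>CA\<^esub> twisted_act x f" for c
      using T.act_const[of a c f'] by (simp only: f a(2) CA(4) twisted_act_eq[OF a(1)] C.eqv_def)
    fix g assume "g \<in> carrier CA"
    then obtain g' where g: "g = cp g'" by (rule CA_cases)
    show "twisted_act x (f \<oplus>\<^bsub>CA\<^esub> g) = twisted_act x f \<oplus>\<^bsub>CA\<^esub> twisted_act x g"
      using T.act_add[of a f' g'] by (simp only: f g a(2) CA(2) twisted_act_eq[OF a(1)] C.eqv_def)
  qed
  fix y f assume "y \<in> carrier UA" "f \<in> carrier CA"
  then obtain b f' where b: "b \<in> carrier (U_free s l)" "y = up b" and f: "f = cp f'"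
    by (elim UA_cases CA_cases)
  show "twisted_act (x \<otimes>\<^bsub>UA\<^esub> y) f = twisted_act x (twisted_act y f)"
    using T.act_mult[of a b f']
    by (simp only: a(2) b(2) f UA(1) twisted_act_eq[OF a(1)] twisted_act_eq[OF b(1)] twisted_act_eq[OF U_free_closed(2)[OF a(1) b(1)]] C.eqv_def)
next
  fix f assume "f \<in> carrier CA"
  then obtain f' where f: "f = cp f'" by (rule CA_cases)
  show "twisted_act \<one>\<^bsub>UA\<^esub> f = f"
    using T.act_one[of f'] by (simp only: f UA(3) twisted_act_eq[OF U_free_closed(4)] C.eqv_def)
  show "is_linear UA CA (\<lambda>x. twisted_act x f)"
    unfolding is_linear_def
  proof (intro conjI ballI allI)
    show "(\<lambda>x. twisted_act x f) \<in> carrier UA \<rightarrow> carrier CA"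
    proof
      fix x assume "x \<in> carrier UA"
      then obtain a where a: "a \<in> carrier (U_free s l)" "x = up a" by (rule UA_cases)
      then show "twisted_act x f \<in> carrier CA" by (simp only: f twisted_act_eq[OF a(1)] CA(5))
    qed
    fix x assume "x \<in> carrier UA"
    then obtain a where a: "a \<in> carrier (U_free s l)" "x = up a" by (rule UA_cases)
    show "twisted_act (c \<odot>\<^bsub>UA\<^esub> x) f = c \<odot>\<^bsub>CA\<^esub> twisted_act x f" for c
      using T.act_const_left[of c a f']
      by (simp only: f a(2) UA(4) CA(4) twisted_act_eq[OF a(1)] twisted_act_eq[OF U_free_closed(2)[OF U_free_closed(3) a(1)]] C.eqv_def)
    fix y assume "y \<in> carrier UA"
    then obtain b where b: "b \<in> carrier (U_free s l)" "y = up b" by (rule UA_cases)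
    show "twisted_act (x \<oplus>\<^bsub>UA\<^esub> y) f = twisted_act x f \<oplus>\<^bsub>CA\<^esub> twisted_act y f"
      using T.act_add_left[of a b f']
      by (simp only: f a(2) b(2) UA(2) CA(2) twisted_act_eq[OF a(1)] twisted_act_eq[OF b(1)] twisted_act_eq[OF U_free_closed(1)[OF a(1) b(1)]] C.eqv_def)
  qed
qed

definition phi :: "ugen falg set \<Rightarrow> (nat \<times> nat) falg set" where
  "phi x = twisted_act x \<one>\<^bsub>CA\<^esub>"

lemma phi_eq: "a \<in> carrier (U_free s l) \<Longrightarrow> phi (up a) = cp (T a 1)"
  unfolding phi_def CA(3) by (rule twisted_act_eq)

lemma phi_Lmat:
  assumes ij: "i \<in> I" "j \<in> I"
  shows "phi (U_cls s l q (Lmat b i j)) = cp (Phi b i j)"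
proof -
  have "T (Lmat b i j) 1 \<approx> (\<Sum>k\<in>I. Xi (Lmat b i k) 1 * Phi b k j)" by (rule W.tw_L[OF ij])
  also have "\<dots> \<approx> (\<Sum>k\<in>I. (if i = k then 1 else 0) * Phi b k j)"
    by (intro X.sum X.mult X.refl Xi_unit ij)
  also have "\<dots> = Phi b i j" using ij by (simp add: if_distrib[of "\<lambda>x. x * _"] cong: if_cong)
  finally show ?thesis
    by (simp only: U_cls[OF Lmat_in[OF ij]] phi_eq[OF Lmat_in[OF ij]] C.eqv_def)
qed

section \<open>The Sweedler formula for the twisted action\<close>

text \<open>
  The twisted action is compatible with products like a module algebra action: $T$ acts on
  the right factor and $\xi$ on the left one.
\<close>

lemma T_product:
  assumes ij: "i \<in> I" "j \<in> I"
  shows "T (Lmat b i j) (f * g) \<approx> (\<Sum>k\<in>I. Xi (Lmat b i k) f * T (Lmat b k j) g)"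
proof -
  have "T (Lmat b i j) (f * g) \<approx> (\<Sum>m\<in>I. Xi (Lmat b i m) (f * g) * Phi b m j)" by (rule W.tw_L[OF ij])
  also have "\<dots> \<approx> (\<Sum>m\<in>I. (\<Sum>k\<in>I. Xi (Lmat b i k) f * Xi (Lmat b k m) g) * Phi b m j)"
    by (intro X.sum X.mult X.refl Xi_product ij)
  also have "\<dots> = (\<Sum>k\<in>I. Xi (Lmat b i k) f * (\<Sum>m\<in>I. Xi (Lmat b k m) g * Phi b m j))"
    unfolding sum_distrib_left sum_distrib_right mult.assoc by (rule sum.swap)
  also have "\<dots> \<approx> (\<Sum>k\<in>I. Xi (Lmat b i k) f * T (Lmat b k j) g)"
    by (intro X.sum X.scale X.sym[OF W.tw_L] ij)
  finally show ?thesis .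
qed

text \<open>
  The value of $(\xi_uf)\,\varphi(v)$ at a pair of words. The retraction makes $\varphi(v)$
  depend on the class only, also for words that are not in the generators.
\<close>

definition sweedler_term :: "(nat \<times> nat) falg \<Rightarrow> ugen word \<times> ugen word \<Rightarrow> (nat \<times> nat) falg" where
  "sweedler_term f p = Xi (Poly_Mapping.single (fst p) 1) f
      * T (retr (U_gens s l) (Poly_Mapping.single (snd p) 1)) 1"

lemma single_Cons: "Poly_Mapping.single (Word [g] + u) 1 = gen g * Poly_Mapping.single u (1 :: complex)"
  by (simp add: gen_def mult_single)

text \<open>
  Splitting off the first letter $L_{ij}$, the comultiplication contributes
  $\sum_kL_{ik}\otimes L_{kj}$, and \<open>T_product\<close> produces the same sum.
\<close>

lemma sweedler_word:
  assumes "set w \<subseteq> U_gens s l"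
  shows "T (Poly_Mapping.single (Word w) 1) f \<approx> lin (sweedler_term f) (comult s l (Poly_Mapping.single (Word w) 1))"
  using assms
proof (induction w)
  case Nil
  have "f * 1 \<approx> Xi 1 f * T 1 1" by (intro X.mult X.sym[OF X.act_one] X.sym[OF T.act_one])
  then have "f \<approx> Xi 1 f * T 1 1" by simp
  with T.act_one[of f] have "T 1 f \<approx> Xi 1 f * T 1 1" by (rule X.trans)
  moreover have "lin (sweedler_term f) 1 = Xi 1 f * T 1 1"
    using lin_single[of "sweedler_term f" 0 1] by (simp add: sweedler_term_def)
  moreover have "Poly_Mapping.single (Word []) 1 = (1 :: ugen falg)"
    by (simp add: zero_word_def[symmetric])
  ultimately show ?case unfolding comult_single_Nil by simp
next
  case (Cons g w)
  have "g \<in> U_gens s l" using Cons.prems by simp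
  then obtain b i j where g: "i \<in> I" "j \<in> I" "tri b i j" "g = Lgen b i j"
    by (rule U_gens_cases)
  let ?w = "Poly_Mapping.single (Word w) (1 :: complex)"
  let ?y = "comult s l ?w"
  let ?A = "\<lambda>p :: ugen word \<times> ugen word. Xi (Poly_Mapping.single (fst p) 1) f"
    and ?B = "\<lambda>p :: ugen word \<times> ugen word. T (retr (U_gens s l) (Poly_Mapping.single (snd p) 1)) 1"
  have "Word (g # w) = Word [g] + Word w" by (simp add: plus_word_def)
  then have gw: "Poly_Mapping.single (Word (g # w)) 1 = Lmat b i j * ?w"
    using g by (simp only: single_Cons Lmat_eq if_True)
  have k: "lin (\<lambda>p. Xi (Lmat b i k) (?A p) * T (Lmat b k j) (?B p)) ?y
      \<approx> lin (sweedler_term f) (tens (Lmat b i k) (Lmat b k j) * ?y)" if k: "k \<in> I" for k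
  proof (cases "tri b i k \<and> tri b k j")
    case True
    let ?g1 = "Lgen b i k" and ?g2 = "Lgen b k j"
    have g2: "?g2 \<in> U_gens s l" using True k g by (intro Lgen_in) auto
    have "lin (\<lambda>p. Xi (Lmat b i k) (?A p) * T (Lmat b k j) (?B p)) ?y
        \<approx> lin (\<lambda>p. sweedler_term f ((Word [?g1], Word [?g2]) + p)) ?y"
    proof (rule G.lin_cong)
      fix p :: "ugen word \<times> ugen word"
      have "Xi (gen ?g1) (?A p) * T (gen ?g2) (?B p)
          \<approx> Xi (gen ?g1 * Poly_Mapping.single (fst p) 1) f
            * T (gen ?g2 * retr (U_gens s l) (Poly_Mapping.single (snd p) 1)) 1"
        by (intro X.mult X.sym[OF X.act_mult] X.sym[OF T.act_mult])
      also have "\<dots> = sweedler_term f ((Word [?g1], Word [?g2]) + p)"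
        using g2 by (simp add: sweedler_term_def single_Cons retr_mult retr_gen)
      finally show "Xi (Lmat b i k) (?A p) * T (Lmat b k j) (?B p) \<approx> sweedler_term f ((Word [?g1], Word [?g2]) + p)"
        using True by (simp add: Lmat_eq)
    qed
    also have "\<dots> = lin (sweedler_term f) (tens (Lmat b i k) (Lmat b k j) * ?y)"
      using True by (simp add: tens_Lmat lin_single_mult)
    finally show ?thesis .
  next
    case False
    then have "Lmat b i k = 0 \<or> Lmat b k j = 0" by (auto simp: Lmat_eq)
    then have "Xi (Lmat b i k) (?A p) * T (Lmat b k j) (?B p) \<approx> 0" for p
      using X.mult[OF X.act_zero_left X.refl[of "T (Lmat b k j) (?B p)"], of "?A p"]
        X.mult[OF X.refl[of "Xi (Lmat b i k) (?A p)"] T.act_zero_left, of "?B p"] by auto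
    then have "lin (\<lambda>p. Xi (Lmat b i k) (?A p) * T (Lmat b k j) (?B p)) ?y \<approx> lin (\<lambda>p. 0) ?y"
      by (rule G.lin_cong)
    also have "lin (\<lambda>p. 0) ?y = (0 :: (nat \<times> nat) falg)" by (simp add: lin_def)
    finally show ?thesis unfolding tens_Lmat if_not_P[OF False] by simp
  qed
  have "T (Lmat b i j * ?w) f \<approx> T (Lmat b i j) (T ?w f)" by (rule T.act_mult)
  also have "\<dots> \<approx> T (Lmat b i j) (lin (sweedler_term f) ?y)" using Cons by (intro T.act_cong) simp
  also have "\<dots> \<approx> lin (\<lambda>p. T (Lmat b i j) (sweedler_term f p)) ?y" by (rule T.act_lin)
  also have "\<dots> \<approx> lin (\<lambda>p. \<Sum>k\<in>I. Xi (Lmat b i k) (?A p) * T (Lmat b k j) (?B p)) ?y"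
    unfolding sweedler_term_def by (intro G.lin_cong T_product g)
  also have "\<dots> = (\<Sum>k\<in>I. lin (\<lambda>p. Xi (Lmat b i k) (?A p) * T (Lmat b k j) (?B p)) ?y)"
    by (rule lin_fun_sum)
  also have "\<dots> \<approx> (\<Sum>k\<in>I. lin (sweedler_term f) (tens (Lmat b i k) (Lmat b k j) * ?y))"
    by (intro X.sum k)
  also have "\<dots> = lin (sweedler_term f) (comult s l (Poly_Mapping.single (Word (g # w)) 1))"
    unfolding g(4) comult_single_Cons sum_distrib_right by (rule lin_sum[symmetric])
  finally show ?case unfolding gw .
qed

lemma sweedler_T:
  assumes a: "a \<in> carrier (U_free s l)"
  shows "T a f \<approx> lin (sweedler_term f) (comult s l a)"
proof -
  have "T a f = (\<Sum>w\<in>Poly_Mapping.keys a. const (Poly_Mapping.lookup a w) * T (Poly_Mapping.single w 1) f)"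
    by (simp add: G.ext_def lin_single lin_def[of _ a])
  also have "\<dots> \<approx> (\<Sum>w\<in>Poly_Mapping.keys a. const (Poly_Mapping.lookup a w) * lin (sweedler_term f) (comult s l (Poly_Mapping.single w 1)))"
  proof (intro X.sum X.scale)
    fix w assume "w \<in> Poly_Mapping.keys a"
    then have "set (letters w) \<subseteq> U_gens s l" using a by (auto simp: U_free_def free_algebra_def)
    then show "T (Poly_Mapping.single w 1) f \<approx> lin (sweedler_term f) (comult s l (Poly_Mapping.single w 1))"
      using sweedler_word[of "letters w" f] by simp
  qed
  also have "\<dots> = lin (sweedler_term f) (comult s l a)"
    unfolding comult_words[of s l a] lin_sum lin_const ..
  finally show ?thesis .
qed

lemma twisted_act_sweedler:
  assumes a: "a \<in> carrier (U_free s l)" and f: "f \<in> carrier CA"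
  shows "twisted_act (U_cls s l q a) f = sweedler s l q CA (\<lambda>x1 x2. \<xi> x1 f \<otimes>\<^bsub>CA\<^esub> phi x2) a"
proof -
  obtain f' where f': "f = cp f'" using f by (rule CA_cases)
  have phi_up: "phi (up y) = cp (T (retr (U_gens s l) y) 1)" for y
  proof -
    have "up y = up (retr (U_gens s l) y)" by (simp add: pres_def)
    then show ?thesis using phi_eq[of "retr (U_gens s l) y"] by (simp add: U_free_def in_free_algebra_iff)
  qed
  have "sweedler s l q CA (\<lambda>x1 x2. \<xi> x1 f \<otimes>\<^bsub>CA\<^esub> phi x2) a
      = cp (lin (\<lambda>p. Xi (Poly_Mapping.single (fst p) 1) f'
          * T (retr (U_gens s l) (Poly_Mapping.single (snd p) 1)) 1) (comult s l a))"
    by (rule sweedler_cp[OF a]) (simp only: f' phi_up cp_Xi[symmetric] CA(1))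
  also have "(\<lambda>p. Xi (Poly_Mapping.single (fst p) 1) f'
          * T (retr (U_gens s l) (Poly_Mapping.single (snd p) 1)) 1) = sweedler_term f'"
    by (intro ext) (simp only: sweedler_term_def)
  also have "cp (lin (sweedler_term f') (comult s l a)) = cp (T a f')"
    using sweedler_T[OF a, of f'] by (simp only: C.eqv_def)
  also have "\<dots> = twisted_act (U_cls s l q a) f" by (simp only: U_cls[OF a] f' twisted_act_eq[OF a])
  finally show ?thesis ..
qed

lemma C_cls_Phi:
  assumes ij: "i \<in> I" "j \<in> I"
  shows "C_cls s l q (Phi b i j) = cp (Phi b i j)"
proof (rule C_cls)
  have "fixed_on (C_gens s l) I (Phi b)"
    unfolding Phi_def by (auto intro!: fixed_prod fixed_mult intro: fixed_const fixed_Zstar fixed_Winv fixed_one)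
  then show "retr (C_gens s l) (Phi b i j) = Phi b i j" using ij by (simp add: fixed_on_def)
qed

lemma twisted_action:
  "is_linear UA CA phi \<and>
    (\<forall>i\<in>I. \<forall>j\<in>I.
       phi (U_cls s l q (Lplus i j)) = C_cls s l q (const (mx_inv I Dm i j)) \<and>
       phi (U_cls s l q (Lminus i j)) =
         C_cls s l q (mx_prod I [Zstar, const_mx Dm, const_mx Dm, mx_inv I Zstar,
           const_mx (mx_inv I Dm)] i j)) \<and>
    phi \<one>\<^bsub>UA\<^esub> = \<one>\<^bsub>CA\<^esub> \<and>
    (\<forall>a\<in>carrier (U_free s l). \<forall>y\<in>carrier UA.
       phi (U_cls s l q a \<otimes>\<^bsub>UA\<^esub> y) =
         sweedler s l q CA (\<lambda>x1 x2. \<xi> x1 (phi y) \<otimes>\<^bsub>CA\<^esub> phi x2) a) \<and>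
    (\<exists>act.
       (\<forall>a\<in>carrier (U_free s l). \<forall>f\<in>carrier CA.
          act (U_cls s l q a) f =
            sweedler s l q CA (\<lambda>x1 x2. \<xi> x1 f \<otimes>\<^bsub>CA\<^esub> phi x2) a) \<and>
       is_left_action UA CA act \<and>
       (\<forall>x\<in>carrier UA. act x \<one>\<^bsub>CA\<^esub> = phi x))"
proof (intro conjI ballI exI[of _ twisted_act])
  have one: "\<one>\<^bsub>CA\<^esub> \<in> carrier CA" unfolding CA(3) by (rule CA(5))
  have phi: "phi = (\<lambda>x. twisted_act x \<one>\<^bsub>CA\<^esub>)" by (intro ext) (rule phi_def)
  show "is_linear UA CA phi"
    unfolding phi by (rule left_action_linear[OF twisted_act_action one])
  fix i j assume ij: "i \<in> I" "j \<in> I"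
  show "phi (U_cls s l q (Lplus i j)) = C_cls s l q (const (mx_inv I Dm i j))"
    using phi_Lmat[OF ij, of True] C_cls_Phi[OF ij, of True] by (simp only: Lmat_def Phi_def const_mx_def if_True)
  show "phi (U_cls s l q (Lminus i j)) = C_cls s l q (mx_prod I [Zstar, const_mx Dm, const_mx Dm,
      mx_inv I Zstar, const_mx (mx_inv I Dm)] i j)"
    using phi_Lmat[OF ij, of False] C_cls_Phi[OF ij, of False]
    by (simp only: Lmat_def Phi_def if_False Winv_def)
next
  show "phi \<one>\<^bsub>UA\<^esub> = \<one>\<^bsub>CA\<^esub>"
    unfolding phi_def by (rule left_action_one[OF twisted_act_action]) (simp only: CA(3) CA(5))
next
  fix a y assume a: "a \<in> carrier (U_free s l)" and y: "y \<in> carrier UA"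
  have one: "\<one>\<^bsub>CA\<^esub> \<in> carrier CA" unfolding CA(3) by (rule CA(5))
  obtain b where b: "b \<in> carrier (U_free s l)" "y = up b" using y by (rule UA_cases)
  have "phi y \<in> carrier CA" unfolding b(2) phi_eq[OF b(1)] by (rule CA(5))
  then have "twisted_act (U_cls s l q a) (phi y) = sweedler s l q CA (\<lambda>x1 x2. \<xi> x1 (phi y) \<otimes>\<^bsub>CA\<^esub> phi x2) a"
    by (rule twisted_act_sweedler[OF a])
  moreover have "U_cls s l q a \<in> carrier UA" unfolding U_cls[OF a] by (rule UA(5))
  then have "phi (U_cls s l q a \<otimes>\<^bsub>UA\<^esub> y) = twisted_act (U_cls s l q a) (phi y)"
    unfolding phi_def by (rule left_action_mult[OF twisted_act_action _ y one])
  ultimately show "phi (U_cls s l q a \<otimes>\<^bsub>UA\<^esub> y) =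
         sweedler s l q CA (\<lambda>x1 x2. \<xi> x1 (phi y) \<otimes>\<^bsub>CA\<^esub> phi x2) a" by simp
next
  show "is_left_action UA CA twisted_act" by (rule twisted_act_action)
  show "twisted_act x \<one>\<^bsub>CA\<^esub> = phi x" for x by (simp only: phi_def)
  show "twisted_act (U_cls s l q a) f = sweedler s l q CA (\<lambda>x1 x2. \<xi> x1 f \<otimes>\<^bsub>CA\<^esub> phi x2) a"
    if "a \<in> carrier (U_free s l)" "f \<in> carrier CA" for a f
    by (rule twisted_act_sweedler[OF that])
qed

end

section \<open>The linear map and the left action\<close>

theorem mainTheorem4:
  fixes s :: series and l :: nat and q :: real
    and Dm :: "(nat, complex) mx"
    and \<xi> :: "ugen falg set \<Rightarrow> (nat \<times> nat) falg set \<Rightarrow> (nat \<times> nat) falg set"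
  defines "N \<equiv> vdim s l"
    and "I \<equiv> idx s l"
    and "J \<equiv> idx2 s l"
    and "U \<equiv> U_alg s l q"
    and "CA \<equiv> C_alg s l q"
    and "K \<equiv> K_mx s l q"
  assumes simple: "simple_type s l"
    and q: "q > 0" "q \<noteq> 1"
    and xi: "is_xi s l q \<xi>"
    and D_diag: "\<forall>i\<in>I. \<forall>j\<in>I. i \<noteq> j \<longrightarrow> Dm i j = 0"
    and D_det: "det (mat N N (\<lambda>(i, j). Dm (i + 1) (j + 1))) = 1"
    and D_K: "mx_eq J (mx_prod J [K, mx_1 Dm, mx_2 Dm]) K"
  shows "\<exists>\<phi>. is_linear U CA \<phi> \<and>
    (\<forall>i\<in>I. \<forall>j\<in>I.
       \<phi> (U_cls s l q (Lplus i j)) = C_cls s l q (const (mx_inv I Dm i j)) \<and>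
       \<phi> (U_cls s l q (Lminus i j)) =
         C_cls s l q (mx_prod I [Zstar, const_mx Dm, const_mx Dm, mx_inv I Zstar,
           const_mx (mx_inv I Dm)] i j)) \<and>
    \<phi> \<one>\<^bsub>U\<^esub> = \<one>\<^bsub>CA\<^esub> \<and>
    (\<forall>a\<in>carrier (U_free s l). \<forall>y\<in>carrier U.
       \<phi> (U_cls s l q a \<otimes>\<^bsub>U\<^esub> y) =
         sweedler s l q CA (\<lambda>x1 x2. \<xi> x1 (\<phi> y) \<otimes>\<^bsub>CA\<^esub> \<phi> x2) a) \<and>
    (\<exists>act.
       (\<forall>a\<in>carrier (U_free s l). \<forall>f\<in>carrier CA.
          act (U_cls s l q a) f =
            sweedler s l q CA (\<lambda>x1 x2. \<xi> x1 f \<otimes>\<^bsub>CA\<^esub> \<phi> x2) a) \<and>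
       is_left_action U CA act \<and>
       (\<forall>x\<in>carrier U. act x \<one>\<^bsub>CA\<^esub> = \<phi> x))"
proof -
  interpret cell_action s l q Dm \<xi>
    using simple q xi D_diag D_det D_K unfolding N_def I_def J_def K_def
    by unfold_locales blast+
  show ?thesis
    unfolding I_def U_def CA_def by (rule exI[of _ phi]) (rule twisted_action)
qed

end
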